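(* A connected component $\mathcal R_0$ of the root groupoid $\mathcal R$ is admissible if and only if it is weakly symmetric.
   Context: Root groupoid. Fix a finite set $X$. A root datum is a quadruple $v=(\mathfrak h,a,b,p)$ with $\mathfrak h$ a finite-dimensional complex vector space, $a:X\to\mathfrak h$, $b:X\to\mathfrak h^*$ such that the families $(a(x))_{x\in X}$ and $(b(x))_{x\in X}$ are linearly independent, and $p:X\to\mathbb Z_2$; we write $\mathfrak h(v),a_v,b_v,p_v$. Its Cartan matrix is $a_{xy}=\langle a(x),b(y)\rangle$. An element $x\in X$ is reflectable at $v$ if: $a_{xx}=0$ implies $p(x)=1$; if $a_{xx}\ne 0$ and $p(x)=0$ then $2a_{xy}/a_{xx}\in\mathbb Z_{\le 0}$ for all $y\ne x$; if $a_{xx}\neq 0$ and $p(x)=1$ then $a_{xy}/a_{xx}\in\mathbb Z_{\le 0}$ for all $y\ne x$. For $x$ reflectable at $v$ the reflexion $r_x:v\to v'=(\mathfrak h,a',b',p')$ is defined as follows. Anisotropic case $a_{xx}\ne0$: $p'=p$, $a'(y)=a(y)-2\frac{a_{yx}}{a_{xx}}a(x)$, $b'(y)=b(y)-2\frac{a_{xy}}{a_{xx}}b(x)$. Isotropic case $a_{xx}=0$: $(a'(x),b'(x),p'(x))=(-a(x),-b(x),p(x))$; for $y\neq x$ with $a_{xy}=0$, $(a'(y),b'(y),p'(y))=(a(y),b(y),p(y))$; for $y$ with $a_{xy}\ne0$, $(a'(y),b'(y),p'(y))=(a(y)+\frac{a_{yx}}{a_{xy}}a(x),\,b(y)+b(x),\,1+p(y))$.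 The root groupoid $\mathcal R$ has the root data as objects; its arrows are generated by reflexions, tautological arrows $t_\theta:(\mathfrak h,a,b,p)\to(\mathfrak h',\theta\circ a,(\theta^* )^{-1}\circ b,p)$ for linear isomorphisms $\theta:\mathfrak h\to\mathfrak h'$, and homotheties $h_\lambda:(\mathfrak h,a,b,p)\to(\mathfrak h,\lambda a,b,p)$ for $\lambda:X\to\mathbb C^*$. Each generator induces a linear isomorphism of the spaces $\mathfrak h$ (the identity for reflexions and homotheties, $\theta$ for $t_\theta$), and two compositions of generators $v\to v'$ are identified iff they induce the same isomorphism $\mathfrak h(v)\to\mathfrak h(v')$. Weak symmetricity. A root datum is locally weakly symmetric if, for every $x$ reflectable at it and every $y\in X$, $a_{xy}=0$ implies $a_{yx}=0$. A component is weakly symmetric if all root data in it are locally weakly symmetric. Root algebras. The half-baked Lie superalgebra $\tilde{\mathfrak g}(v)$ is generated by $\mathfrak h(v)$ (even) and $\tilde e_x,\tilde f_x$ ($x\in X$, of parity $p(x)$) with relations $[\mathfrak h,\mathfrak h]=0$, $[h,\tilde e_x]=\langle b(x),h\rangle\tilde e_x$, $[h,\tilde f_x]=-\langle b(x),h\rangle\tilde f_x$, $[\tilde e_x,\tilde f_y]=0$ for $x\ne y$, $[\tilde e_x,\tilde f_x]=a(x)$. A root Lie superalgebra supported on a component $\mathcal R_0$ is a collection of quotients $\mathfrak g(v)=\tilde{\mathfrak g}(v)/I(v)$, $v\in\mathcal R_0$, with $I(v)\cap\mathfrak h(v)=0$, such that for each arrow $\alpha:v\to v'$ in $\mathcal R_0$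 the induced isomorphism $\mathfrak h(v)\to\mathfrak h(v')$ extends to an isomorphism $\mathfrak g(v)\to\mathfrak g(v')$. $\mathcal R_0$ is admissible if a root Lie superalgebra supported on it exists. *)

theory Defs
  imports "HOL-Library.Z2" "HOL-Library.Nonpos_Ints" "HOL-Algebra.Module" "HOL-Algebra.QuotRing"
begin

section \<open>Complex vector spaces\<close>

text \<open>
  A complex vector space is a \<^locale>\<open>module\<close> of HOL-Algebra over the field of complex numbers.
  The record type of modules inherits the fields \<^const>\<open>mult\<close> and \<^const>\<open>one\<close> from rings;
  they play no role for modules and are left \<^const>\<open>undefined\<close> below.
\<close>

definition complex_field :: "complex ring"
  where "complex_field = \<lparr>carrier = UNIV, mult = (*), one = 1, zero = 0, add = (+)\<rparr>"

lemma field_complex_field: "field complex_field"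
proof (rule cring.cring_fieldI2)
  show "cring complex_field"
  proof (rule cringI)
    show "abelian_group complex_field"
      by (rule abelian_groupI)
        (auto simp: complex_field_def intro: exI[of _ "- x" for x :: complex])
    show "comm_monoid complex_field"
      by (rule comm_monoidI) (auto simp: complex_field_def)
  qed (auto simp: complex_field_def algebra_simps)
  show "\<zero>\<^bsub>complex_field\<^esub> \<noteq> \<one>\<^bsub>complex_field\<^esub>"
    by (simp add: complex_field_def)
  show "\<exists>b\<in>carrier complex_field. x \<otimes>\<^bsub>complex_field\<^esub> b = \<one>\<^bsub>complex_field\<^esub>"
    if "x \<noteq> \<zero>\<^bsub>complex_field\<^esub>" for x
    using that by (intro bexI[of _ "inverse x"]) (auto simp: complex_field_def)
qed

abbreviation complex_space :: "(complex, 'a, 'm) module_scheme \<Rightarrow> bool"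
  where "complex_space V \<equiv> module complex_field V"

definition lin_comb :: "(complex, 'a, 'm) module_scheme \<Rightarrow> 'i set \<Rightarrow> ('i \<Rightarrow> 'a) \<Rightarrow> ('i \<Rightarrow> complex) \<Rightarrow> 'a"
  where "lin_comb V S u c = (\<Oplus>\<^bsub>V\<^esub>i\<in>S. c i \<odot>\<^bsub>V\<^esub> u i)"

definition finite_dim :: "(complex, 'a, 'm) module_scheme \<Rightarrow> bool"
  where "finite_dim V \<longleftrightarrow>
    (\<exists>B. finite B \<and> B \<subseteq> carrier V \<and> (\<forall>w\<in>carrier V. \<exists>c. w = lin_comb V B (\<lambda>u. u) c))"

definition lin_indep_family :: "(complex, 'a, 'm) module_scheme \<Rightarrow> 'i set \<Rightarrow> ('i \<Rightarrow> 'a) \<Rightarrow> bool"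
  where "lin_indep_family V S u \<longleftrightarrow>
    (\<forall>c. lin_comb V S u c = \<zero>\<^bsub>V\<^esub> \<longrightarrow> (\<forall>i\<in>S. c i = 0))"

text \<open>Functionals are extensional functions, so that each one is represented exactly once.\<close>

definition dual_space :: "(complex, 'a, 'm) module_scheme \<Rightarrow> (complex, 'a \<Rightarrow> complex) module"
  where "dual_space V =
    \<lparr>carrier = {f \<in> carrier V \<rightarrow>\<^sub>E UNIV.
        (\<forall>u\<in>carrier V. \<forall>w\<in>carrier V. f (u \<oplus>\<^bsub>V\<^esub> w) = f u + f w) \<and>
        (\<forall>c. \<forall>w\<in>carrier V. f (c \<odot>\<^bsub>V\<^esub> w) = c * f w)},
     mult = undefined, one = undefined,
     zero = (\<lambda>w\<in>carrier V. 0),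
     add = (\<lambda>f g. \<lambda>w\<in>carrier V. f w + g w),
     smult = (\<lambda>c f. \<lambda>w\<in>carrier V. c * f w)\<rparr>"

definition linear_iso ::
    "(complex, 'a, 'm) module_scheme \<Rightarrow> (complex, 'b, 'n) module_scheme \<Rightarrow> ('a \<Rightarrow> 'b) \<Rightarrow> bool"
  where "linear_iso V W f \<longleftrightarrow>
    f \<in> extensional (carrier V) \<and> bij_betw f (carrier V) (carrier W) \<and>
    (\<forall>u\<in>carrier V. \<forall>w\<in>carrier V. f (u \<oplus>\<^bsub>V\<^esub> w) = f u \<oplus>\<^bsub>W\<^esub> f w) \<and>
    (\<forall>c. \<forall>w\<in>carrier V. f (c \<odot>\<^bsub>V\<^esub> w) = c \<odot>\<^bsub>W\<^esub> f w)"

definition transpose_map :: "(complex, 'a, 'm) module_scheme \<Rightarrow> ('a \<Rightarrow> 'b) \<Rightarrow> ('b \<Rightarrow> complex) \<Rightarrow> 'a \<Rightarrow> complex"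
  where "transpose_map V f g = compose (carrier V) g f"


section \<open>Root data and the root groupoid\<close>

text \<open>
  The space \<open>\<hh>(v)\<close> may be any finite-dimensional complex vector space whose elements
  are taken from the type \<^typ>\<open>'h\<close>. The maps \<open>a\<close>, \<open>b\<close>, \<open>p\<close> are extensional on the index set \<open>X\<close>.
\<close>

record ('h, 'x) root_datum =
  hspace :: "(complex, 'h) module"
  coroot :: "'x \<Rightarrow> 'h"
  simple_root :: "'x \<Rightarrow> 'h \<Rightarrow> complex"
  parity :: "'x \<Rightarrow> bit"

definition is_root_datum :: "'x set \<Rightarrow> ('h, 'x) root_datum \<Rightarrow> bool"
  where "is_root_datum X v \<longleftrightarrow>
    complex_space (hspace v) \<and> finite_dim (hspace v) \<and>
    coroot v \<in> X \<rightarrow>\<^sub>E carrier (hspace v) \<and> lin_indep_family (hspace v) X (coroot v) \<and>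
    simple_root v \<in> X \<rightarrow>\<^sub>E carrier (dual_space (hspace v)) \<and> lin_indep_family (dual_space (hspace v)) X (simple_root v) \<and>
    parity v \<in> X \<rightarrow>\<^sub>E UNIV"

definition cartan :: "('h, 'x) root_datum \<Rightarrow> 'x \<Rightarrow> 'x \<Rightarrow> complex"
  where "cartan v x y = simple_root v y (coroot v x)"

definition reflectable :: "'x set \<Rightarrow> ('h, 'x) root_datum \<Rightarrow> 'x \<Rightarrow> bool"
  where "reflectable X v x \<longleftrightarrow>
    (cartan v x x = 0 \<longrightarrow> parity v x = 1) \<and>
    (cartan v x x \<noteq> 0 \<and> parity v x = 0 \<longrightarrow>
      (\<forall>y\<in>X. y \<noteq> x \<longrightarrow> 2 * cartan v x y / cartan v x x \<in> \<int>\<^sub>\<le>\<^sub>0)) \<and>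
    (cartan v x x \<noteq> 0 \<and> parity v x = 1 \<longrightarrow>
      (\<forall>y\<in>X. y \<noteq> x \<longrightarrow> cartan v x y / cartan v x x \<in> \<int>\<^sub>\<le>\<^sub>0))"

definition anisotropic_reflexion :: "'x set \<Rightarrow> 'x \<Rightarrow> ('h, 'x) root_datum \<Rightarrow> ('h, 'x) root_datum"
  where "anisotropic_reflexion X x v =
    (let V = hspace v; V' = dual_space V in
     \<lparr>hspace = V,
      coroot = (\<lambda>y\<in>X. coroot v y \<ominus>\<^bsub>V\<^esub> (2 * (cartan v y x / cartan v x x)) \<odot>\<^bsub>V\<^esub> coroot v x),
      simple_root = (\<lambda>y\<in>X. simple_root v y \<ominus>\<^bsub>V'\<^esub> (2 * (cartan v x y / cartan v x x)) \<odot>\<^bsub>V'\<^esub> simple_root v x),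
      parity = parity v\<rparr>)"

definition isotropic_reflexion :: "'x set \<Rightarrow> 'x \<Rightarrow> ('h, 'x) root_datum \<Rightarrow> ('h, 'x) root_datum"
  where "isotropic_reflexion X x v =
    (let V = hspace v; V' = dual_space V in
     \<lparr>hspace = V,
      coroot = (\<lambda>y\<in>X. if y = x then \<ominus>\<^bsub>V\<^esub> coroot v x
        else if cartan v x y = 0 then coroot v y
        else coroot v y \<oplus>\<^bsub>V\<^esub> (cartan v y x / cartan v x y) \<odot>\<^bsub>V\<^esub> coroot v x),
      simple_root = (\<lambda>y\<in>X. if y = x then \<ominus>\<^bsub>V'\<^esub> simple_root v x
        else if cartan v x y = 0 then simple_root v y
        else simple_root v y \<oplus>\<^bsub>V'\<^esub> simple_root v x),
      parity = (\<lambda>y\<in>X. if y = x \<or> cartan v x y = 0 then parity v y else 1 + parity v y)\<rparr>)"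

definition reflexion :: "'x set \<Rightarrow> 'x \<Rightarrow> ('h, 'x) root_datum \<Rightarrow> ('h, 'x) root_datum"
  where "reflexion X x v =
    (if cartan v x x \<noteq> 0 then anisotropic_reflexion X x v else isotropic_reflexion X x v)"

text \<open>The target of the tautological arrow \<open>t\<^sub>\<theta>\<close>, for \<open>\<theta> : \<hh>(v) \<rightarrow> W\<close>.\<close>

definition transported :: "'x set \<Rightarrow> (complex, 'h) module \<Rightarrow> ('h \<Rightarrow> 'h) \<Rightarrow> ('h, 'x) root_datum \<Rightarrow> ('h, 'x) root_datum"
  where "transported X W \<theta> v =
    \<lparr>hspace = W,
     coroot = compose X \<theta> (coroot v),
     simple_root = compose X (inv_into (carrier (dual_space W)) (transpose_map (hspace v) \<theta>)) (simple_root v),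
     parity = parity v\<rparr>"

definition rescaled :: "'x set \<Rightarrow> ('x \<Rightarrow> complex) \<Rightarrow> ('h, 'x) root_datum \<Rightarrow> ('h, 'x) root_datum"
  where "rescaled X l v =
    \<lparr>hspace = hspace v,
     coroot = (\<lambda>x\<in>X. l x \<odot>\<^bsub>hspace v\<^esub> coroot v x),
     simple_root = simple_root v,
     parity = parity v\<rparr>"

definition identity_on :: "('h, 'x) root_datum \<Rightarrow> 'h \<Rightarrow> 'h"
  where "identity_on v = (\<lambda>h\<in>carrier (hspace v). h)"

text \<open>\<open>generating_arrow X v v' \<phi>\<close>: a generator \<open>v \<rightarrow> v'\<close> inducing \<open>\<phi> : \<hh>(v) \<rightarrow> \<hh>(v')\<close>.\<close>

inductive generating_arrow ::
    "'x set \<Rightarrow> ('h, 'x) root_datum \<Rightarrow> ('h, 'x) root_datum \<Rightarrow> ('h \<Rightarrow> 'h) \<Rightarrow> bool"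
  for X where
  reflexion_arrow:
    "\<lbrakk>is_root_datum X v; x \<in> X; reflectable X v x\<rbrakk>
      \<Longrightarrow> generating_arrow X v (reflexion X x v) (identity_on v)"
| tautological_arrow:
    "\<lbrakk>is_root_datum X v; complex_space W; linear_iso (hspace v) W \<theta>\<rbrakk>
      \<Longrightarrow> generating_arrow X v (transported X W \<theta> v) \<theta>"
| homothety_arrow:
    "\<lbrakk>is_root_datum X v; \<forall>x\<in>X. l x \<noteq> 0\<rbrakk>
      \<Longrightarrow> generating_arrow X v (rescaled X l v) (identity_on v)"

text \<open>
  Since compositions of generators are identified when they induce the same isomorphism,
  an arrow \<open>v \<rightarrow> v'\<close> of the root groupoid is the same thing as an isomorphism
  \<open>\<phi> : \<hh>(v) \<rightarrow> \<hh>(v')\<close> induced by some composition. No formal inverses are needed: reflexions are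
  involutive, and the inverses of tautological arrows and homotheties are again of the same kind.
\<close>

inductive groupoid_arrow ::
    "'x set \<Rightarrow> ('h, 'x) root_datum \<Rightarrow> ('h, 'x) root_datum \<Rightarrow> ('h \<Rightarrow> 'h) \<Rightarrow> bool"
  for X where
  identity_arrow: "is_root_datum X v \<Longrightarrow> groupoid_arrow X v v (identity_on v)"
| composite_arrow:
    "\<lbrakk>groupoid_arrow X v v' \<phi>; generating_arrow X v' v'' \<psi>\<rbrakk>
      \<Longrightarrow> groupoid_arrow X v v'' (compose (carrier (hspace v)) \<psi> \<phi>)"

definition root_component :: "'x set \<Rightarrow> ('h, 'x) root_datum set \<Rightarrow> bool"
  where "root_component X R \<longleftrightarrow>
    (\<exists>v. is_root_datum X v \<and> R = {v'. \<exists>\<phi>. groupoid_arrow X v v' \<phi>})"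

definition locally_weakly_symmetric :: "'x set \<Rightarrow> ('h, 'x) root_datum \<Rightarrow> bool"
  where "locally_weakly_symmetric X v \<longleftrightarrow>
    (\<forall>x\<in>X. reflectable X v x \<longrightarrow> (\<forall>y\<in>X. cartan v x y = 0 \<longrightarrow> cartan v y x = 0))"

definition weakly_symmetric :: "'x set \<Rightarrow> ('h, 'x) root_datum set \<Rightarrow> bool"
  where "weakly_symmetric X R \<longleftrightarrow> (\<forall>v\<in>R. locally_weakly_symmetric X v)"


section \<open>Lie superalgebras\<close>

record 'a lie_superalgebra = "(complex, 'a) module" +
  bracket :: "'a \<Rightarrow> 'a \<Rightarrow> 'a"
  part :: "bit \<Rightarrow> 'a set"

definition koszul_sign :: "bit \<Rightarrow> bit \<Rightarrow> complex"
  where "koszul_sign i j = (if i = 1 \<and> j = 1 then -1 else 1)"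

text \<open>Ideals of Lie superalgebras are graded, so that the quotients are again superalgebras.\<close>

definition superideal :: "'a set \<Rightarrow> 'a lie_superalgebra \<Rightarrow> bool"
  where "superideal I L \<longleftrightarrow>
    submodule I complex_field L \<and>
    (\<forall>x\<in>carrier L. \<forall>y\<in>I. bracket L x y \<in> I \<and> bracket L y x \<in> I) \<and>
    (\<forall>x\<in>I. \<exists>y\<in>I \<inter> part L 0. \<exists>z\<in>I \<inter> part L 1. x = y \<oplus>\<^bsub>L\<^esub> z)"

definition super_quotient :: "'a lie_superalgebra \<Rightarrow> 'a set \<Rightarrow> 'a set lie_superalgebra"
  where "super_quotient L I =
    \<lparr>carrier = a_rcosets\<^bsub>L\<^esub> I,
     mult = undefined, one = undefined,
     zero = I,
     add = set_add L,
     smult = (\<lambda>c A. \<Union>x\<in>A. I +>\<^bsub>L\<^esub> (c \<odot>\<^bsub>L\<^esub> x)),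
     bracket = (\<lambda>A B. \<Union>x\<in>A. \<Union>y\<in>B. I +>\<^bsub>L\<^esub> bracket L x y),
     part = (\<lambda>i. (\<lambda>x. I +>\<^bsub>L\<^esub> x) ` part L i)\<rparr>"

definition super_iso :: "'a lie_superalgebra \<Rightarrow> 'b lie_superalgebra \<Rightarrow> ('a \<Rightarrow> 'b) \<Rightarrow> bool"
  where "super_iso L M f \<longleftrightarrow>
    bij_betw f (carrier L) (carrier M) \<and>
    (\<forall>x\<in>carrier L. \<forall>y\<in>carrier L. f (x \<oplus>\<^bsub>L\<^esub> y) = f x \<oplus>\<^bsub>M\<^esub> f y) \<and>
    (\<forall>c. \<forall>x\<in>carrier L. f (c \<odot>\<^bsub>L\<^esub> x) = c \<odot>\<^bsub>M\<^esub> f x) \<and>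
    (\<forall>x\<in>carrier L. \<forall>y\<in>carrier L. f (bracket L x y) = bracket M (f x) (f y)) \<and>
    (\<forall>i. f ` part L i = part M i)"


section \<open>Presentations of Lie superalgebras\<close>

text \<open>
  The Lie superalgebra presented by a set \<open>G\<close> of generators with parities \<open>\<pi>\<close> and a set
  \<open>R\<close> of relations between terms homogeneous of the same parity: formal terms in the generators
  modulo the least congruence that contains \<open>R\<close> and the Lie superalgebra axioms.
\<close>

datatype 'g lie_term =
  Gen 'g
| Zero
| Plus "'g lie_term" "'g lie_term"
| Scale complex "'g lie_term"
| Bracket "'g lie_term" "'g lie_term"

inductive has_parity :: "('g \<Rightarrow> bit) \<Rightarrow> 'g lie_term \<Rightarrow> bit \<Rightarrow> bool"
  for \<pi> where
  "has_parity \<pi> (Gen g) (\<pi> g)"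
| "has_parity \<pi> Zero i"
| "\<lbrakk>has_parity \<pi> s i; has_parity \<pi> t i\<rbrakk> \<Longrightarrow> has_parity \<pi> (Plus s t) i"
| "has_parity \<pi> t i \<Longrightarrow> has_parity \<pi> (Scale c t) i"
| "\<lbrakk>has_parity \<pi> s i; has_parity \<pi> t j\<rbrakk> \<Longrightarrow> has_parity \<pi> (Bracket s t) (i + j)"

definition lie_terms :: "'g set \<Rightarrow> 'g lie_term set"
  where "lie_terms G = {t. set_lie_term t \<subseteq> G}"

inductive_set lie_congruence ::
    "'g set \<Rightarrow> ('g \<Rightarrow> bit) \<Rightarrow> 'g lie_term rel \<Rightarrow> 'g lie_term rel"
  for G \<pi> R where
  relation: "\<lbrakk>(s, t) \<in> R; s \<in> lie_terms G; t \<in> lie_terms G\<rbrakk> \<Longrightarrow> (s, t) \<in> lie_congruence G \<pi> R"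
| reflexive: "t \<in> lie_terms G \<Longrightarrow> (t, t) \<in> lie_congruence G \<pi> R"
| symmetric: "(s, t) \<in> lie_congruence G \<pi> R \<Longrightarrow> (t, s) \<in> lie_congruence G \<pi> R"
| transitive: "\<lbrakk>(s, t) \<in> lie_congruence G \<pi> R; (t, u) \<in> lie_congruence G \<pi> R\<rbrakk>
    \<Longrightarrow> (s, u) \<in> lie_congruence G \<pi> R"
| Plus_cong: "\<lbrakk>(s, s') \<in> lie_congruence G \<pi> R; (t, t') \<in> lie_congruence G \<pi> R\<rbrakk>
    \<Longrightarrow> (Plus s t, Plus s' t') \<in> lie_congruence G \<pi> R"
| Scale_cong: "(t, t') \<in> lie_congruence G \<pi> R
    \<Longrightarrow> (Scale c t, Scale c t') \<in> lie_congruence G \<pi> R"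
| Bracket_cong: "\<lbrakk>(s, s') \<in> lie_congruence G \<pi> R; (t, t') \<in> lie_congruence G \<pi> R\<rbrakk>
    \<Longrightarrow> (Bracket s t, Bracket s' t') \<in> lie_congruence G \<pi> R"
| Plus_assoc: "\<lbrakk>s \<in> lie_terms G; t \<in> lie_terms G; u \<in> lie_terms G\<rbrakk>
    \<Longrightarrow> (Plus (Plus s t) u, Plus s (Plus t u)) \<in> lie_congruence G \<pi> R"
| Plus_comm: "\<lbrakk>s \<in> lie_terms G; t \<in> lie_terms G\<rbrakk>
    \<Longrightarrow> (Plus s t, Plus t s) \<in> lie_congruence G \<pi> R"
| Plus_Zero: "t \<in> lie_terms G \<Longrightarrow> (Plus t Zero, t) \<in> lie_congruence G \<pi> R"
| Plus_inverse: "t \<in> lie_terms G \<Longrightarrow> (Plus t (Scale (-1) t), Zero) \<in> lie_congruence G \<pi> R"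
| Scale_Plus: "\<lbrakk>s \<in> lie_terms G; t \<in> lie_terms G\<rbrakk>
    \<Longrightarrow> (Scale c (Plus s t), Plus (Scale c s) (Scale c t)) \<in> lie_congruence G \<pi> R"
| Scale_add: "t \<in> lie_terms G
    \<Longrightarrow> (Scale (c + d) t, Plus (Scale c t) (Scale d t)) \<in> lie_congruence G \<pi> R"
| Scale_mult: "t \<in> lie_terms G
    \<Longrightarrow> (Scale (c * d) t, Scale c (Scale d t)) \<in> lie_congruence G \<pi> R"
| Scale_one: "t \<in> lie_terms G \<Longrightarrow> (Scale 1 t, t) \<in> lie_congruence G \<pi> R"
| Bracket_Plus_left: "\<lbrakk>s \<in> lie_terms G; t \<in> lie_terms G; u \<in> lie_terms G\<rbrakk>
    \<Longrightarrow> (Bracket (Plus s t) u, Plus (Bracket s u) (Bracket t u)) \<in> lie_congruence G \<pi> R"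
| Bracket_Scale_left: "\<lbrakk>s \<in> lie_terms G; t \<in> lie_terms G\<rbrakk>
    \<Longrightarrow> (Bracket (Scale c s) t, Scale c (Bracket s t)) \<in> lie_congruence G \<pi> R"
| Bracket_Plus_right: "\<lbrakk>s \<in> lie_terms G; t \<in> lie_terms G; u \<in> lie_terms G\<rbrakk>
    \<Longrightarrow> (Bracket s (Plus t u), Plus (Bracket s t) (Bracket s u)) \<in> lie_congruence G \<pi> R"
| Bracket_Scale_right: "\<lbrakk>s \<in> lie_terms G; t \<in> lie_terms G\<rbrakk>
    \<Longrightarrow> (Bracket s (Scale c t), Scale c (Bracket s t)) \<in> lie_congruence G \<pi> R"
| Bracket_skew:
    "\<lbrakk>s \<in> lie_terms G; t \<in> lie_terms G; has_parity \<pi> s i; has_parity \<pi> t j\<rbrakk>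
      \<Longrightarrow> (Bracket s t, Scale (- koszul_sign i j) (Bracket t s)) \<in> lie_congruence G \<pi> R"
| Bracket_jacobi:
    "\<lbrakk>s \<in> lie_terms G; t \<in> lie_terms G; u \<in> lie_terms G; has_parity \<pi> s i; has_parity \<pi> t j\<rbrakk>
      \<Longrightarrow> (Bracket s (Bracket t u),
           Plus (Bracket (Bracket s t) u) (Scale (koszul_sign i j) (Bracket t (Bracket s u))))
          \<in> lie_congruence G \<pi> R"

definition lie_class ::
    "'g set \<Rightarrow> ('g \<Rightarrow> bit) \<Rightarrow> 'g lie_term rel \<Rightarrow> 'g lie_term \<Rightarrow> 'g lie_term set"
  where "lie_class G \<pi> R t = lie_congruence G \<pi> R `` {t}"

definition presented_lie_superalgebra ::
    "'g set \<Rightarrow> ('g \<Rightarrow> bit) \<Rightarrow> 'g lie_term rel \<Rightarrow> 'g lie_term set lie_superalgebra"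
  where "presented_lie_superalgebra G \<pi> R =
    \<lparr>carrier = lie_terms G // lie_congruence G \<pi> R,
     mult = undefined, one = undefined,
     zero = lie_class G \<pi> R Zero,
     add = (\<lambda>A B. \<Union>s\<in>A. \<Union>t\<in>B. lie_class G \<pi> R (Plus s t)),
     smult = (\<lambda>c A. \<Union>t\<in>A. lie_class G \<pi> R (Scale c t)),
     bracket = (\<lambda>A B. \<Union>s\<in>A. \<Union>t\<in>B. lie_class G \<pi> R (Bracket s t)),
     part = (\<lambda>i. lie_class G \<pi> R ` {t \<in> lie_terms G. has_parity \<pi> t i})\<rparr>"


section \<open>Root algebras\<close>

datatype ('h, 'x) root_generator = H 'h | E 'x | F 'x

definition root_generators :: "'x set \<Rightarrow> ('h, 'x) root_datum \<Rightarrow> ('h, 'x) root_generator set"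
  where "root_generators X v = H ` carrier (hspace v) \<union> E ` X \<union> F ` X"

primrec generator_parity :: "('h, 'x) root_datum \<Rightarrow> ('h, 'x) root_generator \<Rightarrow> bit"
  where
  "generator_parity v (H h) = 0"
| "generator_parity v (E x) = parity v x"
| "generator_parity v (F x) = parity v x"

text \<open>The first two relations express that \<open>\<hh>(v)\<close> enters as a vector space.\<close>

inductive_set half_baked_relations ::
    "'x set \<Rightarrow> ('h, 'x) root_datum \<Rightarrow> ('h, 'x) root_generator lie_term rel"
  for X v where
  "\<lbrakk>h \<in> carrier (hspace v); k \<in> carrier (hspace v)\<rbrakk>
    \<Longrightarrow> (Gen (H (h \<oplus>\<^bsub>hspace v\<^esub> k)), Plus (Gen (H h)) (Gen (H k))) \<in> half_baked_relations X v"
| "h \<in> carrier (hspace v)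
    \<Longrightarrow> (Gen (H (c \<odot>\<^bsub>hspace v\<^esub> h)), Scale c (Gen (H h))) \<in> half_baked_relations X v"
| "\<lbrakk>h \<in> carrier (hspace v); k \<in> carrier (hspace v)\<rbrakk>
    \<Longrightarrow> (Bracket (Gen (H h)) (Gen (H k)), Zero) \<in> half_baked_relations X v"
| "\<lbrakk>h \<in> carrier (hspace v); x \<in> X\<rbrakk>
    \<Longrightarrow> (Bracket (Gen (H h)) (Gen (E x)), Scale (simple_root v x h) (Gen (E x))) \<in> half_baked_relations X v"
| "\<lbrakk>h \<in> carrier (hspace v); x \<in> X\<rbrakk>
    \<Longrightarrow> (Bracket (Gen (H h)) (Gen (F x)), Scale (- simple_root v x h) (Gen (F x))) \<in> half_baked_relations X v"
| "\<lbrakk>x \<in> X; y \<in> X; x \<noteq> y\<rbrakk>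
    \<Longrightarrow> (Bracket (Gen (E x)) (Gen (F y)), Zero) \<in> half_baked_relations X v"
| "x \<in> X
    \<Longrightarrow> (Bracket (Gen (E x)) (Gen (F x)), Gen (H (coroot v x))) \<in> half_baked_relations X v"

definition half_baked ::
    "'x set \<Rightarrow> ('h, 'x) root_datum \<Rightarrow> ('h, 'x) root_generator lie_term set lie_superalgebra"
  where "half_baked X v =
    presented_lie_superalgebra (root_generators X v) (generator_parity v) (half_baked_relations X v)"

definition cartan_embedding ::
    "'x set \<Rightarrow> ('h, 'x) root_datum \<Rightarrow> 'h \<Rightarrow> ('h, 'x) root_generator lie_term set"
  where "cartan_embedding X v h =
    lie_class (root_generators X v) (generator_parity v) (half_baked_relations X v) (Gen (H h))"

definition root_lie_superalgebra ::
    "'x set \<Rightarrow> ('h, 'x) root_datum set \<Rightarrow>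
      (('h, 'x) root_datum \<Rightarrow> ('h, 'x) root_generator lie_term set set) \<Rightarrow> bool"
  where "root_lie_superalgebra X R I \<longleftrightarrow>
    (\<forall>v\<in>R. superideal (I v) (half_baked X v) \<and>
       I v \<inter> cartan_embedding X v ` carrier (hspace v) = {\<zero>\<^bsub>half_baked X v\<^esub>}) \<and>
    (\<forall>v\<in>R. \<forall>v'\<in>R. \<forall>\<phi>. groupoid_arrow X v v' \<phi> \<longrightarrow>
       (\<exists>\<Phi>. super_iso (super_quotient (half_baked X v) (I v)) (super_quotient (half_baked X v') (I v')) \<Phi> \<and>
         (\<forall>h\<in>carrier (hspace v).
            \<Phi> (I v +>\<^bsub>half_baked X v\<^esub> cartan_embedding X v h) =
            I v' +>\<^bsub>half_baked X v'\<^esub> cartan_embedding X v' (\<phi> h))))"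

definition admissible :: "'x set \<Rightarrow> ('h, 'x) root_datum set \<Rightarrow> bool"
  where "admissible X R \<longleftrightarrow> (\<exists>I. root_lie_superalgebra X R I)"

end

theory Submission
  imports Defs
begin

text \<open>
  The Cartan subalgebra acts faithfully on Verma modules, so it embeds into the half-baked algebra.
  Let \<open>I(v)\<close> be the largest ideal that meets it trivially. If the component is weakly symmetric,
  the quotients by the \<open>I(v)\<close> form a root Lie superalgebra: by maximality, an element of the span of
  the \<open>e\<close>-words that is killed by all \<open>f\<^sub>y\<close> vanishes, and this yields the Serre relations for the
  \<open>x\<close>-strings at a reflectable \<open>x\<close>. Hence the ends of the \<open>x\<close>-strings through \<open>e\<^sub>y\<close> and \<open>f\<^sub>y\<close>,
  suitably scaled, satisfy the half-baked relations of the reflected datum, they generate, and every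
  ideal still meets the Cartan subalgebra, so the two contragredient quotients coincide.

  Conversely, let \<open>a\<^sub>x\<^sub>y = 0\<close> with \<open>x\<close> reflectable. In the algebra of the reflected datum the weight
  \<open>-b(x)\<close> is simple and the weight of \<open>f\<^sub>y\<close> is unchanged, so \<open>f\<^sub>x\<close> and \<open>f\<^sub>y\<close> are multiples of
  \<open>e'\<^sub>x\<close> and \<open>f'\<^sub>y\<close> and commute. Applying \<open>ad e\<^sub>y\<close> to \<open>[f\<^sub>x, f\<^sub>y] = 0\<close> gives \<open>a\<^sub>y\<^sub>x f\<^sub>x = 0\<close>, and
  \<open>f\<^sub>x \<noteq> 0\<close> because \<open>[e\<^sub>x, f\<^sub>x] = a(x) \<noteq> 0\<close>.
\<close>

text \<open>The obstacle is that an arrow has to be lifted to an isomorphism between two different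
  quotients. The way around it is to keep one algebra \<open>L\<close> and to change only how it is
  read: \<open>root_rep\<close> records a Cartan map and elements \<open>e\<close>, \<open>f\<close>
  of \<open>L\<close> satisfying the half-baked relations of a datum, and an arrow replaces the
  datum and these elements. Minimality refers only to the image of the Cartan map, so it survives,
  and a minimal realization is isomorphic to the contragredient quotient of its datum. Independence
  of the simple roots yields Cartan elements with any prescribed values on them. The eigenvalues of
  one such element give the height, the parity or a single simple root space, whichever is needed,
  in place of a full weight decomposition. Rereading \<open>L\<close> with the negated Cartan map
  exchanges \<open>e\<close> and \<open>f\<close>, so a statement on one yields one on the other.
  Weak symmetricity matters where \<open>a_xy = 0\<close>: the string through \<open>e y\<close>
  must then stop at once, and \<open>f y\<close> kills \<open>[e x, e y]\<close> only if
  \<open>a_yx = 0\<close>.\<close>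

section \<open>Vector spaces over the complex numbers\<close>

lemma complex_field_simps [simp]:
  "carrier complex_field = UNIV" "a \<oplus>\<^bsub>complex_field\<^esub> b = a + b"
  "a \<otimes>\<^bsub>complex_field\<^esub> b = a * b" "\<one>\<^bsub>complex_field\<^esub> = 1" "\<zero>\<^bsub>complex_field\<^esub> = 0"
  by (simp_all add: complex_field_def)

lemma complex_field_minus [simp]: "\<ominus>\<^bsub>complex_field\<^esub> a = - a"
proof -
  interpret field complex_field by (rule field_complex_field)
  show ?thesis by (rule minus_equality) simp_all
qed

lemma complex_spaceI:
  assumes "abelian_group V"
    and "\<And>c x. x \<in> carrier V \<Longrightarrow> c \<odot>\<^bsub>V\<^esub> x \<in> carrier V"
    and "\<And>c d x. x \<in> carrier V \<Longrightarrow> (c + d) \<odot>\<^bsub>V\<^esub> x = c \<odot>\<^bsub>V\<^esub> x \<oplus>\<^bsub>V\<^esub> d \<odot>\<^bsub>V\<^esub> x"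
    and "\<And>c x y. x \<in> carrier V \<Longrightarrow> y \<in> carrier V \<Longrightarrow> c \<odot>\<^bsub>V\<^esub> (x \<oplus>\<^bsub>V\<^esub> y) = c \<odot>\<^bsub>V\<^esub> x \<oplus>\<^bsub>V\<^esub> c \<odot>\<^bsub>V\<^esub> y"
    and "\<And>c d x. x \<in> carrier V \<Longrightarrow> (c * d) \<odot>\<^bsub>V\<^esub> x = c \<odot>\<^bsub>V\<^esub> (d \<odot>\<^bsub>V\<^esub> x)"
    and "\<And>x. x \<in> carrier V \<Longrightarrow> 1 \<odot>\<^bsub>V\<^esub> x = x"
  shows "complex_space V"
  by (rule module.intro)
    (use assms field_complex_field in \<open>auto simp: module_axioms_def field_def domain_def\<close>)

locale complex_vector_space = module complex_field V for V (structure)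
begin

lemma scale_closed [simp, intro]: "x \<in> carrier V \<Longrightarrow> c \<odot> x \<in> carrier V"
  by (simp add: smult_closed)

lemma scale_add_left: "x \<in> carrier V \<Longrightarrow> (c + d) \<odot> x = c \<odot> x \<oplus> d \<odot> x"
  using smult_l_distr[of c d x] by simp

lemma scale_add_right: "x \<in> carrier V \<Longrightarrow> y \<in> carrier V \<Longrightarrow> c \<odot> (x \<oplus> y) = c \<odot> x \<oplus> c \<odot> y"
  using smult_r_distr[of c x y] by simp

lemma scale_scale [simp]: "x \<in> carrier V \<Longrightarrow> c \<odot> (d \<odot> x) = (c * d) \<odot> x"
  using smult_assoc1[of c d x] by simp

lemma scale_one [simp]: "x \<in> carrier V \<Longrightarrow> 1 \<odot> x = x"
  using smult_one[of x] by simp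

lemma scale_zero_left [simp]: "x \<in> carrier V \<Longrightarrow> 0 \<odot> x = \<zero>"
  using smult_l_null[of x] by simp

lemma scale_zero_right [simp]: "c \<odot> \<zero> = \<zero>"
  using smult_r_null[of c] by simp

text \<open>Subtraction is written below as adding a multiple by -1, so that arguments on subspaces
  and linear maps reduce to sums and multiples.\<close>

lemma minus_eq_scale: "x \<in> carrier V \<Longrightarrow> \<ominus> x = (-1) \<odot> x"
  using smult_l_minus[of 1 x] by simp

lemma diff_eq_scale: "x \<in> carrier V \<Longrightarrow> y \<in> carrier V \<Longrightarrow> x \<ominus> y = x \<oplus> (-1) \<odot> y"
  by (simp add: a_minus_def minus_eq_scale)

lemma scale_eq_zero_iff: "x \<in> carrier V \<Longrightarrow> c \<odot> x = \<zero> \<longleftrightarrow> c = 0 \<or> x = \<zero>"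
proof -
  assume x: "x \<in> carrier V"
  have "x = \<zero>" if "c \<odot> x = \<zero>" "c \<noteq> 0"
  proof -
    have "(inverse c * c) \<odot> x = inverse c \<odot> (c \<odot> x)" using x by (simp del: left_inverse)
    then show ?thesis using that x by simp
  qed
  then show ?thesis using x by auto
qed

lemma add_scale_minus: "x \<in> carrier V \<Longrightarrow> x \<oplus> (-1) \<odot> x = \<zero>"
  using scale_add_left[of x 1 "-1"] by simp

lemma add_eq_zero_imp: "x \<in> carrier V \<Longrightarrow> y \<in> carrier V \<Longrightarrow> x \<oplus> y = \<zero> \<Longrightarrow> x = (-1) \<odot> y"
  by (metis minus_eq_scale a_comm minus_equality)

lemma submodule_iff:
  "submodule N complex_field V \<longleftrightarrow> N \<subseteq> carrier V \<and> \<zero> \<in> N \<and>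
     (\<forall>x\<in>N. \<forall>y\<in>N. x \<oplus> y \<in> N) \<and> (\<forall>c. \<forall>x\<in>N. c \<odot> x \<in> N)"
proof
  assume N: "submodule N complex_field V"
  then have s: "subgroup N (add_monoid V)" and sm: "\<And>c x. x \<in> N \<Longrightarrow> c \<odot> x \<in> N"
    by (auto simp: submodule_def submodule_axioms_def)
  show "N \<subseteq> carrier V \<and> \<zero> \<in> N \<and> (\<forall>x\<in>N. \<forall>y\<in>N. x \<oplus> y \<in> N) \<and> (\<forall>c. \<forall>x\<in>N. c \<odot> x \<in> N)"
    using sm subgroup.subset[OF s] subgroup.one_closed[OF s] subgroup.m_closed[OF s] by auto
next
  assume N: "N \<subseteq> carrier V \<and> \<zero> \<in> N \<and> (\<forall>x\<in>N. \<forall>y\<in>N. x \<oplus> y \<in> N) \<and> (\<forall>c. \<forall>x\<in>N. c \<odot> x \<in> N)"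
  have "\<ominus> x \<in> N" if "x \<in> N" for x using N that minus_eq_scale[of x] by auto
  then have "subgroup N (add_monoid V)"
    using N by (intro subgroup.intro) (auto simp: a_inv_def)
  then show "submodule N complex_field V"
    using N by (auto simp: submodule_def submodule_axioms_def)
qed

end

lemma complex_vector_space_iff: "complex_vector_space V \<longleftrightarrow> complex_space V"
  by (simp add: complex_vector_space_def)

section \<open>Lie superalgebras\<close>

lemma koszul_sign_commute: "koszul_sign i j = koszul_sign j i"
  by (auto simp: koszul_sign_def)

lemma koszul_sign_square [simp]: "koszul_sign i j * koszul_sign i j = 1"
  by (auto simp: koszul_sign_def)

lemma koszul_sign_nonzero [simp]: "koszul_sign i j \<noteq> 0"
  by (auto simp: koszul_sign_def)

lemma koszul_sign_zero [simp]: "koszul_sign i 0 = 1" "koszul_sign 0 i = 1"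
  by (auto simp: koszul_sign_def)

text \<open>The two parts have to span but not to meet in zero: an element of a presented algebra is
  homogeneous as soon as one homogeneous term represents it. The third argument of the Jacobi
  identity is arbitrary because the sign depends on the first two alone.\<close>

locale lie_super = complex_vector_space L for L :: "'a lie_superalgebra" (structure) +
  assumes bracket_closed [simp, intro]:
      "x \<in> carrier L \<Longrightarrow> y \<in> carrier L \<Longrightarrow> bracket L x y \<in> carrier L"
    and bracket_add_left:
      "x \<in> carrier L \<Longrightarrow> y \<in> carrier L \<Longrightarrow> z \<in> carrier L \<Longrightarrow>
        bracket L (x \<oplus> y) z = bracket L x z \<oplus> bracket L y z"
    and bracket_scale_left:
      "x \<in> carrier L \<Longrightarrow> y \<in> carrier L \<Longrightarrow> bracket L (c \<odot> x) y = c \<odot> bracket L x y"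
    and bracket_add_right:
      "x \<in> carrier L \<Longrightarrow> y \<in> carrier L \<Longrightarrow> z \<in> carrier L \<Longrightarrow>
        bracket L x (y \<oplus> z) = bracket L x y \<oplus> bracket L x z"
    and bracket_scale_right:
      "x \<in> carrier L \<Longrightarrow> y \<in> carrier L \<Longrightarrow> bracket L x (c \<odot> y) = c \<odot> bracket L x y"
    and part_subset: "part L i \<subseteq> carrier L"
    and part_zero: "\<zero> \<in> part L i"
    and part_add: "x \<in> part L i \<Longrightarrow> y \<in> part L i \<Longrightarrow> x \<oplus> y \<in> part L i"
    and part_scale: "x \<in> part L i \<Longrightarrow> c \<odot> x \<in> part L i"
    and part_bracket: "x \<in> part L i \<Longrightarrow> y \<in> part L j \<Longrightarrow> bracket L x y \<in> part L (i + j)"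
    and part_decomp: "x \<in> carrier L \<Longrightarrow> \<exists>y\<in>part L 0. \<exists>z\<in>part L 1. x = y \<oplus> z"
    and bracket_skew: "x \<in> part L i \<Longrightarrow> y \<in> part L j \<Longrightarrow>
        bracket L x y = (- koszul_sign i j) \<odot> bracket L y x"
    and bracket_jacobi: "x \<in> part L i \<Longrightarrow> y \<in> part L j \<Longrightarrow> z \<in> carrier L \<Longrightarrow>
        bracket L x (bracket L y z) =
          bracket L (bracket L x y) z \<oplus> koszul_sign i j \<odot> bracket L y (bracket L x z)"
begin

lemma part_carrier: "x \<in> part L i \<Longrightarrow> x \<in> carrier L"
  using part_subset by blast

lemma bracket_zero_left [simp]: "x \<in> carrier L \<Longrightarrow> bracket L \<zero> x = \<zero>"
  using bracket_scale_left[of \<zero> x 0] by simp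

lemma bracket_zero_right [simp]: "x \<in> carrier L \<Longrightarrow> bracket L x \<zero> = \<zero>"
  using bracket_scale_right[of x \<zero> 0] by simp

lemma bracket_eq_zero_swap:
  "x \<in> part L i \<Longrightarrow> y \<in> part L j \<Longrightarrow> bracket L x y = \<zero> \<Longrightarrow> bracket L y x = \<zero>"
  using bracket_skew[of y j x i] by simp

end

text \<open>Meant for a bare record \<open>M\<close> whose operations are given on representatives:
  every axiom is an equation or an existence statement and so passes along a surjection. Applied to
  quotients by superideals.\<close>

lemma (in lie_super) homomorphic_image:
  fixes M :: "'b lie_superalgebra"
  assumes surj: "carrier M = q ` carrier L" and zero: "\<zero>\<^bsub>M\<^esub> = q \<zero>"
    and add: "\<And>x y. x \<in> carrier L \<Longrightarrow> y \<in> carrier L \<Longrightarrow> q x \<oplus>\<^bsub>M\<^esub> q y = q (x \<oplus> y)"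
    and scale: "\<And>c x. x \<in> carrier L \<Longrightarrow> c \<odot>\<^bsub>M\<^esub> q x = q (c \<odot> x)"
    and brack: "\<And>x y. x \<in> carrier L \<Longrightarrow> y \<in> carrier L \<Longrightarrow> bracket M (q x) (q y) = q (bracket L x y)"
    and part: "\<And>i. part M i = q ` part L i"
  shows "lie_super M"
proof -
  have minus: "q ((-1) \<odot> x) \<oplus>\<^bsub>M\<^esub> q x = \<zero>\<^bsub>M\<^esub>" if "x \<in> carrier L" for x
    using that by (simp add: add zero add_scale_minus a_comm)
  have "abelian_group M"
    by (rule abelian_groupI)
      (auto simp: surj zero add a_ac intro!: bexI[of _ "(-1) \<odot> _"] minus[unfolded zero add])
  then have "complex_space M"
    by (rule complex_spaceI)
      (auto simp: surj add scale scale_add_left scale_add_right)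
  moreover have pc: "x \<in> part L i \<Longrightarrow> x \<in> carrier L" for x i using part_subset by auto
  have "lie_super_axioms M"
  proof
    show "part M i \<subseteq> carrier M" for i using part_subset by (auto simp: part surj)
    show "\<zero>\<^bsub>M\<^esub> \<in> part M i" for i by (simp add: part zero part_zero)
    show "x \<in> part M i \<Longrightarrow> y \<in> part M i \<Longrightarrow> x \<oplus>\<^bsub>M\<^esub> y \<in> part M i" for x y i
      by (auto simp: part add pc part_add)
    show "x \<in> part M i \<Longrightarrow> c \<odot>\<^bsub>M\<^esub> x \<in> part M i" for x c i
      by (auto simp: part scale pc part_scale)
    show "x \<in> part M i \<Longrightarrow> y \<in> part M j \<Longrightarrow> bracket M x y \<in> part M (i + j)" for x y i j
    proof -
      assume "x \<in> part M i" "y \<in> part M j"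
      then obtain u w where u: "u \<in> part L i" "x = q u" and w: "w \<in> part L j" "y = q w"
        unfolding part by blast
      then have "bracket M x y = q (bracket L u w)" using pc by (simp add: brack)
      then show ?thesis using part_bracket[OF u(1) w(1)] unfolding part by blast
    qed
    show "\<exists>y\<in>part M 0. \<exists>z\<in>part M 1. x = y \<oplus>\<^bsub>M\<^esub> z" if "x \<in> carrier M" for x
    proof -
      from that obtain u where "u \<in> carrier L" "x = q u" by (auto simp: surj)
      moreover from part_decomp[OF \<open>u \<in> carrier L\<close>]
      obtain y z where "y \<in> part L 0" "z \<in> part L 1" "u = y \<oplus> z" by auto
      moreover from this have "x = q y \<oplus>\<^bsub>M\<^esub> q z" using \<open>x = q u\<close> by (simp add: add pc)
      ultimately show ?thesis unfolding part by blast
    qed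
    show "bracket M x y = (- koszul_sign i j) \<odot>\<^bsub>M\<^esub> bracket M y x"
      if "x \<in> part M i" "y \<in> part M j" for x y i j
    proof -
      from that obtain u w where "u \<in> part L i" "x = q u" "w \<in> part L j" "y = q w"
        unfolding part by blast
      then show ?thesis using bracket_skew[of u i w j] by (simp add: brack scale pc)
    qed
    show "bracket M x (bracket M y z) =
          bracket M (bracket M x y) z \<oplus>\<^bsub>M\<^esub> koszul_sign i j \<odot>\<^bsub>M\<^esub> bracket M y (bracket M x z)"
      if "x \<in> part M i" "y \<in> part M j" "z \<in> carrier M" for x y z i j
    proof -
      from that obtain u w t where "u \<in> part L i" "x = q u" "w \<in> part L j" "y = q w"
        "t \<in> carrier L" "z = q t"
        unfolding part surj by blast
      then show ?thesis using bracket_jacobi[of u i w j t] by (simp add: brack scale add pc)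
    qed
  qed (auto simp: surj add scale brack bracket_add_left bracket_add_right
       bracket_scale_left bracket_scale_right)
  ultimately show ?thesis by (simp add: lie_super_def complex_vector_space_def)
qed

section \<open>Generation by homogeneous elements; homomorphisms\<close>

text \<open>The parity is carried along because the sign in the Jacobi identity must be known at
  each bracket; \<open>S i\<close> holds the generators of parity \<open>i\<close>.\<close>

inductive homogeneous_generated :: "('a::type) lie_superalgebra \<Rightarrow> (bit \<Rightarrow> 'a set) \<Rightarrow> bit \<Rightarrow> 'a \<Rightarrow> bool"
  for L S where
  hgen_base: "s \<in> S i \<Longrightarrow> homogeneous_generated L S i s"
| hgen_zero: "homogeneous_generated L S i \<zero>\<^bsub>L\<^esub>"
| hgen_add: "homogeneous_generated L S i x \<Longrightarrow> homogeneous_generated L S i y \<Longrightarrow>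
    homogeneous_generated L S i (x \<oplus>\<^bsub>L\<^esub> y)"
| hgen_scale: "homogeneous_generated L S i x \<Longrightarrow> homogeneous_generated L S i (c \<odot>\<^bsub>L\<^esub> x)"
| hgen_bracket: "homogeneous_generated L S i x \<Longrightarrow> homogeneous_generated L S j y \<Longrightarrow>
    homogeneous_generated L S (i + j) (bracket L x y)"

lemma homogeneous_generated_trans:
  assumes "homogeneous_generated L S i x"
    and "\<And>i s. s \<in> S i \<Longrightarrow> homogeneous_generated L S' i s"
  shows "homogeneous_generated L S' i x"
  using assms(1) by induction (blast intro: homogeneous_generated.intros assms(2))+

context lie_super
begin

lemma hgen_part:
  assumes "homogeneous_generated L S i x" and "\<And>i. S i \<subseteq> part L i"
  shows "x \<in> part L i"
  using assms(1) by induction (use assms(2) part_zero part_add part_scale part_bracket in auto)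

text \<open>The operator \<open>ad [x, y]\<close> is the supercommutator of \<open>ad x\<close> and
  \<open>ad y\<close>, so stability under the generators is inherited by everything they
  generate.\<close>

lemma hgen_stable:
  assumes "homogeneous_generated L S i x" and S: "\<And>i. S i \<subseteq> part L i"
    and M: "submodule M complex_field L"
    and st: "\<And>i s w. s \<in> S i \<Longrightarrow> w \<in> M \<Longrightarrow> bracket L s w \<in> M" and w: "w \<in> M"
  shows "bracket L x w \<in> M"
  using assms(1) w
proof (induction arbitrary: w)
  case (hgen_base s i)
  then show ?case using st by auto
next
  case (hgen_zero i)
  then show ?case using M by (auto simp: submodule_iff)
next
  case (hgen_add i x y)
  moreover have "x \<in> carrier L" "y \<in> carrier L"
    using hgen_add.hyps hgen_part[OF _ S] part_carrier by blast+
  ultimately show ?case using M by (auto simp: submodule_iff bracket_add_left subset_iff)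
next
  case (hgen_scale i x c)
  moreover have "x \<in> carrier L" using hgen_scale.hyps hgen_part[OF _ S] part_carrier by blast
  ultimately show ?case using M by (auto simp: submodule_iff bracket_scale_left subset_iff)
next
  case (hgen_bracket i x j y)
  have x: "x \<in> part L i" and y: "y \<in> part L j"
    using hgen_bracket.hyps hgen_part[OF _ S] by blast+
  have wc: "w \<in> carrier L" using M hgen_bracket.prems by (auto simp: submodule_iff)
  have "bracket L (bracket L x y) w =
    bracket L x (bracket L y w) \<oplus> (- koszul_sign i j) \<odot> bracket L y (bracket L x w)"
    using bracket_jacobi[OF x y wc] x y wc part_carrier
    by (simp add: a_assoc scale_add_left[symmetric])
  then show ?case using hgen_bracket M by (auto simp: submodule_iff)
qed

end

definition super_hom :: "'a lie_superalgebra \<Rightarrow> 'b lie_superalgebra \<Rightarrow> ('a \<Rightarrow> 'b) \<Rightarrow> bool"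
  where "super_hom L M f \<longleftrightarrow>
    f \<in> carrier L \<rightarrow> carrier M \<and>
    (\<forall>x\<in>carrier L. \<forall>y\<in>carrier L. f (x \<oplus>\<^bsub>L\<^esub> y) = f x \<oplus>\<^bsub>M\<^esub> f y) \<and>
    (\<forall>c. \<forall>x\<in>carrier L. f (c \<odot>\<^bsub>L\<^esub> x) = c \<odot>\<^bsub>M\<^esub> f x) \<and>
    (\<forall>x\<in>carrier L. \<forall>y\<in>carrier L. f (bracket L x y) = bracket M (f x) (f y)) \<and>
    (\<forall>i. f ` part L i \<subseteq> part M i)"

lemma super_homD:
  assumes "super_hom L M f"
  shows "x \<in> carrier L \<Longrightarrow> f x \<in> carrier M"
    and "x \<in> carrier L \<Longrightarrow> y \<in> carrier L \<Longrightarrow> f (x \<oplus>\<^bsub>L\<^esub> y) = f x \<oplus>\<^bsub>M\<^esub> f y"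
    and "x \<in> carrier L \<Longrightarrow> f (c \<odot>\<^bsub>L\<^esub> x) = c \<odot>\<^bsub>M\<^esub> f x"
    and "x \<in> carrier L \<Longrightarrow> y \<in> carrier L \<Longrightarrow> f (bracket L x y) = bracket M (f x) (f y)"
    and "x \<in> part L i \<Longrightarrow> f x \<in> part M i"
  using assms by (auto simp: super_hom_def image_subset_iff)

lemma super_hom_zero:
  assumes "super_hom L M f" "lie_super L" "lie_super M"
  shows "f \<zero>\<^bsub>L\<^esub> = \<zero>\<^bsub>M\<^esub>"
proof -
  interpret L: lie_super L by fact
  interpret M: lie_super M by fact
  show ?thesis
    using super_homD(3)[OF assms(1), of "\<zero>\<^bsub>L\<^esub>" 0] super_homD(1)[OF assms(1), of "\<zero>\<^bsub>L\<^esub>"] by simp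
qed

lemma super_iso_imp_hom:
  assumes "super_iso L M f"
  shows "super_hom L M f"
  using assms by (auto simp: super_iso_def super_hom_def bij_betw_def)

text \<open>Since the parts of \<open>lie_super\<close> may overlap, a bijective homomorphism need
  not map them onto the parts of the target; hence the third premise.\<close>

lemma super_isoI:
  assumes "super_hom L M f" "bij_betw f (carrier L) (carrier M)" "\<And>i. part M i \<subseteq> f ` part L i"
  shows "super_iso L M f"
  using assms by (fastforce simp: super_iso_def super_hom_def)

lemma super_iso_inverse:
  assumes f: "super_iso L M f" and "lie_super L"
  shows "super_iso M L (inv_into (carrier L) f)"
proof -
  interpret L: lie_super L by fact
  let ?g = "inv_into (carrier L) f"
  have bij: "bij_betw f (carrier L) (carrier M)" using f by (simp add: super_iso_def)
  have gf: "?g (f x) = x" if "x \<in> carrier L" for x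
    using bij that by (simp add: bij_betw_inv_into_left)
  note hom = super_homD[OF super_iso_imp_hom[OF f]]
  have ex: "\<exists>u\<in>carrier L. x = f u" if "x \<in> carrier M" for x
    using bij that by (auto simp: bij_betw_def)
  have add: "?g (x \<oplus>\<^bsub>M\<^esub> y) = ?g x \<oplus>\<^bsub>L\<^esub> ?g y" if "x \<in> carrier M" "y \<in> carrier M" for x y
  proof -
    from that ex obtain u w where u: "u \<in> carrier L" "x = f u" and w: "w \<in> carrier L" "y = f w"
      by blast
    show ?thesis using gf[of "u \<oplus>\<^bsub>L\<^esub> w"] u w by (simp add: gf hom)
  qed
  have scale: "?g (c \<odot>\<^bsub>M\<^esub> x) = c \<odot>\<^bsub>L\<^esub> ?g x" if "x \<in> carrier M" for x c
  proof -
    from that ex obtain u where u: "u \<in> carrier L" "x = f u" by blast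
    show ?thesis using gf[of "c \<odot>\<^bsub>L\<^esub> u"] u by (simp add: gf hom)
  qed
  have br: "?g (bracket M x y) = bracket L (?g x) (?g y)" if "x \<in> carrier M" "y \<in> carrier M" for x y
  proof -
    from that ex obtain u w where u: "u \<in> carrier L" "x = f u" and w: "w \<in> carrier L" "y = f w"
      by blast
    show ?thesis using gf[of "bracket L u w"] u w by (simp add: gf hom)
  qed
  have "?g ` part M i = part L i" for i
  proof -
    have "part M i = f ` part L i" using f by (auto simp: super_iso_def)
    then have "?g ` part M i = (\<lambda>x. ?g (f x)) ` part L i" by (simp add: image_image)
    also have "\<dots> = (\<lambda>x. x) ` part L i"
      by (rule image_cong[OF refl]) (use gf L.part_carrier in blast)
    finally show ?thesis by simp
  qed
  then show ?thesis
    using add scale br bij_betw_inv_into[OF bij] by (simp add: super_iso_def)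
qed

section \<open>Presented Lie superalgebras\<close>

text \<open>In presentations and quotients the operations are unions over representatives; such a
  union collapses once all its members agree.\<close>

lemma UN_const: "x \<in> A \<Longrightarrow> (\<And>y. y \<in> A \<Longrightarrow> f y = c) \<Longrightarrow> (\<Union>y\<in>A. f y) = c"
  by auto

lemma lie_terms_simps [simp]:
  "Gen g \<in> lie_terms G \<longleftrightarrow> g \<in> G" "Zero \<in> lie_terms G"
  "Plus s t \<in> lie_terms G \<longleftrightarrow> s \<in> lie_terms G \<and> t \<in> lie_terms G"
  "Scale c t \<in> lie_terms G \<longleftrightarrow> t \<in> lie_terms G"
  "Bracket s t \<in> lie_terms G \<longleftrightarrow> s \<in> lie_terms G \<and> t \<in> lie_terms G"
  by (auto simp: lie_terms_def)

lemma lie_congruence_terms: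
  "(s, t) \<in> lie_congruence G \<pi> R \<Longrightarrow> s \<in> lie_terms G \<and> t \<in> lie_terms G"
  by (induction rule: lie_congruence.induct) auto

lemma equiv_lie_congruence: "equiv (lie_terms G) (lie_congruence G \<pi> R)"
proof -
  have "lie_congruence G \<pi> R \<subseteq> lie_terms G \<times> lie_terms G"
    using lie_congruence_terms by fast
  moreover have "refl_on (lie_terms G) (lie_congruence G \<pi> R)"
    by (auto simp: refl_on_def intro: lie_congruence.reflexive dest: lie_congruence_terms)
  moreover have "sym (lie_congruence G \<pi> R)" by (auto intro: symI lie_congruence.symmetric)
  moreover have "trans (lie_congruence G \<pi> R)" by (blast intro: transI lie_congruence.transitive)
  ultimately show ?thesis by (simp add: equiv_def)
qed

lemma lie_class_eqI: "(s, t) \<in> lie_congruence G \<pi> R \<Longrightarrow> lie_class G \<pi> R s = lie_class G \<pi> R t"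
  unfolding lie_class_def by (rule equiv_class_eq[OF equiv_lie_congruence])

lemma lie_class_self: "t \<in> lie_terms G \<Longrightarrow> t \<in> lie_class G \<pi> R t"
  by (simp add: lie_class_def lie_congruence.reflexive)

lemma lie_classD: "s \<in> lie_class G \<pi> R t \<Longrightarrow> (s, t) \<in> lie_congruence G \<pi> R"
  by (simp add: lie_class_def lie_congruence.symmetric)

context
  fixes G :: "'g set" and \<pi> :: "'g \<Rightarrow> bit" and R :: "'g lie_term rel"
begin

private abbreviation (input) "cls \<equiv> lie_class G \<pi> R"
private abbreviation (input) "P \<equiv> presented_lie_superalgebra G \<pi> R"

lemma presented_carrier: "carrier P = cls ` lie_terms G"
  by (auto simp: presented_lie_superalgebra_def quotient_def lie_class_def)

lemma presented_part: "part P i = cls ` {t \<in> lie_terms G. has_parity \<pi> t i}"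
  by (simp add: presented_lie_superalgebra_def)

lemma presented_ops:
  "\<zero>\<^bsub>P\<^esub> = cls Zero"
  "s \<in> lie_terms G \<Longrightarrow> t \<in> lie_terms G \<Longrightarrow> cls s \<oplus>\<^bsub>P\<^esub> cls t = cls (Plus s t)"
  "t \<in> lie_terms G \<Longrightarrow> c \<odot>\<^bsub>P\<^esub> cls t = cls (Scale c t)"
  "s \<in> lie_terms G \<Longrightarrow> t \<in> lie_terms G \<Longrightarrow> bracket P (cls s) (cls t) = cls (Bracket s t)"
proof -
  show "\<zero>\<^bsub>P\<^esub> = cls Zero" by (simp add: presented_lie_superalgebra_def)
  show "cls s \<oplus>\<^bsub>P\<^esub> cls t = cls (Plus s t)" if "s \<in> lie_terms G" "t \<in> lie_terms G"
    unfolding presented_lie_superalgebra_def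
    by simp (rule UN_const[OF lie_class_self[OF that(1)]], rule UN_const[OF lie_class_self[OF that(2)]],
        intro lie_class_eqI lie_congruence.Plus_cong lie_classD)
  show "c \<odot>\<^bsub>P\<^esub> cls t = cls (Scale c t)" if "t \<in> lie_terms G"
    unfolding presented_lie_superalgebra_def
    by simp (rule UN_const[OF lie_class_self[OF that]], intro lie_class_eqI lie_congruence.Scale_cong lie_classD)
  show "bracket P (cls s) (cls t) = cls (Bracket s t)" if "s \<in> lie_terms G" "t \<in> lie_terms G"
    unfolding presented_lie_superalgebra_def
    by simp (rule UN_const[OF lie_class_self[OF that(1)]], rule UN_const[OF lie_class_self[OF that(2)]],
        intro lie_class_eqI lie_congruence.Bracket_cong lie_classD)
qed

lemma complex_space_presented: "complex_space P"
proof (rule complex_spaceI)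
  show "abelian_group P"
  proof (rule abelian_groupI)
    show comm: "x \<oplus>\<^bsub>P\<^esub> y = y \<oplus>\<^bsub>P\<^esub> x" if "x \<in> carrier P" "y \<in> carrier P" for x y
      using that unfolding presented_carrier
      by (elim imageE) (simp add: presented_ops lie_class_eqI[OF lie_congruence.Plus_comm])
    show "\<exists>y\<in>carrier P. y \<oplus>\<^bsub>P\<^esub> x = \<zero>\<^bsub>P\<^esub>" if "x \<in> carrier P" for x
    proof -
      obtain t where t: "t \<in> lie_terms G" "x = cls t" using \<open>x \<in> carrier P\<close> by (auto simp: presented_carrier)
      have "cls (Plus t (Scale (-1) t)) = cls Zero"
        using t by (intro lie_class_eqI lie_congruence.Plus_inverse)
      then have "x \<oplus>\<^bsub>P\<^esub> cls (Scale (-1) t) = \<zero>\<^bsub>P\<^esub>" "cls (Scale (-1) t) \<in> carrier P"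
        using t by (auto simp: presented_ops presented_carrier)
      then show ?thesis using comm[OF that] by auto
    qed
    show "\<zero>\<^bsub>P\<^esub> \<oplus>\<^bsub>P\<^esub> x = x" if "x \<in> carrier P" for x
    proof -
      obtain t where t: "t \<in> lie_terms G" "x = cls t" using \<open>x \<in> carrier P\<close> by (auto simp: presented_carrier)
      have "cls (Plus t Zero) = cls t"
        using t by (intro lie_class_eqI lie_congruence.Plus_Zero)
      then have "x \<oplus>\<^bsub>P\<^esub> \<zero>\<^bsub>P\<^esub> = x" "\<zero>\<^bsub>P\<^esub> \<in> carrier P"
        using t by (auto simp: presented_ops presented_carrier)
      then show ?thesis using comm[OF that] by simp
    qed
    show "x \<oplus>\<^bsub>P\<^esub> y \<oplus>\<^bsub>P\<^esub> z = x \<oplus>\<^bsub>P\<^esub> (y \<oplus>\<^bsub>P\<^esub> z)"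
      if "x \<in> carrier P" "y \<in> carrier P" "z \<in> carrier P" for x y z
      using that unfolding presented_carrier
      by (elim imageE) (simp add: presented_ops lie_class_eqI[OF lie_congruence.Plus_assoc])
  qed (auto simp: presented_carrier presented_ops)
next
  fix c d x y assume "x \<in> carrier P"
  then obtain t where t: "t \<in> lie_terms G" "x = cls t" by (auto simp: presented_carrier)
  then show "c \<odot>\<^bsub>P\<^esub> x \<in> carrier P" by (simp add: presented_ops presented_carrier)
  show "(c + d) \<odot>\<^bsub>P\<^esub> x = c \<odot>\<^bsub>P\<^esub> x \<oplus>\<^bsub>P\<^esub> d \<odot>\<^bsub>P\<^esub> x"
    using lie_class_eqI[OF lie_congruence.Scale_add[OF t(1)]] t by (simp add: presented_ops)
  show "(c * d) \<odot>\<^bsub>P\<^esub> x = c \<odot>\<^bsub>P\<^esub> (d \<odot>\<^bsub>P\<^esub> x)"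
    using lie_class_eqI[OF lie_congruence.Scale_mult[OF t(1)]] t by (simp add: presented_ops)
  show "1 \<odot>\<^bsub>P\<^esub> x = x"
    using lie_class_eqI[OF lie_congruence.Scale_one[OF t(1)]] t by (simp add: presented_ops)
  assume "y \<in> carrier P"
  then obtain s where s: "s \<in> lie_terms G" "y = cls s" by (auto simp: presented_carrier)
  show "c \<odot>\<^bsub>P\<^esub> (x \<oplus>\<^bsub>P\<^esub> y) = c \<odot>\<^bsub>P\<^esub> x \<oplus>\<^bsub>P\<^esub> c \<odot>\<^bsub>P\<^esub> y"
    using lie_class_eqI[OF lie_congruence.Scale_Plus[OF t(1) s(1)]] t s by (simp add: presented_ops)
qed

lemma presented_bracket_closed:
  "x \<in> carrier P \<Longrightarrow> y \<in> carrier P \<Longrightarrow> bracket P x y \<in> carrier P"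
  unfolding presented_carrier by (elim imageE) (simp add: presented_ops)

lemma presented_bracket_add:
  assumes "x \<in> carrier P" "y \<in> carrier P" "z \<in> carrier P"
  shows "bracket P (x \<oplus>\<^bsub>P\<^esub> y) z = bracket P x z \<oplus>\<^bsub>P\<^esub> bracket P y z"
    and "bracket P x (y \<oplus>\<^bsub>P\<^esub> z) = bracket P x y \<oplus>\<^bsub>P\<^esub> bracket P x z"
proof -
  obtain s t u where "s \<in> lie_terms G" "x = cls s" "t \<in> lie_terms G" "y = cls t"
    "u \<in> lie_terms G" "z = cls u"
    using assms unfolding presented_carrier by blast
  then show "bracket P (x \<oplus>\<^bsub>P\<^esub> y) z = bracket P x z \<oplus>\<^bsub>P\<^esub> bracket P y z"
    and "bracket P x (y \<oplus>\<^bsub>P\<^esub> z) = bracket P x y \<oplus>\<^bsub>P\<^esub> bracket P x z"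
    using lie_class_eqI[OF lie_congruence.Bracket_Plus_left, of s G t u \<pi> R]
      lie_class_eqI[OF lie_congruence.Bracket_Plus_right, of s G t u \<pi> R]
    by (simp_all add: presented_ops)
qed

lemma presented_bracket_scale:
  assumes "x \<in> carrier P" "y \<in> carrier P"
  shows "bracket P (c \<odot>\<^bsub>P\<^esub> x) y = c \<odot>\<^bsub>P\<^esub> bracket P x y"
    and "bracket P x (c \<odot>\<^bsub>P\<^esub> y) = c \<odot>\<^bsub>P\<^esub> bracket P x y"
proof -
  obtain s t where "s \<in> lie_terms G" "x = cls s" "t \<in> lie_terms G" "y = cls t"
    using assms unfolding presented_carrier by blast
  then show "bracket P (c \<odot>\<^bsub>P\<^esub> x) y = c \<odot>\<^bsub>P\<^esub> bracket P x y"
    and "bracket P x (c \<odot>\<^bsub>P\<^esub> y) = c \<odot>\<^bsub>P\<^esub> bracket P x y"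
    using lie_class_eqI[OF lie_congruence.Bracket_Scale_left[where s=s and t=t and c=c and G=G and \<pi>=\<pi> and R=R]]
      lie_class_eqI[OF lie_congruence.Bracket_Scale_right[where s=s and t=t and c=c and G=G and \<pi>=\<pi> and R=R]]
    by (simp_all add: presented_ops)
qed

text \<open>Induction on terms. \<open>Zero\<close> carries both parities, so a generator is
  completed by \<open>Zero\<close> in the parity it lacks; a bracket splits into four brackets,
  which are sorted by their parity.\<close>

lemma has_parity_decomp:
  assumes "t \<in> lie_terms G"
  shows "\<exists>s\<in>lie_terms G. \<exists>u\<in>lie_terms G. has_parity \<pi> s 0 \<and> has_parity \<pi> u 1 \<and>
    cls t = cls s \<oplus>\<^bsub>P\<^esub> cls u"
proof -
  interpret complex_vector_space P
    by (simp add: complex_vector_space_iff complex_space_presented)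
  have c [simp]: "cls t \<in> carrier P" if "t \<in> lie_terms G" for t
    using that by (auto simp: presented_carrier)
  have z: "cls Zero = \<zero>\<^bsub>P\<^esub>" by (simp add: presented_ops)
  show ?thesis
    using assms
  proof (induction t)
    case (Gen g)
    then have g: "Gen g \<in> lie_terms G" by simp
    then have "cls (Gen g) = cls (Gen g) \<oplus>\<^bsub>P\<^esub> cls Zero" "cls (Gen g) = cls Zero \<oplus>\<^bsub>P\<^esub> cls (Gen g)"
      by (simp_all add: z)
    moreover have "has_parity \<pi> (Gen g) 0 \<or> has_parity \<pi> (Gen g) 1"
      using has_parity.intros(1)[of \<pi> g] by (cases "\<pi> g") auto
    ultimately show ?case
      using g has_parity.intros(2)[of \<pi> 0] has_parity.intros(2)[of \<pi> 1] lie_terms_simps(2)[of G]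
      by blast
  next
    case Zero
    have "cls Zero = cls Zero \<oplus>\<^bsub>P\<^esub> cls Zero" by (simp add: z)
    then show ?case
      using has_parity.intros(2)[of \<pi> 0] has_parity.intros(2)[of \<pi> 1] lie_terms_simps(2)[of G]
      by blast
  next
    case (Plus t1 t2)
    then obtain s1 u1 s2 u2 where t: "s1 \<in> lie_terms G" "u1 \<in> lie_terms G" "s2 \<in> lie_terms G"
      "u2 \<in> lie_terms G" "has_parity \<pi> s1 0" "has_parity \<pi> u1 1" "has_parity \<pi> s2 0"
      "has_parity \<pi> u2 1" "cls t1 = cls s1 \<oplus>\<^bsub>P\<^esub> cls u1" "cls t2 = cls s2 \<oplus>\<^bsub>P\<^esub> cls u2"
      by (metis lie_terms_simps(3))
    have "cls (Plus t1 t2) = cls (Plus s1 s2) \<oplus>\<^bsub>P\<^esub> cls (Plus u1 u2)"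
      using t(1-4) t(9,10) Plus.prems by (simp add: presented_ops(2)[symmetric] a_ac)
    moreover have "has_parity \<pi> (Plus s1 s2) 0" "has_parity \<pi> (Plus u1 u2) 1"
      using t by (auto intro: has_parity.intros)
    ultimately show ?case
      using t(1-4) by (intro bexI[of _ "Plus s1 s2"] bexI[of _ "Plus u1 u2"]) auto
  next
    case (Scale c t)
    then obtain s u where t: "s \<in> lie_terms G" "u \<in> lie_terms G" "has_parity \<pi> s 0" "has_parity \<pi> u 1"
      "cls t = cls s \<oplus>\<^bsub>P\<^esub> cls u" by auto
    have "cls (Scale c t) = cls (Scale c s) \<oplus>\<^bsub>P\<^esub> cls (Scale c u)"
      using t(1,2,5) Scale.prems by (simp add: presented_ops(3)[symmetric] scale_add_right)
    then show ?case using t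
      by (intro bexI[of _ "Scale c s"] bexI[of _ "Scale c u"]) (auto intro: has_parity.intros(4))
  next
    case (Bracket t1 t2)
    then obtain s1 u1 s2 u2 where t: "s1 \<in> lie_terms G" "u1 \<in> lie_terms G" "s2 \<in> lie_terms G"
      "u2 \<in> lie_terms G" "has_parity \<pi> s1 0" "has_parity \<pi> u1 1" "has_parity \<pi> s2 0"
      "has_parity \<pi> u2 1" "cls t1 = cls s1 \<oplus>\<^bsub>P\<^esub> cls u1" "cls t2 = cls s2 \<oplus>\<^bsub>P\<^esub> cls u2"
      by (metis lie_terms_simps(5))
    let ?s = "Plus (Bracket s1 s2) (Bracket u1 u2)" and ?u = "Plus (Bracket s1 u2) (Bracket u1 s2)"
    have "cls (Bracket t1 t2) = cls ?s \<oplus>\<^bsub>P\<^esub> cls ?u"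
      using t(1-4) t(9,10) Bracket.prems
      by (simp add: presented_ops(2,4)[symmetric] presented_bracket_closed presented_bracket_add a_ac)
    moreover have "has_parity \<pi> ?s 0"
      using has_parity.intros(5)[OF t(5,7)] has_parity.intros(5)[OF t(6,8)]
      by (auto intro: has_parity.intros(3))
    moreover have "has_parity \<pi> ?u 1"
      using has_parity.intros(5)[OF t(5,8)] has_parity.intros(5)[OF t(6,7)]
      by (auto intro: has_parity.intros(3))
    ultimately show ?case
      using t(1-4) by (intro bexI[of _ ?s] bexI[of _ ?u]) auto
  qed
qed

lemma lie_super_presented: "lie_super P"
proof -
  have "lie_super_axioms P"
  proof
    show "part P i \<subseteq> carrier P" for i by (auto simp: presented_part presented_carrier)
    show "\<zero>\<^bsub>P\<^esub> \<in> part P i" for i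
      by (auto simp: presented_part presented_ops intro!: imageI has_parity.intros)
    show "x \<oplus>\<^bsub>P\<^esub> y \<in> part P i" if "x \<in> part P i" "y \<in> part P i" for x y i
      using that by (auto simp: presented_part presented_ops intro!: imageI has_parity.intros)
    show "c \<odot>\<^bsub>P\<^esub> x \<in> part P i" if "x \<in> part P i" for x c i
      using that by (auto simp: presented_part presented_ops intro!: imageI has_parity.intros)
    show "bracket P x y \<in> part P (i + j)" if xy: "x \<in> part P i" "y \<in> part P j" for x y i j
    proof -
      obtain s t where "s \<in> lie_terms G" "has_parity \<pi> s i" "x = cls s"
        "t \<in> lie_terms G" "has_parity \<pi> t j" "y = cls t"
        using xy unfolding presented_part by blast
      moreover from this have "bracket P x y = cls (Bracket s t)" "Bracket s t \<in> lie_terms G"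
        by (simp_all add: presented_ops)
      moreover from calculation have "has_parity \<pi> (Bracket s t) (i + j)"
        by (intro has_parity.intros(5))
      ultimately show ?thesis unfolding presented_part by blast
    qed
    show "\<exists>y\<in>part P 0. \<exists>z\<in>part P 1. x = y \<oplus>\<^bsub>P\<^esub> z" if x: "x \<in> carrier P" for x
    proof -
      obtain t where t: "t \<in> lie_terms G" "x = cls t" using x by (auto simp: presented_carrier)
      obtain s u where "s \<in> lie_terms G" "u \<in> lie_terms G" "has_parity \<pi> s 0" "has_parity \<pi> u 1"
        "cls t = cls s \<oplus>\<^bsub>P\<^esub> cls u"
        using has_parity_decomp[OF t(1)] by blast
      then have "cls s \<in> part P 0" "cls u \<in> part P 1" "x = cls s \<oplus>\<^bsub>P\<^esub> cls u"
        using t by (auto simp: presented_part)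
      then show ?thesis by blast
    qed
    show "bracket P x y = (- koszul_sign i j) \<odot>\<^bsub>P\<^esub> bracket P y x"
      if xy: "x \<in> part P i" "y \<in> part P j" for x y i j
    proof -
      obtain s t where "s \<in> lie_terms G" "has_parity \<pi> s i" "x = cls s"
        "t \<in> lie_terms G" "has_parity \<pi> t j" "y = cls t"
        using xy unfolding presented_part by blast
      then show ?thesis
        by (simp add: presented_ops) (rule lie_class_eqI lie_congruence.Bracket_skew | assumption)+
    qed
    show "bracket P x (bracket P y z) =
          bracket P (bracket P x y) z \<oplus>\<^bsub>P\<^esub> koszul_sign i j \<odot>\<^bsub>P\<^esub> bracket P y (bracket P x z)"
      if xyz: "x \<in> part P i" "y \<in> part P j" "z \<in> carrier P" for x y z i j
    proof -
      obtain s t u where "s \<in> lie_terms G" "has_parity \<pi> s i" "x = cls s"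
        "t \<in> lie_terms G" "has_parity \<pi> t j" "y = cls t" "u \<in> lie_terms G" "z = cls u"
        using xyz unfolding presented_part presented_carrier by blast
      then show ?thesis
        by (simp add: presented_ops) (rule lie_class_eqI lie_congruence.Bracket_jacobi | assumption)+
    qed
  qed (simp_all add: presented_bracket_closed presented_bracket_add presented_bracket_scale)
  then show ?thesis
    by (simp add: lie_super_def complex_vector_space_def complex_space_presented)
qed

text \<open>The rules of \<open>has_parity\<close> and of \<open>homogeneous_generated\<close> match
  one by one, so a homogeneous term is itself a recipe for generating its class.\<close>

lemma presented_generated:
  assumes "x \<in> part P i"
  shows "homogeneous_generated P (\<lambda>i. (\<lambda>g. cls (Gen g)) ` {g \<in> G. \<pi> g = i}) i x"
proof -
  obtain t where t: "t \<in> lie_terms G" "has_parity \<pi> t i" "x = cls t"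
    using assms unfolding presented_part by blast
  from t(2,1) have "homogeneous_generated P (\<lambda>i. (\<lambda>g. cls (Gen g)) ` {g \<in> G. \<pi> g = i}) i (cls t)"
  proof induction
    case (1 g)
    then show ?case by (auto intro!: hgen_base)
  next
    case (2 i)
    then show ?case using hgen_zero[of P _ i] by (simp add: presented_ops)
  next
    case (3 s i t)
    then show ?case using hgen_add[of P _ i "cls s" "cls t"] by (simp add: presented_ops)
  next
    case (4 t i c)
    then show ?case using hgen_scale[of P _ i "cls t" c] by (simp add: presented_ops)
  next
    case (5 s i t j)
    then have st: "s \<in> lie_terms G" "t \<in> lie_terms G" by simp_all
    show ?case
      unfolding presented_ops(4)[OF st, symmetric] by (rule hgen_bracket[OF 5(3)[OF st(1)] 5(4)[OF st(2)]])
  qed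
  then show ?thesis by (simp add: t)
qed

end

primrec eval_term :: "'a lie_superalgebra \<Rightarrow> ('g \<Rightarrow> 'a) \<Rightarrow> 'g lie_term \<Rightarrow> 'a"
  where
  "eval_term L \<gamma> (Gen g) = \<gamma> g"
| "eval_term L \<gamma> Zero = \<zero>\<^bsub>L\<^esub>"
| "eval_term L \<gamma> (Plus s t) = eval_term L \<gamma> s \<oplus>\<^bsub>L\<^esub> eval_term L \<gamma> t"
| "eval_term L \<gamma> (Scale c t) = c \<odot>\<^bsub>L\<^esub> eval_term L \<gamma> t"
| "eval_term L \<gamma> (Bracket s t) = bracket L (eval_term L \<gamma> s) (eval_term L \<gamma> t)"

text \<open>The representative is chosen arbitrarily; \<open>eval_term_cong\<close> makes the value
  independent of the choice.\<close>

definition eval_class :: "'a lie_superalgebra \<Rightarrow> ('g \<Rightarrow> 'a) \<Rightarrow> 'g lie_term set \<Rightarrow> 'a"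
  where "eval_class L \<gamma> A = eval_term L \<gamma> (SOME t. t \<in> A)"

context lie_super
begin

context
  fixes G :: "'g set" and \<pi> :: "'g \<Rightarrow> bit" and \<gamma> :: "'g \<Rightarrow> 'a"
  assumes gen: "\<And>g. g \<in> G \<Longrightarrow> \<gamma> g \<in> part L (\<pi> g)"
begin

lemma eval_term_closed: "t \<in> lie_terms G \<Longrightarrow> eval_term L \<gamma> t \<in> carrier L"
  by (induction t) (auto intro: part_carrier gen)

lemma eval_term_part: "has_parity \<pi> t i \<Longrightarrow> t \<in> lie_terms G \<Longrightarrow> eval_term L \<gamma> t \<in> part L i"
proof (induction rule: has_parity.induct)
  case (5 s i t j)
  then have "eval_term L \<gamma> s \<in> part L i" "eval_term L \<gamma> t \<in> part L j" by simp_all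
  then show ?case unfolding eval_term.simps by (rule part_bracket)
qed (auto intro: gen part_zero part_add part_scale)

context
  fixes R :: "'g lie_term rel"
  assumes rel: "\<And>s t. (s, t) \<in> R \<Longrightarrow> s \<in> lie_terms G \<Longrightarrow> t \<in> lie_terms G \<Longrightarrow>
    eval_term L \<gamma> s = eval_term L \<gamma> t"
begin

lemma eval_term_cong: "(s, t) \<in> lie_congruence G \<pi> R \<Longrightarrow> eval_term L \<gamma> s = eval_term L \<gamma> t"
proof (induction rule: lie_congruence.induct)
  case (Bracket_skew s t i j)
  then show ?case unfolding eval_term.simps by (intro bracket_skew eval_term_part)
next
  case (Bracket_jacobi s t u i j)
  then show ?case
    unfolding eval_term.simps by (intro bracket_jacobi eval_term_part eval_term_closed)
next
  case (relation s t)
  then show ?case by (rule rel)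
next
  case (Plus_assoc s t u)
  then show ?case by (simp add: eval_term_closed a_assoc)
next
  case (Plus_comm s t)
  then show ?case by (simp add: eval_term_closed a_comm)
next
  case (Scale_add t c d)
  then show ?case by (simp add: eval_term_closed scale_add_left)
qed (simp_all add: eval_term_closed add_scale_minus
    scale_add_right bracket_add_left bracket_add_right bracket_scale_left bracket_scale_right)

lemma eval_class: "t \<in> lie_terms G \<Longrightarrow> eval_class L \<gamma> (lie_class G \<pi> R t) = eval_term L \<gamma> t"
  unfolding eval_class_def
  by (rule someI2[of _ t], erule lie_class_self) (rule eval_term_cong[OF lie_classD])

text \<open>The universal property of the presentation, and the source of the homomorphisms that are
  prescribed on generators.\<close>

lemma super_hom_eval_class: "super_hom (presented_lie_superalgebra G \<pi> R) L (eval_class L \<gamma>)"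
  unfolding super_hom_def presented_carrier presented_part
  by (simp add: presented_ops eval_class eval_term_closed eval_term_part image_subset_iff Pi_iff)

end

end

section \<open>Quotients by superideals\<close>

context
  fixes I
  assumes I: "superideal I L"
begin

lemma superideal_submodule:
  "I \<subseteq> carrier L" "\<zero> \<in> I" "x \<in> I \<Longrightarrow> y \<in> I \<Longrightarrow> x \<oplus> y \<in> I" "x \<in> I \<Longrightarrow> c \<odot> x \<in> I"
  using I by (auto simp: superideal_def submodule_iff)

lemma quotient_eq_iff:
  assumes "x \<in> carrier L" "y \<in> carrier L"
  shows "I +> x = I +> y \<longleftrightarrow> x \<oplus> (-1) \<odot> y \<in> I"
proof
  assume eq: "I +> x = I +> y"
  have "x \<in> I +> x" using superideal_submodule(2) assms(1) by (force simp: a_r_coset_def')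
  then obtain i where i: "i \<in> I" "x = i \<oplus> y" using eq by (auto simp: a_r_coset_def')
  then have "x \<oplus> (-1) \<odot> y = i \<oplus> (y \<oplus> (-1) \<odot> y)"
    using superideal_submodule(1) assms by (simp add: a_assoc subset_iff)
  then show "x \<oplus> (-1) \<odot> y \<in> I" using i superideal_submodule(1) assms
    by (simp add: add_scale_minus subset_iff)
next
  assume d: "x \<oplus> (-1) \<odot> y \<in> I"
  have e: "y \<oplus> (-1) \<odot> x \<in> I"
    using superideal_submodule(4)[OF d, of "-1"] assms by (simp add: scale_add_right a_comm)
  have *: "I +> x \<subseteq> I +> y"
    if "x \<in> carrier L" "y \<in> carrier L" "x \<oplus> (-1) \<odot> y \<in> I" for x y
  proof
    fix u assume "u \<in> I +> x"
    then obtain i where i: "i \<in> I" "u = i \<oplus> x" by (auto simp: a_r_coset_def')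
    then have "u = (i \<oplus> (x \<oplus> (-1) \<odot> y)) \<oplus> y"
      using superideal_submodule(1) that add_scale_minus[of y] a_comm[of y "(-1) \<odot> y"]
      by (simp add: a_assoc subset_iff)
    then show "u \<in> I +> y" using superideal_submodule(3)[OF i(1) that(3)]
      by (auto simp: a_r_coset_def')
  qed
  show "I +> x = I +> y" using *[OF assms d] *[OF assms(2,1) e] by blast
qed

lemma quotient_self: "x \<in> carrier L \<Longrightarrow> x \<in> I +> x"
  using superideal_submodule(2) by (force simp: a_r_coset_def')

lemma quotient_memD: "y \<in> I +> x \<Longrightarrow> x \<in> carrier L \<Longrightarrow> y \<in> carrier L \<and> I +> y = I +> x"
proof -
  assume "y \<in> I +> x" and x: "x \<in> carrier L"
  then obtain i where i: "i \<in> I" "y = i \<oplus> x" by (auto simp: a_r_coset_def')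
  then have "y \<oplus> (-1) \<odot> x = i \<oplus> (x \<oplus> (-1) \<odot> x)"
    using superideal_submodule(1) x by (simp add: a_assoc subset_iff)
  then have "y \<oplus> (-1) \<odot> x \<in> I" "y \<in> carrier L"
    using i superideal_submodule(1) x by (auto simp: add_scale_minus subset_iff)
  then show ?thesis using x by (simp add: quotient_eq_iff)
qed

lemma quotient_zero_iff: "x \<in> carrier L \<Longrightarrow> I +> x = I \<longleftrightarrow> x \<in> I"
proof -
  assume x: "x \<in> carrier L"
  have "I +> \<zero> = I" using superideal_submodule(1) by (force simp: a_r_coset_def')
  then show ?thesis using quotient_eq_iff[OF x zero_closed] x by simp
qed

lemma quotient_ops:
  "\<zero>\<^bsub>super_quotient L I\<^esub> = I +> \<zero>"
  "x \<in> carrier L \<Longrightarrow> y \<in> carrier L \<Longrightarrow> (I +> x) \<oplus>\<^bsub>super_quotient L I\<^esub> (I +> y) = I +> (x \<oplus> y)"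
  "x \<in> carrier L \<Longrightarrow> c \<odot>\<^bsub>super_quotient L I\<^esub> (I +> x) = I +> (c \<odot> x)"
  "x \<in> carrier L \<Longrightarrow> y \<in> carrier L \<Longrightarrow>
    bracket (super_quotient L I) (I +> x) (I +> y) = I +> bracket L x y"
  "carrier (super_quotient L I) = (\<lambda>x. I +> x) ` carrier L"
  "part (super_quotient L I) i = (\<lambda>x. I +> x) ` part L i"
proof -
  show "\<zero>\<^bsub>super_quotient L I\<^esub> = I +> \<zero>"
    using quotient_zero_iff[of \<zero>] superideal_submodule(2) by (simp add: super_quotient_def)
  show "carrier (super_quotient L I) = (\<lambda>x. I +> x) ` carrier L"
    by (auto simp: super_quotient_def A_RCOSETS_def')
  show "part (super_quotient L I) i = (\<lambda>x. I +> x) ` part L i"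
    by (simp add: super_quotient_def)
  have c: "x \<oplus> (-1) \<odot> x' \<in> I \<and> x' \<in> carrier L" if "x' \<in> I +> x" "x \<in> carrier L" for x x'
    using quotient_memD[OF that] quotient_eq_iff[of x x'] that by auto
  have sc: "I +> (c \<odot> x') = I +> (c \<odot> x)" if "x' \<in> I +> x" "x \<in> carrier L" for x x' c
  proof -
    have "c \<odot> x \<oplus> (-1) \<odot> (c \<odot> x') = c \<odot> (x \<oplus> (-1) \<odot> x')"
      using c[OF that] that by (simp add: scale_add_right)
    then have "c \<odot> x \<oplus> (-1) \<odot> (c \<odot> x') \<in> I"
      using c[OF that] superideal_submodule(4) by simp
    then have "I +> (c \<odot> x) = I +> (c \<odot> x')" using c[OF that] that(2) by (subst quotient_eq_iff) simp_all
    then show ?thesis ..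
  qed
  show "c \<odot>\<^bsub>super_quotient L I\<^esub> (I +> x) = I +> (c \<odot> x)" if x: "x \<in> carrier L"
    by (simp add: super_quotient_def) (rule UN_const[OF quotient_self[OF x] sc[OF _ x]])
  have br: "I +> bracket L x' y' = I +> bracket L x y"
    if x: "x' \<in> I +> x" "x \<in> carrier L" and y: "y' \<in> I +> y" "y \<in> carrier L" for x x' y y'
  proof -
    note cx = c[OF x] and cy = c[OF y]
    \<comment> \<open>Telescoping through \<open>[x', y]\<close>: the difference is
      \<open>[x - x', y] + [x', y - y']\<close>, and both summands lie in the two-sided
      ideal.\<close>
    have "bracket L x y \<oplus> (-1) \<odot> bracket L x' y' =
      bracket L (x \<oplus> (-1) \<odot> x') y \<oplus> bracket L x' (y \<oplus> (-1) \<odot> y')"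
    proof -
      have *: "bracket L x y \<oplus> (-1) \<odot> bracket L x' y' =
        bracket L x y \<oplus> (((-1) \<odot> bracket L x' y \<oplus> bracket L x' y) \<oplus> (-1) \<odot> bracket L x' y')"
        using cx cy x y add_scale_minus[of "bracket L x' y"]
        by (simp add: a_comm[of "(-1) \<odot> bracket L x' y" "bracket L x' y"])
      show ?thesis unfolding * using cx cy x y
        by (simp add: bracket_add_left bracket_add_right bracket_scale_left bracket_scale_right a_assoc)
    qed
    also have "\<dots> \<in> I"
      using I cx cy x y by (intro superideal_submodule(3)) (auto simp: superideal_def)
    finally have "I +> bracket L x y = I +> bracket L x' y'" using cx cy x y by (subst quotient_eq_iff) simp_all
    then show ?thesis ..
  qed
  show "bracket (super_quotient L I) (I +> x) (I +> y) = I +> bracket L x y"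
    if x: "x \<in> carrier L" and y: "y \<in> carrier L"
    by (simp add: super_quotient_def)
      (rule UN_const[OF quotient_self[OF x]], rule UN_const[OF quotient_self[OF y]], rule br[OF _ x _ y])
  show "(I +> x) \<oplus>\<^bsub>super_quotient L I\<^esub> (I +> y) = I +> (x \<oplus> y)"
    if x: "x \<in> carrier L" and y: "y \<in> carrier L"
  proof -
    \<comment> \<open>Unlike the other operations on cosets, addition is the setwise sum, so two
      inclusions are shown.\<close>
    have "set_add L (I +> x) (I +> y) = I +> (x \<oplus> y)"
    proof (intro equalityI subsetI)
      fix u assume "u \<in> set_add L (I +> x) (I +> y)"
      then obtain i j where i: "i \<in> I" "j \<in> I" "u = (i \<oplus> x) \<oplus> (j \<oplus> y)"
        by (auto simp: a_r_coset_def' set_add_def')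
      moreover have "i \<in> carrier L" "j \<in> carrier L" using i superideal_submodule(1) by auto
      ultimately have "u = (i \<oplus> j) \<oplus> (x \<oplus> y)" using x y by (simp add: a_ac)
      then show "u \<in> I +> (x \<oplus> y)" using superideal_submodule(3)[OF i(1,2)] by (auto simp: a_r_coset_def')
    next
      fix u assume "u \<in> I +> (x \<oplus> y)"
      then obtain i where i: "i \<in> I" "u = i \<oplus> (x \<oplus> y)" by (auto simp: a_r_coset_def')
      then have "i \<oplus> x \<in> I +> x" "u = (i \<oplus> x) \<oplus> y"
        using superideal_submodule(1) x y by (auto simp: a_assoc a_r_coset_def' subset_iff)
      then show "u \<in> set_add L (I +> x) (I +> y)"
        using quotient_self[OF y] unfolding set_add_def' by blast
    qed
    then show ?thesis by (simp add: super_quotient_def)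
  qed
qed

lemma lie_super_quotient: "lie_super (super_quotient L I)"
  by (rule homomorphic_image[where q = "\<lambda>x. I +> x"]) (auto simp: quotient_ops)

lemma super_hom_quotient: "super_hom L (super_quotient L I) (\<lambda>x. I +> x)"
  by (auto simp: super_hom_def quotient_ops)

end

end

section \<open>Eigenspaces\<close>

text \<open>\<open>lin_comb\<close> is a sum over a finite index set, whereas the sets of words
  spanned below are infinite in general; hence an inductive span.\<close>

inductive_set span :: "(complex, 'a, 'm) module_scheme \<Rightarrow> 'a set \<Rightarrow> 'a set"
  for V W where
  span_base: "w \<in> W \<Longrightarrow> w \<in> span V W"
| span_zero: "\<zero>\<^bsub>V\<^esub> \<in> span V W"
| span_add: "u \<in> span V W \<Longrightarrow> w \<in> span V W \<Longrightarrow> u \<oplus>\<^bsub>V\<^esub> w \<in> span V W"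
| span_scale: "u \<in> span V W \<Longrightarrow> c \<odot>\<^bsub>V\<^esub> u \<in> span V W"

lemma span_mono: "u \<in> span V W \<Longrightarrow> W \<subseteq> W' \<Longrightarrow> u \<in> span V W'"
  by (induction rule: span.induct) (auto intro: span.intros)

lemma span_scale_base: "w \<in> W \<Longrightarrow> c \<odot>\<^bsub>V\<^esub> w \<in> span V W"
  by (intro span_scale span_base)

text \<open>The \<open>P k\<close> are meant to be subspaces of the \<open>k\<close>-eigenspaces of
  one operator, possibly proper ones. Whatever is known of the spanning vectors of eigenvalue
  \<open>k\<close> is put into \<open>P k\<close>, and \<open>eigenspace_eigen_sums\<close> turns it
  into a statement on the full eigenspace.\<close>

definition eigen_sums :: "(complex, 'a, 'm) module_scheme \<Rightarrow> (complex \<Rightarrow> 'a set) \<Rightarrow> 'a set"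
  where "eigen_sums V P = {\<Oplus>\<^bsub>V\<^esub>k\<in>S. w k | S w. finite S \<and> (\<forall>k\<in>S. w k \<in> P k)}"

context complex_vector_space
begin

lemma span_carrier: "u \<in> span V W \<Longrightarrow> W \<subseteq> carrier V \<Longrightarrow> u \<in> carrier V"
  by (induction rule: span.induct) auto

lemma span_subset:
  "u \<in> span V W \<Longrightarrow> submodule N complex_field V \<Longrightarrow> W \<subseteq> N \<Longrightarrow> u \<in> N"
  by (induction rule: span.induct) (auto simp: submodule_iff)

lemma submodule_span: "W \<subseteq> carrier V \<Longrightarrow> submodule (span V W) complex_field V"
  using span_carrier by (auto simp: submodule_iff intro: span.intros)

text \<open>Applying \<open>T - k\<close> removes the component at \<open>k\<close> and multiplies
  every other one by a nonzero number \<open>i - k\<close>, so an induction on the number of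
  eigenvalues isolates the components; the removed one is recovered by subtraction.\<close>

lemma eigen_component:
  assumes N: "submodule N complex_field V"
    and T: "\<And>u. u \<in> carrier V \<Longrightarrow> T u \<in> carrier V"
      "\<And>u w. u \<in> carrier V \<Longrightarrow> w \<in> carrier V \<Longrightarrow> T (u \<oplus> w) = T u \<oplus> T w"
      "\<And>c u. u \<in> carrier V \<Longrightarrow> T (c \<odot> u) = c \<odot> T u"
    and TN: "\<And>u. u \<in> N \<Longrightarrow> T u \<in> N"
    and "finite S" and "\<And>k. k \<in> S \<Longrightarrow> w k \<in> carrier V \<and> T (w k) = k \<odot> w k"
    and "(\<Oplus>k\<in>S. w k) \<in> N" and "j \<in> S"
  shows "w j \<in> N"
  using assms(6-)
proof (induction S arbitrary: w j rule: finite_induct)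
  case empty
  then show ?case by simp
next
  case (insert k S)
  have N': "N \<subseteq> carrier V" "\<And>x y. x \<in> N \<Longrightarrow> y \<in> N \<Longrightarrow> x \<oplus> y \<in> N" "\<And>c x. x \<in> N \<Longrightarrow> c \<odot> x \<in> N"
    using N by (auto simp: submodule_iff)
  have w: "\<And>i. i \<in> S \<Longrightarrow> w i \<in> carrier V" "\<And>i. i \<in> S \<Longrightarrow> T (w i) = i \<odot> w i"
    and wk: "w k \<in> carrier V" "T (w k) = k \<odot> w k"
    using insert.prems(1) by auto
  have sum: "(\<Oplus>i\<in>S. w i) \<in> carrier V" using w by (intro finsum_closed) auto
  have eq: "(\<Oplus>i\<in>insert k S. w i) = w k \<oplus> (\<Oplus>i\<in>S. w i)"
    using insert.hyps w wk by (intro finsum_insert) auto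
  have shift: "T (\<Oplus>i\<in>S'. w i) \<oplus> (- k) \<odot> (\<Oplus>i\<in>S'. w i) = (\<Oplus>i\<in>S'. (i - k) \<odot> w i)"
    if "finite S'" "S' \<subseteq> S" for S'
    using that
  proof (induction S' rule: finite_induct)
    case empty
    then show ?case using T(3)[of \<zero> 0] T(1)[of \<zero>] by simp
  next
    case (insert i F)
    have F: "(\<Oplus>i\<in>F. w i) \<in> carrier V" "(\<Oplus>i\<in>F. (i - k) \<odot> w i) \<in> carrier V"
      using insert.prems w by (auto intro!: finsum_closed)
    have wi: "w i \<in> carrier V" "T (w i) = i \<odot> w i" using insert.prems w by auto
    have "(\<Oplus>j\<in>insert i F. w j) = w i \<oplus> (\<Oplus>i\<in>F. w i)"
      "(\<Oplus>j\<in>insert i F. (j - k) \<odot> w j) = (i - k) \<odot> w i \<oplus> (\<Oplus>i\<in>F. (i - k) \<odot> w i)"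
      using insert.hyps insert.prems w by (intro finsum_insert; auto)+
    moreover have "(i - k) \<odot> w i = i \<odot> w i \<oplus> (- k) \<odot> w i"
      using scale_add_left[OF wi(1), of i "- k"] by simp
    ultimately show ?case
      using insert F wi T(1)[OF F(1)] by (simp add: T(2) scale_add_right a_ac)
  qed
  have "T (w k \<oplus> (\<Oplus>i\<in>S. w i)) \<oplus> (- k) \<odot> (w k \<oplus> (\<Oplus>i\<in>S. w i)) =
    (k \<odot> w k \<oplus> (- k) \<odot> w k) \<oplus> (T (\<Oplus>i\<in>S. w i) \<oplus> (- k) \<odot> (\<Oplus>i\<in>S. w i))"
    using wk sum T(1)[OF sum] by (simp add: T(2) scale_add_right a_ac)
  also have "k \<odot> w k \<oplus> (- k) \<odot> w k = \<zero>"
    using scale_add_left[OF wk(1), of k "- k"] wk by simp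
  also have "\<zero> \<oplus> (T (\<Oplus>i\<in>S. w i) \<oplus> (- k) \<odot> (\<Oplus>i\<in>S. w i)) = (\<Oplus>i\<in>S. (i - k) \<odot> w i)"
    using shift[OF insert.hyps(1) subset_refl] sum T(1)[OF sum] by (metis add.l_one add.m_closed scale_closed)
  finally have "(\<Oplus>i\<in>S. (i - k) \<odot> w i) \<in> N"
    using insert.prems(2) eq TN[OF insert.prems(2)] N' by (metis)
  then have comp: "w i \<in> N" if "i \<in> S" for i
  proof -
    have "(i - k) \<odot> w i \<in> N"
      using insert.IH[of "\<lambda>i. (i - k) \<odot> w i" i] w that \<open>(\<Oplus>i\<in>S. (i - k) \<odot> w i) \<in> N\<close>
      by (auto simp: T(3) mult.commute)
    then have "inverse (i - k) \<odot> ((i - k) \<odot> w i) \<in> N" using N'(3) by blast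
    then show ?thesis using insert.hyps(2) that w by (cases "i = k") auto
  qed
  have sumN: "(\<Oplus>i\<in>S. w i) \<in> N"
    using insert.hyps(1) comp
    by (induction S rule: finite_induct)
      (use N N'(1) in \<open>auto simp: submodule_iff subset_iff Pi_iff\<close>)
  have "w k = (w k \<oplus> (\<Oplus>i\<in>S. w i)) \<oplus> (-1) \<odot> (\<Oplus>i\<in>S. w i)"
    using wk sum by (simp add: a_assoc add_scale_minus)
  also have "\<dots> \<in> N" using sumN insert.prems(2) eq N' by auto
  finally show ?case using comp insert.prems(3) by auto
qed

context
  fixes P :: "complex \<Rightarrow> 'a set"
  assumes P: "\<And>k. submodule (P k) complex_field V"
begin

private lemma P': "P k \<subseteq> carrier V" "\<zero> \<in> P k" "x \<in> P k \<Longrightarrow> y \<in> P k \<Longrightarrow> x \<oplus> y \<in> P k"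
  "x \<in> P k \<Longrightarrow> c \<odot> x \<in> P k"
  using P[of k] by (auto simp: submodule_iff)

lemma eigen_sums_base: "w \<in> P k \<Longrightarrow> w \<in> eigen_sums V P"
proof -
  assume w: "w \<in> P k"
  then have "w = (\<Oplus>i\<in>{k}. w)" using P'(1)[of k] by (subst finsum_insert) auto
  then show ?thesis unfolding eigen_sums_def using w by (auto intro!: exI[of _ "{k}"] exI[of _ "\<lambda>_. w"])
qed

lemma eigen_sums_carrier: "u \<in> eigen_sums V P \<Longrightarrow> u \<in> carrier V"
  using P'(1) by (auto simp: eigen_sums_def intro!: finsum_closed)

lemma eigen_sums_extend:
  assumes "finite S" "\<And>k. k \<in> S \<Longrightarrow> w k \<in> P k" "finite S'" "S \<subseteq> S'"
  shows "(\<Oplus>k\<in>S. w k) = (\<Oplus>k\<in>S'. if k \<in> S then w k else \<zero>)"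
  using assms P'(2) subsetD[OF P'(1) assms(2)] by (intro add.finprod_mono_neutral_cong_left[folded finsum_def, simplified]) auto

lemma eigen_sums_add:
  assumes "u \<in> eigen_sums V P" "u' \<in> eigen_sums V P"
  shows "u \<oplus> u' \<in> eigen_sums V P"
proof -
  from assms obtain S w S' w' where u: "finite S" "\<And>k. k \<in> S \<Longrightarrow> w k \<in> P k" "u = (\<Oplus>k\<in>S. w k)"
    and u': "finite S'" "\<And>k. k \<in> S' \<Longrightarrow> w' k \<in> P k" "u' = (\<Oplus>k\<in>S'. w' k)"
    unfolding eigen_sums_def by blast
  let ?w = "\<lambda>k. if k \<in> S then w k else \<zero>" and ?w' = "\<lambda>k. if k \<in> S' then w' k else \<zero>"
  have c: "?w k \<in> P k" "?w' k \<in> P k" for k using u u' P'(2) by auto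
  have "u \<oplus> u' = (\<Oplus>k\<in>S \<union> S'. ?w k) \<oplus> (\<Oplus>k\<in>S \<union> S'. ?w' k)"
    unfolding u(3) u'(3) using u(1) u'(1)
      eigen_sums_extend[of S w, OF u(1,2), of "S \<union> S'"] eigen_sums_extend[of S' w', OF u'(1,2), of "S \<union> S'"]
    by simp
  also have "\<dots> = (\<Oplus>k\<in>S \<union> S'. ?w k \<oplus> ?w' k)"
    using c P'(1) by (intro finsum_addf[symmetric]) blast+
  finally have "u \<oplus> u' = (\<Oplus>k\<in>S \<union> S'. ?w k \<oplus> ?w' k)" .
  moreover have "\<forall>k\<in>S \<union> S'. ?w k \<oplus> ?w' k \<in> P k" using c P'(3) by blast
  moreover have "finite (S \<union> S')" using u(1) u'(1) by simp
  ultimately show ?thesis unfolding eigen_sums_def by blast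
qed

lemma eigen_sums_scale:
  assumes "u \<in> eigen_sums V P"
  shows "c \<odot> u \<in> eigen_sums V P"
proof -
  from assms obtain S w where u: "finite S" "\<And>k. k \<in> S \<Longrightarrow> w k \<in> P k" "u = (\<Oplus>k\<in>S. w k)"
    unfolding eigen_sums_def by blast
  from u(1,2) have "c \<odot> (\<Oplus>k\<in>S. w k) \<in> eigen_sums V P"
  proof (induction S rule: finite_induct)
    case empty
    then show ?case using eigen_sums_base[OF P'(2)] by simp
  next
    case (insert k S)
    have w: "w k \<in> carrier V" "w \<in> S \<rightarrow> carrier V" using insert.prems P'(1) by blast+
    then have "c \<odot> (\<Oplus>i\<in>insert k S. w i) = c \<odot> w k \<oplus> c \<odot> (\<Oplus>i\<in>S. w i)"
      using insert.hyps by (simp add: scale_add_right)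
    also have "\<dots> \<in> eigen_sums V P"
      using insert.prems insert.IH
      by (intro eigen_sums_add[OF eigen_sums_base[of _ k]] P'(4)) auto
    finally show ?case .
  qed
  then show ?thesis by (simp add: u)
qed

lemma submodule_eigen_sums: "submodule (eigen_sums V P) complex_field V"
  using eigen_sums_carrier eigen_sums_base[OF P'(2)] eigen_sums_add eigen_sums_scale
  by (auto simp: submodule_iff)

context
  fixes T
  assumes T: "\<And>u. u \<in> carrier V \<Longrightarrow> T u \<in> carrier V"
      "\<And>u w. u \<in> carrier V \<Longrightarrow> w \<in> carrier V \<Longrightarrow> T (u \<oplus> w) = T u \<oplus> T w"
      "\<And>c u. u \<in> carrier V \<Longrightarrow> T (c \<odot> u) = c \<odot> T u"
    and eig: "\<And>k u. u \<in> P k \<Longrightarrow> T u = k \<odot> u"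
begin

text \<open>The decomposition of \<open>u\<close> survives the restriction to \<open>N\<close> by
  \<open>eigen_component\<close>. With an ideal for \<open>N\<close>, this is how its elements are
  analysed.\<close>

lemma eigen_sums_stable:
  assumes "submodule N complex_field V" and "\<And>u. u \<in> N \<Longrightarrow> T u \<in> N"
    and "u \<in> eigen_sums V P" "u \<in> N"
  shows "\<exists>S w. finite S \<and> (\<forall>k\<in>S. w k \<in> P k \<inter> N) \<and> u = (\<Oplus>k\<in>S. w k)"
proof -
  from assms(3) obtain S w where u: "finite S" "\<And>k. k \<in> S \<Longrightarrow> w k \<in> P k" "u = (\<Oplus>k\<in>S. w k)"
    unfolding eigen_sums_def by blast
  have "w k \<in> N" if "k \<in> S" for k
    using u eig subsetD[OF P'(1) u(2)] assms that
    by (intro eigen_component[of N T S w]) (auto intro: T)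
  then show ?thesis using u by blast
qed

text \<open>Bringing \<open>u\<close> to the other side as a vector of eigenvalue \<open>c\<close>
  gives a vanishing sum of eigenvectors. Each component then vanishes, and \<open>u\<close> is the
  component at \<open>c\<close> alone.\<close>

lemma eigenspace_eigen_sums:
  assumes "u \<in> eigen_sums V P" "T u = c \<odot> u"
  shows "u \<in> P c"
proof -
  from assms(1) obtain S w where u: "finite S" "\<And>k. k \<in> S \<Longrightarrow> w k \<in> P k" "u = (\<Oplus>k\<in>S. w k)"
    unfolding eigen_sums_def by blast
  have uc: "u \<in> carrier V" using eigen_sums_carrier assms(1) .
  \<comment> \<open>Absent components are filled with zero: \<open>c\<close> need not belong to
    \<open>S\<close>, in which case \<open>u\<close> itself turns out to be zero.\<close>
  let ?w = "\<lambda>k. if k \<in> S then w k else \<zero>" and ?v = "\<lambda>k. if c = k then (-1) \<odot> u else \<zero>"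
  have wP: "?w k \<in> P k" for k using u P'(2) by auto
  then have wc: "?w k \<in> carrier V" for k using P'(1) by blast
  have "(\<Oplus>k\<in>insert c S. ?w k \<oplus> ?v k) = (\<Oplus>k\<in>insert c S. ?w k) \<oplus> (\<Oplus>k\<in>insert c S. ?v k)"
    using wc uc by (intro finsum_addf) auto
  also have "(\<Oplus>k\<in>insert c S. ?w k) = u"
    using eigen_sums_extend[OF u(1,2), of "insert c S", symmetric] u by blast
  also have "(\<Oplus>k\<in>insert c S. ?v k) = (-1) \<odot> u"
    using finsum_singleton[of c "insert c S" "\<lambda>_. (-1) \<odot> u"] u(1) uc by simp
  finally have sum: "(\<Oplus>k\<in>insert c S. ?w k \<oplus> ?v k) \<in> {\<zero>}" using uc by (simp add: add_scale_minus)
  have T0: "T \<zero> = \<zero>" using T(3)[of \<zero> 0] T(1)[of \<zero>] by simp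
  have "?w c \<oplus> ?v c \<in> {\<zero>}"
  proof (rule eigen_component[OF _ T _ _ _ sum, of c])
    show "submodule {\<zero>} complex_field V" by (simp add: submodule_iff)
    show "?w k \<oplus> ?v k \<in> carrier V \<and> T (?w k \<oplus> ?v k) = k \<odot> (?w k \<oplus> ?v k)" for k
      using wc[of k] uc eig[OF wP[of k]] assms(2)
      by (cases "c = k") (auto simp: T(2,3) scale_add_right T0 mult.commute simp del: if_split)
  qed (use u(1) T0 in auto)
  then have "u = ?w c"
    using add_eq_zero_imp[OF wc[of c], of "(-1) \<odot> u"] uc by simp
  then show ?thesis using wP[of c] by metis
qed

end

end

end

context lie_super
begin

lemma bracket_jacobi_left:
  assumes "x \<in> part L i" "y \<in> part L j" "z \<in> carrier L"
  shows "bracket L (bracket L x y) z =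
    bracket L x (bracket L y z) \<oplus> (- koszul_sign i j) \<odot> bracket L y (bracket L x z)"
  using bracket_jacobi[OF assms] assms part_carrier
  by (simp add: a_assoc scale_add_left[symmetric])

lemma bracket_span:
  assumes "u \<in> span L W" "W \<subseteq> carrier L" "g \<in> carrier L" "submodule N complex_field L"
    and "\<And>w. w \<in> W \<Longrightarrow> bracket L g w \<in> N"
  shows "bracket L g u \<in> N"
  using assms(1)
proof induction
  case (span_add u w)
  then show ?case using assms span_carrier by (auto simp: bracket_add_right submodule_iff)
next
  case (span_scale u c)
  then show ?case using assms span_carrier by (auto simp: bracket_scale_right submodule_iff)
qed (use assms in \<open>auto simp: submodule_iff\<close>)

end

section \<open>Realizations of a root datum\<close>

text \<open>Amounts to a homomorphism from the half-baked algebra of \<open>v\<close> to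
  \<open>L\<close>; the Cartan map may have a kernel and the elements need not generate. One algebra
  may carry realizations of several data. \<open>coweight_ex\<close> is the form in which the
  independence of the simple roots is used.\<close>

locale root_rep = lie_super L for L (structure) +
  fixes X :: "'x set" and v :: "('h, 'x) root_datum"
    and \<iota> :: "'h \<Rightarrow> 'a" and e f :: "'x \<Rightarrow> 'a"
  assumes space: "complex_space (hspace v)"
    and coroot_closed: "x \<in> X \<Longrightarrow> coroot v x \<in> carrier (hspace v)"
    and coweight_ex: "\<exists>h\<in>carrier (hspace v). \<forall>x\<in>X. simple_root v x h = t x"
    and cartan_part: "h \<in> carrier (hspace v) \<Longrightarrow> \<iota> h \<in> part L 0"
    and cartan_add: "h \<in> carrier (hspace v) \<Longrightarrow> k \<in> carrier (hspace v) \<Longrightarrow>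
      \<iota> (h \<oplus>\<^bsub>hspace v\<^esub> k) = \<iota> h \<oplus> \<iota> k"
    and cartan_scale: "h \<in> carrier (hspace v) \<Longrightarrow> \<iota> (c \<odot>\<^bsub>hspace v\<^esub> h) = c \<odot> \<iota> h"
    and e_part: "x \<in> X \<Longrightarrow> e x \<in> part L (parity v x)"
    and f_part: "x \<in> X \<Longrightarrow> f x \<in> part L (parity v x)"
    and bracket_cartan: "h \<in> carrier (hspace v) \<Longrightarrow> k \<in> carrier (hspace v) \<Longrightarrow>
      bracket L (\<iota> h) (\<iota> k) = \<zero>"
    and bracket_cartan_e: "h \<in> carrier (hspace v) \<Longrightarrow> x \<in> X \<Longrightarrow>
      bracket L (\<iota> h) (e x) = simple_root v x h \<odot> e x"
    and bracket_cartan_f: "h \<in> carrier (hspace v) \<Longrightarrow> x \<in> X \<Longrightarrow>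
      bracket L (\<iota> h) (f x) = (- simple_root v x h) \<odot> f x"
    and bracket_e_f: "x \<in> X \<Longrightarrow> y \<in> X \<Longrightarrow> x \<noteq> y \<Longrightarrow> bracket L (e x) (f y) = \<zero>"
    and bracket_e_f_same: "x \<in> X \<Longrightarrow> bracket L (e x) (f x) = \<iota> (coroot v x)"

definition root_generating_set ::
    "'x set \<Rightarrow> ('h, 'x) root_datum \<Rightarrow> ('h \<Rightarrow> 'a) \<Rightarrow> ('x \<Rightarrow> 'a) \<Rightarrow> ('x \<Rightarrow> 'a) \<Rightarrow> bit \<Rightarrow> 'a set"
  where "root_generating_set X v \<iota> e f i =
    {u. (\<exists>h\<in>carrier (hspace v). u = \<iota> h \<and> i = 0) \<or>
        (\<exists>x\<in>X. (u = e x \<or> u = f x) \<and> i = parity v x)}"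

text \<open>Right-nested brackets suffice by the Jacobi identity. The list is kept as an index
  because weight and parity are read off from it.\<close>

inductive root_word :: "'a lie_superalgebra \<Rightarrow> 'x set \<Rightarrow> ('x \<Rightarrow> 'a) \<Rightarrow> 'x list \<Rightarrow> 'a \<Rightarrow> bool"
  for L X e where
  root_word_single: "x \<in> X \<Longrightarrow> root_word L X e [x] (e x)"
| root_word_Cons: "x \<in> X \<Longrightarrow> root_word L X e w u \<Longrightarrow> root_word L X e (x # w) (bracket L (e x) u)"

lemma root_word_ex: "x \<in> X \<Longrightarrow> \<exists>w. root_word L X e w (e x)"
  by (blast intro: root_word_single)

lemma not_root_word_Nil: "\<not> root_word L X e [] u"
  by (auto elim: root_word.cases)

lemma root_word_singleD: "root_word L X e [x] u \<Longrightarrow> u = e x"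
  by (erule root_word.cases) (auto simp: not_root_word_Nil)

lemma bit_of_nat: "(of_nat n :: bit) = (if even n then 0 else 1)"
  by (induction n) auto

context root_rep
begin

lemma cartan_closed [simp]: "h \<in> carrier (hspace v) \<Longrightarrow> \<iota> h \<in> carrier L"
  and e_closed [simp]: "x \<in> X \<Longrightarrow> e x \<in> carrier L"
  and f_closed [simp]: "x \<in> X \<Longrightarrow> f x \<in> carrier L"
  using cartan_part e_part f_part part_carrier by blast+

lemma bracket_e_cartan:
  assumes "h \<in> carrier (hspace v)" "x \<in> X"
  shows "bracket L (e x) (\<iota> h) = (- simple_root v x h) \<odot> e x"
  using bracket_skew[OF e_part[OF assms(2)] cartan_part[OF assms(1)]] assms
  by (simp add: bracket_cartan_e)

lemma bracket_f_cartan: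
  assumes "h \<in> carrier (hspace v)" "x \<in> X"
  shows "bracket L (f x) (\<iota> h) = simple_root v x h \<odot> f x"
  using bracket_skew[OF f_part[OF assms(2)] cartan_part[OF assms(1)]] assms
  by (simp add: bracket_cartan_f)

lemma bracket_f_e:
  assumes "x \<in> X" "y \<in> X" "x \<noteq> y"
  shows "bracket L (f x) (e y) = \<zero>"
  by (rule bracket_eq_zero_swap[OF e_part[OF assms(2)] f_part[OF assms(1)] bracket_e_f])
    (use assms in auto)

lemma bracket_f_e_same:
  assumes "x \<in> X"
  shows "bracket L (f x) (e x) = (- koszul_sign (parity v x) (parity v x)) \<odot> \<iota> (coroot v x)"
  using bracket_skew[OF f_part[OF assms] e_part[OF assms]] assms by (simp add: bracket_e_f_same)

text \<open>Stands in for the Chevalley involution without producing an automorphism. The sign on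
  \<open>e\<close> is forced: super skew-symmetry gives
  \<open>[f x, e x] = - \<epsilon> a(x)\<close> with \<epsilon> the Koszul sign of \<open>x\<close>
  with itself, whereas the negated Cartan map requires \<open>- a(x)\<close>.\<close>

lemma flip:
  "root_rep L X v (\<lambda>h. (-1) \<odot> \<iota> h) f (\<lambda>x. koszul_sign (parity v x) (parity v x) \<odot> e x)"
proof -
  have "root_rep_axioms L X v (\<lambda>h. (-1) \<odot> \<iota> h) f (\<lambda>x. koszul_sign (parity v x) (parity v x) \<odot> e x)"
  proof (rule root_rep_axioms.intro)
    show "(-1) \<odot> \<iota> h \<in> part L 0" if "h \<in> carrier (hspace v)" for h
      using that by (intro part_scale cartan_part)
    show "koszul_sign (parity v x) (parity v x) \<odot> e x \<in> part L (parity v x)" if "x \<in> X" for x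
      using that by (intro part_scale e_part)
  qed (use space coroot_closed coweight_ex f_part in
    \<open>auto simp: cartan_add cartan_scale scale_add_right bracket_scale_left bracket_scale_right
      bracket_cartan bracket_cartan_e bracket_cartan_f bracket_f_e bracket_f_e_same mult.commute
      mult.assoc[symmetric]\<close>)
  then show ?thesis using lie_super_axioms by (simp add: root_rep_def)
qed

lemma generating_set_part: "root_generating_set X v \<iota> e f i \<subseteq> part L i"
  using cartan_part e_part f_part by (auto simp: root_generating_set_def)

lemma root_word_closed: "root_word L X e w u \<Longrightarrow> u \<in> carrier L"
  by (induction rule: root_word.induct) auto

lemma root_word_part: "root_word L X e w u \<Longrightarrow> u \<in> part L (\<Sum>x\<leftarrow>w. parity v x)"
proof (induction rule: root_word.induct)
  case (root_word_single x)
  then show ?case using e_part by (auto simp del: add_bit_eq_xor)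
next
  case (root_word_Cons x w u)
  show ?case using part_bracket[OF e_part root_word_Cons.IH] root_word_Cons.hyps by simp
qed

lemma root_word_weight:
  "root_word L X e w u \<Longrightarrow> h \<in> carrier (hspace v) \<Longrightarrow>
    bracket L (\<iota> h) u = (\<Sum>x\<leftarrow>w. simple_root v x h) \<odot> u"
proof (induction rule: root_word.induct)
  case (root_word_single x)
  then show ?case by (simp add: bracket_cartan_e)
next
  case (root_word_Cons x w u)
  have "u \<in> carrier L" using root_word_closed root_word_Cons.hyps by blast
  then show ?case
    using bracket_jacobi[OF cartan_part e_part, of h x u] root_word_Cons
    by (simp add: bracket_cartan_e bracket_scale_left bracket_scale_right scale_add_left)
qed

text \<open>Moving \<open>f x\<close> to the right through the word meets only brackets
  \<open>[f x, e y]\<close>, which are zero or Cartan elements, and Cartan elements act on words by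
  scalars. The Cartan subalgebra enters the span through the words of length one.\<close>

lemma f_root_word:
  assumes "root_word L X e w u" "x \<in> X"
  shows "bracket L (f x) u \<in> span L (\<iota> ` carrier (hspace v) \<union> {u. \<exists>w. root_word L X e w u})"
    (is "_ \<in> span L ?W")
proof -
  have Wc: "?W \<subseteq> carrier L" using root_word_closed by auto
  have e_stable: "bracket L (e y) u \<in> span L ?W" if "y \<in> X" "u \<in> span L ?W" for y u
  proof (rule bracket_span[OF that(2) Wc _ submodule_span[OF Wc]])
    fix w assume "w \<in> ?W"
    then show "bracket L (e y) w \<in> span L ?W"
    proof
      assume "w \<in> \<iota> ` carrier (hspace v)"
      then show ?thesis using that(1)
        by (auto simp: bracket_e_cartan intro!: span_scale_base intro: root_word_ex)
    next
      assume "w \<in> {u. \<exists>w. root_word L X e w u}"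
      then show ?thesis using that(1) by (auto intro!: span_base root_word_Cons)
    qed
  qed (use that in simp)
  show ?thesis
    using assms
  proof (induction rule: root_word.induct)
    case (root_word_single y)
    then show ?case
      by (cases "x = y") (auto simp: bracket_f_e bracket_f_e_same coroot_closed
        intro!: span_scale_base span_zero)
  next
    case (root_word_Cons y w u)
    have u: "u \<in> carrier L" using root_word_closed root_word_Cons.hyps by blast
    have 1: "bracket L (bracket L (f x) (e y)) u \<in> span L ?W"
    proof (cases "x = y")
      case True
      then show ?thesis
        using root_word_weight[OF root_word_Cons.hyps(2) coroot_closed[of y]] root_word_Cons u
        by (auto simp: bracket_f_e_same bracket_scale_left coroot_closed
          intro!: span_scale_base)
    next
      case False
      then show ?thesis using root_word_Cons u by (simp add: bracket_f_e span_zero)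
    qed
    have 2: "bracket L (e y) (bracket L (f x) u) \<in> span L ?W"
      using e_stable root_word_Cons by blast
    show ?case
      unfolding bracket_jacobi[OF f_part[OF root_word_Cons.prems] e_part[OF root_word_Cons.hyps(1)] u]
      by (intro span_add span_scale 1 2)
  qed
qed

end

section \<open>Triangular decomposition and gradings by Cartan elements\<close>

locale generated_root_rep = root_rep L X v \<iota> e f for L (structure)
    and X :: "'x set" and v :: "('h, 'x) root_datum" and \<iota> and e f :: "'x \<Rightarrow> 'a" +
  assumes generated: "x \<in> part L i \<Longrightarrow>
    homogeneous_generated L (root_generating_set X v \<iota> e f) i x"
begin

lemma flip_generated:
  "generated_root_rep L X v (\<lambda>h. (-1) \<odot> \<iota> h) f (\<lambda>x. koszul_sign (parity v x) (parity v x) \<odot> e x)"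
proof -
  interpret F: root_rep L X v "\<lambda>h. (-1) \<odot> \<iota> h" f "\<lambda>x. koszul_sign (parity v x) (parity v x) \<odot> e x"
    by (rule flip)
  let ?S = "root_generating_set X v (\<lambda>h. (-1) \<odot> \<iota> h) f (\<lambda>x. koszul_sign (parity v x) (parity v x) \<odot> e x)"
  have "homogeneous_generated L ?S i s" if s: "s \<in> root_generating_set X v \<iota> e f i" for i s
  proof -
    consider h where "h \<in> carrier (hspace v)" "s = \<iota> h" "i = 0"
      | x where "x \<in> X" "s = e x" "i = parity v x" | x where "x \<in> X" "s = f x" "i = parity v x"
      using s unfolding root_generating_set_def by blast
    then show ?thesis
    proof cases
      case 1
      then have "(-1) \<odot> \<iota> h \<in> ?S i" by (auto simp: root_generating_set_def)
      then have "homogeneous_generated L ?S i ((-1) \<odot> ((-1) \<odot> \<iota> h))"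
        by (intro hgen_scale hgen_base)
      then show ?thesis using 1 by simp
    next
      case 2
      then have "koszul_sign (parity v x) (parity v x) \<odot> e x \<in> ?S i" by (auto simp: root_generating_set_def)
      then have "homogeneous_generated L ?S i (koszul_sign (parity v x) (parity v x) \<odot>
        (koszul_sign (parity v x) (parity v x) \<odot> e x))"
        by (intro hgen_scale hgen_base)
      then show ?thesis using 2 by simp
    next
      case 3
      then show ?thesis by (intro hgen_base) (auto simp: root_generating_set_def)
    qed
  qed
  then show ?thesis
    using F.root_rep_axioms homogeneous_generated_trans[OF generated]
    by (auto simp: generated_root_rep_def generated_root_rep_axioms_def)
qed

lemma stable_ideal:
  assumes N: "submodule N complex_field L"
    and "\<And>h w. h \<in> carrier (hspace v) \<Longrightarrow> w \<in> N \<Longrightarrow> bracket L (\<iota> h) w \<in> N"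
    and "\<And>x w. x \<in> X \<Longrightarrow> w \<in> N \<Longrightarrow> bracket L (e x) w \<in> N"
    and "\<And>x w. x \<in> X \<Longrightarrow> w \<in> N \<Longrightarrow> bracket L (f x) w \<in> N"
    and u: "u \<in> carrier L" "w \<in> N"
  shows "bracket L u w \<in> N"
proof -
  have *: "bracket L u w \<in> N" if "u \<in> part L i" for u i
    using hgen_stable[OF generated[OF that] generating_set_part N _ u(2)] assms(2-4)
    by (force simp: root_generating_set_def)
  obtain y z where y: "y \<in> part L 0" "z \<in> part L 1" "u = y \<oplus> z" using part_decomp[OF u(1)] by blast
  have "w \<in> carrier L" using N u(2) by (auto simp: submodule_iff)
  then have "bracket L u w = bracket L y w \<oplus> bracket L z w"
    using y part_carrier by (simp add: bracket_add_left)
  then show ?thesis using *[OF y(1)] *[OF y(2)] N by (simp add: submodule_iff)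
qed

text \<open>The triangular decomposition as a spanning statement: the span contains the generators
  and is stable under them. The action of \<open>e\<close> on words in \<open>f\<close> is the
  flipped form of \<open>f_root_word\<close>.\<close>

lemma carrier_span:
  assumes "u \<in> carrier L"
  shows "u \<in> span L (\<iota> ` carrier (hspace v) \<union> {u. \<exists>w. root_word L X e w u} \<union> {u. \<exists>w. root_word L X f w u})"
    (is "_ \<in> span L ?W")
proof -
  interpret F: generated_root_rep L X v "\<lambda>h. (-1) \<odot> \<iota> h" f "\<lambda>x. koszul_sign (parity v x) (parity v x) \<odot> e x"
    by (rule flip_generated)
  have Wc: "?W \<subseteq> carrier L" using root_word_closed F.root_word_closed by auto
  note sub = submodule_span[OF Wc]
  have cartan: "bracket L (\<iota> h) w \<in> span L ?W"
    if h: "h \<in> carrier (hspace v)" and w: "w \<in> span L ?W" for h w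
  proof (rule bracket_span[OF w Wc _ sub])
    fix w assume w: "w \<in> ?W"
    then consider k where "k \<in> carrier (hspace v)" "w = \<iota> k" | w' where "root_word L X e w' w"
      | w' where "root_word L X f w' w" by blast
    then show "bracket L (\<iota> h) w \<in> span L ?W"
    proof cases
      case 1
      then show ?thesis using h by (simp add: bracket_cartan span_zero)
    next
      case 2
      then show ?thesis using root_word_weight[OF 2 h] w by (simp add: span_scale span_base)
    next
      case 3
      have wc: "w \<in> carrier L" using w Wc by blast
      have "(-1) \<odot> bracket L (\<iota> h) w \<in> span L ?W"
        using F.root_word_weight[OF 3 h] w h wc by (simp add: bracket_scale_left span_scale span_base)
      from span_scale[OF this, of "-1"] show ?thesis using h wc by simp
    qed
  qed (use h in simp)
  have e: "bracket L (e x) w \<in> span L ?W" if x: "x \<in> X" and w: "w \<in> span L ?W" for x w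
  proof (rule bracket_span[OF w Wc _ sub])
    fix w assume w: "w \<in> ?W"
    then consider k where "k \<in> carrier (hspace v)" "w = \<iota> k" | w' where "root_word L X e w' w"
      | w' where "root_word L X f w' w" by blast
    then show "bracket L (e x) w \<in> span L ?W"
    proof cases
      case 1
      then show ?thesis using x
        by (auto simp: bracket_e_cartan intro!: span_scale_base intro: root_word_ex)
    next
      case 2
      then show ?thesis using x root_word_Cons[OF x 2] by (blast intro: span_base)
    next
      case 3
      let ?k = "koszul_sign (parity v x) (parity v x)"
      have wc: "w \<in> carrier L" using w Wc by blast
      have "bracket L (?k \<odot> e x) w \<in> span L ?W"
      proof (rule span_subset[OF F.f_root_word[OF 3 x] sub])
        show "(\<lambda>h. (-1) \<odot> \<iota> h) ` carrier (hspace v) \<union> {u. \<exists>w. root_word L X f w u} \<subseteq> span L ?W"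
          by (auto intro!: span_scale_base intro: span_base)
      qed
      from span_scale[OF this, of ?k] show ?thesis using x wc by (simp add: bracket_scale_left)
    qed
  qed (use x in simp)
  have f: "bracket L (f x) w \<in> span L ?W" if x: "x \<in> X" and w: "w \<in> span L ?W" for x w
  proof (rule bracket_span[OF w Wc _ sub])
    fix w assume w: "w \<in> ?W"
    then consider k where "k \<in> carrier (hspace v)" "w = \<iota> k" | w' where "root_word L X e w' w"
      | w' where "root_word L X f w' w" by blast
    then show "bracket L (f x) w \<in> span L ?W"
    proof cases
      case 1
      then show ?thesis using x
        by (auto simp: bracket_f_cartan intro!: span_scale_base intro: root_word_ex)
    next
      case 2
      show ?thesis by (rule span_mono[OF f_root_word[OF 2 x]]) blast
    next
      case 3
      then show ?thesis using x root_word_Cons[OF x 3] by (blast intro: span_base)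
    qed
  qed (use x in simp)
  have "homogeneous_generated L (root_generating_set X v \<iota> e f) i s \<Longrightarrow> s \<in> span L ?W" for i s
  proof (induction rule: homogeneous_generated.induct)
    case (hgen_base s i)
    then show ?case
      by (auto simp: root_generating_set_def intro!: span_base intro: root_word_ex)
  next
    case (hgen_bracket i x j y)
    have "x \<in> carrier L" using hgen_part[OF hgen_bracket.hyps(1) generating_set_part] part_carrier by blast
    then show ?case using stable_ideal[OF sub cartan e f] hgen_bracket.IH by blast
  qed (auto intro: span.intros)
  then have part: "s \<in> part L i \<Longrightarrow> s \<in> span L ?W" for i s using generated by blast
  obtain y z where y: "y \<in> part L 0" "z \<in> part L 1" "u = y \<oplus> z"
    using part_decomp[OF assms] by blast
  show ?thesis unfolding y(3) by (intro span_add part[OF y(1)] part[OF y(2)])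
qed

text \<open>Reduces an eigenvalue argument on the whole algebra to three kinds of vectors: Cartan
  elements and the two kinds of words.\<close>

lemma carrier_eigen_sums:
  assumes P: "\<And>k. submodule (P k) complex_field L"
    and "\<And>h. h \<in> carrier (hspace v) \<Longrightarrow> \<exists>k. \<iota> h \<in> P k"
    and "\<And>w u. root_word L X e w u \<Longrightarrow> \<exists>k. u \<in> P k"
    and "\<And>w u. root_word L X f w u \<Longrightarrow> \<exists>k. u \<in> P k"
    and "u \<in> carrier L"
  shows "u \<in> eigen_sums L P"
  by (rule span_subset[OF carrier_span[OF assms(5)] submodule_eigen_sums[OF P]])
    (use assms(2-4) in \<open>auto dest!: assms(2-4) intro: eigen_sums_base[OF P]\<close>)

lemma cartan_operator:
  assumes "h \<in> carrier (hspace v)"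
  shows "u \<in> carrier L \<Longrightarrow> bracket L (\<iota> h) u \<in> carrier L"
    and "u \<in> carrier L \<Longrightarrow> w \<in> carrier L \<Longrightarrow>
      bracket L (\<iota> h) (u \<oplus> w) = bracket L (\<iota> h) u \<oplus> bracket L (\<iota> h) w"
    and "u \<in> carrier L \<Longrightarrow> bracket L (\<iota> h) (c \<odot> u) = c \<odot> bracket L (\<iota> h) u"
  using assms by (auto simp: bracket_add_right bracket_scale_right)

lemma submodule_eigen:
  assumes "h \<in> carrier (hspace v)" "submodule N complex_field L"
  shows "submodule {u \<in> N. bracket L (\<iota> h) u = k \<odot> u} complex_field L"
  using assms
  by (auto simp: submodule_iff subset_iff bracket_add_right bracket_scale_right scale_add_right
      mult.commute)

lemma f_word_weight:
  assumes "root_word L X f w u" "h \<in> carrier (hspace v)"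
  shows "bracket L (\<iota> h) u = (- (\<Sum>x\<leftarrow>w. simple_root v x h)) \<odot> u"
proof -
  interpret F: root_rep L X v "\<lambda>h. (-1) \<odot> \<iota> h" f "\<lambda>x. koszul_sign (parity v x) (parity v x) \<odot> e x"
    by (rule flip)
  have u: "u \<in> carrier L" using F.root_word_closed assms(1) .
  have "(-1) \<odot> bracket L (\<iota> h) u = (\<Sum>x\<leftarrow>w. simple_root v x h) \<odot> u"
    using F.root_word_weight[OF assms] assms u by (simp add: bracket_scale_left)
  then have "(-1) \<odot> ((-1) \<odot> bracket L (\<iota> h) u) = (-1) \<odot> ((\<Sum>x\<leftarrow>w. simple_root v x h) \<odot> u)"
    by simp
  then show ?thesis using u assms(2) by (simp del: minus_one_mult_self)
qed

lemma f_word_part: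
  assumes "root_word L X f w u"
  shows "u \<in> part L (\<Sum>x\<leftarrow>w. parity v x)"
proof -
  interpret F: root_rep L X v "\<lambda>h. (-1) \<odot> \<iota> h" f "\<lambda>x. koszul_sign (parity v x) (parity v x) \<odot> e x"
    by (rule flip)
  show ?thesis using F.root_word_part[OF assms] .
qed

lemma sum_list_weights:
  assumes "set w \<subseteq> X" "\<And>x. x \<in> X \<Longrightarrow> simple_root v x h = of_nat (t x)"
  shows "(\<Sum>x\<leftarrow>w. simple_root v x h) = of_nat (\<Sum>x\<leftarrow>w. t x)"
  using assms by (induction w) auto

lemma word_set: "root_word L X g w u \<Longrightarrow> set w \<subseteq> X \<and> w \<noteq> []"
  by (induction rule: root_word.induct) auto

lemma sum_list_pos: "w \<noteq> [] \<Longrightarrow> (\<And>x. x \<in> set w \<Longrightarrow> 0 < t x) \<Longrightarrow> 0 < (\<Sum>x\<leftarrow>w. t x :: nat)"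
  by (cases w) auto

lemma words_closed: "root_word L X e w u \<or> root_word L X f w u \<Longrightarrow> u \<in> carrier L"
  using root_word_part f_word_part part_carrier by blast

lemma submodule_part: "submodule (part L i) complex_field L"
  unfolding submodule_iff using part_subset part_zero part_add part_scale by blast

lemma submodule_cartan: "submodule (\<iota> ` carrier (hspace v)) complex_field L"
proof -
  interpret V: complex_vector_space "hspace v" using space by (simp add: complex_vector_space_iff)
  have "\<iota> \<zero>\<^bsub>hspace v\<^esub> = \<zero>" using cartan_scale[OF V.zero_closed, of 0] by simp
  then have "\<zero> \<in> \<iota> ` carrier (hspace v)" by (metis V.zero_closed imageI)
  then show ?thesis
    by (auto simp: submodule_iff cartan_add[symmetric] cartan_scale[symmetric])
qed

text \<open>No word has weight zero at \<open>h\<close>, which is why the zero eigenspace may be restricted to the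
  Cartan subalgebra.\<close>

lemma positive_eigen_sums:
  assumes h: "h \<in> carrier (hspace v)" and t: "\<And>x. x \<in> X \<Longrightarrow> simple_root v x h = of_nat (t x)"
    and pos: "\<And>x. x \<in> X \<Longrightarrow> 0 < t x" and u: "u \<in> carrier L"
  shows "u \<in> eigen_sums L (\<lambda>k. {u \<in> {u \<in> carrier L. k = 0 \<longrightarrow> u \<in> \<iota> ` carrier (hspace v)}.
    bracket L (\<iota> h) u = k \<odot> u})"
proof (rule carrier_eigen_sums[OF _ _ _ _ u])
  show "submodule {u \<in> {u \<in> carrier L. k = 0 \<longrightarrow> u \<in> \<iota> ` carrier (hspace v)}.
    bracket L (\<iota> h) u = k \<odot> u} complex_field L" for k
    using submodule_cartan by (intro submodule_eigen[OF h]) (auto simp: submodule_iff)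
  show "\<exists>k. \<iota> h' \<in> {u \<in> {u \<in> carrier L. k = 0 \<longrightarrow> u \<in> \<iota> ` carrier (hspace v)}.
    bracket L (\<iota> h) u = k \<odot> u}" if "h' \<in> carrier (hspace v)" for h'
    using that h by (intro exI[of _ 0]) (auto simp: bracket_cartan)
  fix w u
  show "\<exists>k. u \<in> {u \<in> {u \<in> carrier L. k = 0 \<longrightarrow> u \<in> \<iota> ` carrier (hspace v)}.
    bracket L (\<iota> h) u = k \<odot> u}" if w: "root_word L X e w u"
  proof -
    have "0 < (\<Sum>x\<leftarrow>w. t x)" using word_set[OF w] pos by (intro sum_list_pos) auto
    moreover have "bracket L (\<iota> h) u = of_nat (\<Sum>x\<leftarrow>w. t x) \<odot> u"
      using root_word_weight[OF w h] sum_list_weights[of w h t] t word_set[OF w] by simp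
    ultimately obtain n :: nat where "0 < n" "bracket L (\<iota> h) u = of_nat n \<odot> u" by blast
    then show ?thesis using words_closed w by (intro exI[of _ "of_nat n"]) auto
  qed
  show "\<exists>k. u \<in> {u \<in> {u \<in> carrier L. k = 0 \<longrightarrow> u \<in> \<iota> ` carrier (hspace v)}.
    bracket L (\<iota> h) u = k \<odot> u}" if w: "root_word L X f w u"
  proof -
    have "0 < (\<Sum>x\<leftarrow>w. t x)" using word_set[OF w] pos by (intro sum_list_pos) auto
    moreover have "bracket L (\<iota> h) u = (- of_nat (\<Sum>x\<leftarrow>w. t x)) \<odot> u"
      using f_word_weight[OF w h] sum_list_weights[of w h t] t word_set[OF w] by simp
    ultimately obtain n :: nat where "0 < n" "bracket L (\<iota> h) u = (- of_nat n) \<odot> u" by blast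
    then show ?thesis using words_closed w by (intro exI[of _ "- of_nat n"]) auto
  qed
qed

context
  fixes h t
  assumes h: "h \<in> carrier (hspace v)" and t: "\<And>x. x \<in> X \<Longrightarrow> simple_root v x h = of_nat (t x)"
    and pos: "\<And>x. x \<in> X \<Longrightarrow> (0::nat) < t x"
begin

lemma submodule_positive_eigen:
  "submodule {u \<in> {u \<in> carrier L. k = 0 \<longrightarrow> u \<in> \<iota> ` carrier (hspace v)}.
    bracket L (\<iota> h) u = k \<odot> u} complex_field L"
  using submodule_cartan by (intro submodule_eigen[OF h]) (auto simp: submodule_iff)

lemma submodule_nonzero_eigen:
  "submodule {u \<in> {u \<in> carrier L. k = 0 \<longrightarrow> u = \<zero>}. bracket L (\<iota> h) u = k \<odot> u} complex_field L"
  by (intro submodule_eigen[OF h]) (auto simp: submodule_iff)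

text \<open>The components of an element of \<open>N\<close> stay in \<open>N\<close>. The one with
  eigenvalue zero is a Cartan element, because all words have nonzero eigenvalues, and therefore
  vanishes.\<close>

lemma trivial_eigen_sums:
  assumes N: "submodule N complex_field L" and st: "\<And>w. w \<in> N \<Longrightarrow> bracket L (\<iota> h) w \<in> N"
    and triv: "N \<inter> \<iota> ` carrier (hspace v) = {\<zero>}" and u: "u \<in> N"
  shows "u \<in> eigen_sums L
    (\<lambda>k. {u \<in> {u \<in> carrier L. k = 0 \<longrightarrow> u = \<zero>}. bracket L (\<iota> h) u = k \<odot> u})"
proof -
  have uc: "u \<in> carrier L" using N u by (auto simp: submodule_iff)
  have eig: "bracket L (\<iota> h) u = k \<odot> u"
    if "u \<in> {u \<in> {u \<in> carrier L. k = 0 \<longrightarrow> u \<in> \<iota> ` carrier (hspace v)}. bracket L (\<iota> h) u = k \<odot> u}"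
    for k u using that by simp
  have "\<exists>S w. finite S \<and> (\<forall>k\<in>S. w k \<in> {u \<in> {u \<in> carrier L.
      k = 0 \<longrightarrow> u \<in> \<iota> ` carrier (hspace v)}. bracket L (\<iota> h) u = k \<odot> u} \<inter> N) \<and> u = (\<Oplus>k\<in>S. w k)"
    by (rule eigen_sums_stable[OF submodule_positive_eigen cartan_operator[OF h] eig N st
      positive_eigen_sums[OF h t pos uc] u])
  then obtain S w where w: "finite S" "\<forall>k\<in>S. w k \<in> {u \<in> {u \<in> carrier L.
      k = 0 \<longrightarrow> u \<in> \<iota> ` carrier (hspace v)}. bracket L (\<iota> h) u = k \<odot> u} \<inter> N" "u = (\<Oplus>k\<in>S. w k)"
    by blast
  have "\<forall>k\<in>S. w k \<in> {u \<in> {u \<in> carrier L. k = 0 \<longrightarrow> u = \<zero>}. bracket L (\<iota> h) u = k \<odot> u}"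
    using w(2) triv by blast
  then show ?thesis unfolding eigen_sums_def using w(1,3) by blast
qed

lemma cartan_nonzero_eigen:
  assumes "k \<in> carrier (hspace v)"
    and "\<iota> k \<in> eigen_sums L
      (\<lambda>k. {u \<in> {u \<in> carrier L. k = 0 \<longrightarrow> u = \<zero>}. bracket L (\<iota> h) u = k \<odot> u})"
  shows "\<iota> k = \<zero>"
proof -
  have "\<iota> k \<in> {u \<in> {u \<in> carrier L. (0::complex) = 0 \<longrightarrow> u = \<zero>}. bracket L (\<iota> h) u = 0 \<odot> u}"
    by (rule eigenspace_eigen_sums[OF submodule_nonzero_eigen cartan_operator[OF h] _ assms(2)])
      (use assms(1) h in \<open>simp_all add: bracket_cartan\<close>)
  then show ?thesis by simp
qed

end

text \<open>With the value 1 at \<open>y\<close> and 2 at the other simple roots, eigenvalue 1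
  occurs only for the one-letter word \<open>y\<close>: any other word has at least 2, words in
  \<open>f\<close> have negative eigenvalues, and Cartan elements have 0.\<close>

lemma simple_eigenspace:
  assumes y: "y \<in> X" and h: "h \<in> carrier (hspace v)"
    and t: "\<And>x. x \<in> X \<Longrightarrow> simple_root v x h = (if x = y then 1 else 2)"
    and u: "u \<in> carrier L" "bracket L (\<iota> h) u = u"
  shows "\<exists>c. u = c \<odot> e y"
proof -
  define t' :: "'x \<Rightarrow> nat" where "t' x = (if x = y then 1 else 2)" for x
  have t': "x \<in> X \<Longrightarrow> simple_root v x h = of_nat (t' x)" for x using t by (simp add: t'_def)
  let ?P = "\<lambda>k. {u \<in> {u \<in> carrier L. k = 1 \<longrightarrow> (\<exists>c. u = c \<odot> e y)}. bracket L (\<iota> h) u = k \<odot> u}"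
  have sub: "submodule (?P k) complex_field L" for k
  proof (intro submodule_eigen[OF h], unfold submodule_iff, safe)
    show "\<exists>c. \<zero> = c \<odot> e y" using y by (intro exI[of _ 0]) simp
    show "\<exists>c'. c \<odot> e y \<oplus> d \<odot> e y = c' \<odot> e y" for c d
      using y by (auto simp: scale_add_left[symmetric])
    show "\<exists>c'. c \<odot> (d \<odot> e y) = c' \<odot> e y" for c d using y by auto
  qed auto
  have ues: "u \<in> eigen_sums L ?P"
  proof (rule carrier_eigen_sums[OF sub _ _ _ u(1)])
    show "\<exists>k. \<iota> h' \<in> ?P k" if "h' \<in> carrier (hspace v)" for h'
      using that h by (intro exI[of _ 0]) (auto simp: bracket_cartan)
    show "\<exists>k. u \<in> ?P k" if w: "root_word L X e w u" for w u
    proof (cases "w = [y]")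
      case True
      then have "u = e y" using w root_word_singleD by fast
      moreover have "e y = 1 \<odot> e y" using y by simp
      moreover have "bracket L (\<iota> h) (e y) = 1 \<odot> e y" using y t h by (simp add: bracket_cartan_e)
      ultimately show ?thesis using e_closed[OF y] by blast
    next
      case False
      have "2 \<le> (\<Sum>x\<leftarrow>w. t' x)"
      proof (cases w)
        case Nil
        then show ?thesis using word_set[OF w] by simp
      next
        case (Cons a w')
        have t1: "1 \<le> t' x" for x by (simp add: t'_def)
        show ?thesis
        proof (cases w')
          case Nil
          then show ?thesis using False Cons by (simp add: t'_def)
        next
          case (Cons b w'')
          show ?thesis unfolding \<open>w = a # w'\<close> Cons using t1[of a] t1[of b] by simp
        qed
      qed
      moreover have "bracket L (\<iota> h) u = of_nat (\<Sum>x\<leftarrow>w. t' x) \<odot> u"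
        using root_word_weight[OF w h] sum_list_weights[of w h t'] t' word_set[OF w] by simp
      ultimately obtain n :: nat where "2 \<le> n" "bracket L (\<iota> h) u = of_nat n \<odot> u" by blast
      then show ?thesis using words_closed w by (intro exI[of _ "of_nat n"]) auto
    qed
    show "\<exists>k. u \<in> ?P k" if w: "root_word L X f w u" for w u
    proof -
      have "bracket L (\<iota> h) u = (- of_nat (\<Sum>x\<leftarrow>w. t' x)) \<odot> u"
        using f_word_weight[OF w h] sum_list_weights[of w h t'] t' word_set[OF w] by simp
      then obtain n :: nat where "bracket L (\<iota> h) u = (- of_nat n) \<odot> u" by blast
      moreover have "(- of_nat n :: complex) \<noteq> 1"
      proof
        assume "(- of_nat n :: complex) = 1"
        then have "Re (- of_nat n) = Re 1" by (rule arg_cong)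
        then show False by simp
      qed
      ultimately show ?thesis using words_closed w by (intro exI[of _ "- of_nat n"]) auto
    qed
  qed
  have "u \<in> ?P 1"
    by (rule eigenspace_eigen_sums[OF sub cartan_operator[OF h] _ ues]) (use u in simp_all)
  then show ?thesis by simp
qed

text \<open>The element of the Cartan subalgebra on which each simple root takes its own parity as a value
  separates the even from the odd part.\<close>

lemma stable_graded:
  assumes N: "submodule N complex_field L"
    and st: "\<And>h w. h \<in> carrier (hspace v) \<Longrightarrow> w \<in> N \<Longrightarrow> bracket L (\<iota> h) w \<in> N" and u: "u \<in> N"
  shows "\<exists>y\<in>N \<inter> part L 0. \<exists>z\<in>N \<inter> part L 1. u = y \<oplus> z"
proof -
  define t :: "'x \<Rightarrow> nat" where "t x = (if parity v x = 1 then 1 else 0)" for x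
  have t_par: "of_nat (t x) = parity v x" for x
    by (cases "parity v x = 1") (simp_all add: t_def)
  obtain h where h: "h \<in> carrier (hspace v)" "\<And>x. x \<in> X \<Longrightarrow> simple_root v x h = of_nat (t x)"
    using coweight_ex[of "\<lambda>x. of_nat (t x)"] by blast
  \<comment> \<open>The eigenvalues that occur are integers \<open>n\<close> for words in
    \<open>e\<close> and \<open>- n\<close> for words in \<open>f\<close>, and the parity of
    \<open>n\<close> is the parity of the word. The floor of the real part merely makes
    \<open>par\<close> total.\<close>
  define par :: "complex \<Rightarrow> bit" where "par k = (if even \<lfloor>Re k\<rfloor> then 0 else 1)" for k
  have "\<lfloor>- real n\<rfloor> = - int n" for n by (metis floor_of_int of_int_minus of_int_of_nat_eq)
  then have par: "par (of_nat n) = of_nat n" "par (- of_nat n) = of_nat n" for n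
    unfolding par_def bit_of_nat by simp_all
  have sum_par: "(\<Sum>x\<leftarrow>w. parity v x) = of_nat (\<Sum>x\<leftarrow>w. t x)" for w
    by (induction w) (simp_all only: list.map sum_list.Nil sum_list.Cons of_nat_0 of_nat_add t_par)
  let ?P = "\<lambda>k. {u \<in> part L (par k). bracket L (\<iota> h) u = k \<odot> u}"
  have sub: "submodule (?P k) complex_field L" for k
    by (rule submodule_eigen[OF h(1) submodule_part])
  have uc: "u \<in> carrier L" using N u by (auto simp: submodule_iff)
  have ues: "u \<in> eigen_sums L ?P"
  proof (rule carrier_eigen_sums[OF sub _ _ _ uc])
    have sum: "(\<Sum>x\<leftarrow>w. simple_root v x h) = of_nat (\<Sum>x\<leftarrow>w. t x)"
      if "root_word L X g w u" for g w u
      by (rule sum_list_weights[OF conjunct1[OF word_set[OF that]] h(2)])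
    show "\<exists>k. \<iota> h' \<in> ?P k" if "h' \<in> carrier (hspace v)" for h'
    proof
      show "\<iota> h' \<in> ?P 0" using that h cartan_part[OF that] by (simp add: bracket_cartan par_def)
    qed
    show "\<exists>k. u \<in> ?P k" if w: "root_word L X e w u" for w u
    proof
      show "u \<in> ?P (of_nat (\<Sum>x\<leftarrow>w. t x))"
        using root_word_weight[OF w h(1)] root_word_part[OF w] unfolding sum_par mem_Collect_eq par sum[OF w]
        by blast
    qed
    show "\<exists>k. u \<in> ?P k" if w: "root_word L X f w u" for w u
    proof
      show "u \<in> ?P (- of_nat (\<Sum>x\<leftarrow>w. t x))"
        using f_word_weight[OF w h(1)] f_word_part[OF w] unfolding sum_par mem_Collect_eq par sum[OF w]
        by blast
    qed
  qed
  have eig: "\<And>k u. u \<in> ?P k \<Longrightarrow> bracket L (\<iota> h) u = k \<odot> u" by simp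
  have "\<exists>S w. finite S \<and> (\<forall>k\<in>S. w k \<in> ?P k \<inter> N) \<and> u = (\<Oplus>k\<in>S. w k)"
    by (rule eigen_sums_stable[OF sub cartan_operator[OF h(1)] eig N st[OF h(1)] ues u])
  then obtain S w where w0: "finite S" "\<forall>k\<in>S. w k \<in> ?P k \<inter> N" "u = (\<Oplus>k\<in>S. w k)"
    by blast
  then have w: "finite S" "\<And>k. k \<in> S \<Longrightarrow> w k \<in> ?P k" "\<And>k. k \<in> S \<Longrightarrow> w k \<in> N"
    "u = (\<Oplus>k\<in>S. w k)"
    by blast+
  have N': "N \<subseteq> carrier L" "\<zero> \<in> N" "\<And>x y. x \<in> N \<Longrightarrow> y \<in> N \<Longrightarrow> x \<oplus> y \<in> N"
    using N by (auto simp: submodule_iff)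
  from w(1-3) have "\<exists>y\<in>N \<inter> part L 0. \<exists>z\<in>N \<inter> part L 1. (\<Oplus>k\<in>S. w k) = y \<oplus> z"
  proof (induction S rule: finite_induct)
    case empty
    have "\<zero> \<in> N \<inter> part L i" for i using N'(2) part_zero by blast
    moreover have "(\<Oplus>k\<in>{}. w k) = \<zero> \<oplus> \<zero>" by simp
    ultimately show ?case by blast
  next
    case (insert k S)
    then obtain y z where y: "y \<in> N \<inter> part L 0" "z \<in> N \<inter> part L 1" "(\<Oplus>k\<in>S. w k) = y \<oplus> z" by blast
    have wk: "w k \<in> N" "w k \<in> part L (par k)" using insert.prems by blast+
    have yz: "y \<in> carrier L" "z \<in> carrier L" "w k \<in> carrier L" using y wk N'(1) by blast+
    have eq: "(\<Oplus>k\<in>insert k S. w k) = w k \<oplus> (y \<oplus> z)"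
      using insert.hyps insert.prems(2) N'(1) unfolding y(3)[symmetric] by (intro finsum_insert) auto
    have "par k = 0 \<or> par k = 1" by (simp add: par_def)
    then show ?case
    proof
      assume "par k = 0"
      then have "w k \<oplus> y \<in> N \<inter> part L 0" using wk y(1) N'(3) part_add by (metis IntD1 IntD2 IntI)
      moreover have "w k \<oplus> (y \<oplus> z) = (w k \<oplus> y) \<oplus> z" using yz by (simp add: a_assoc)
      ultimately show ?thesis unfolding eq using y(2) by blast
    next
      assume "par k = 1"
      then have "w k \<oplus> z \<in> N \<inter> part L 1" using wk y(2) N'(3) part_add by (metis IntD1 IntD2 IntI)
      moreover have "w k \<oplus> (y \<oplus> z) = y \<oplus> (w k \<oplus> z)" using yz by (simp add: a_lcomm)
      ultimately show ?thesis unfolding eq using y(1) by blast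
    qed
  qed
  then show ?thesis using w(4) by metis
qed

text \<open>Stability under the Cartan elements makes \<open>N\<close> graded by
  \<open>stable_graded\<close>; on homogeneous components skew-symmetry turns left stability into
  right stability.\<close>

lemma superidealI:
  assumes N: "submodule N complex_field L"
    and h: "\<And>h w. h \<in> carrier (hspace v) \<Longrightarrow> w \<in> N \<Longrightarrow> bracket L (\<iota> h) w \<in> N"
    and e: "\<And>x w. x \<in> X \<Longrightarrow> w \<in> N \<Longrightarrow> bracket L (e x) w \<in> N"
    and f: "\<And>x w. x \<in> X \<Longrightarrow> w \<in> N \<Longrightarrow> bracket L (f x) w \<in> N"
  shows "superideal N L"
proof -
  have left: "bracket L u w \<in> N" if "u \<in> carrier L" "w \<in> N" for u w
    using stable_ideal[OF N h e f that] .
  have hom: "bracket L w u \<in> N" if w: "w \<in> N" "w \<in> part L i" and u: "u \<in> part L j" for u w i j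
    using left[OF part_carrier[OF u] w(1)] N by (subst bracket_skew[OF w(2) u]) (auto simp: submodule_iff)
  have right: "bracket L w u \<in> N" if u: "u \<in> carrier L" and w: "w \<in> N" for u w
  proof -
    obtain y z where y: "y \<in> N" "y \<in> part L 0" "z \<in> N" "z \<in> part L 1" "w = y \<oplus> z"
      using stable_graded[OF N h w] by blast
    obtain a b where a: "a \<in> part L 0" "b \<in> part L 1" "u = a \<oplus> b"
      using part_decomp[OF u] by blast
    have "bracket L w u = (bracket L y a \<oplus> bracket L y b) \<oplus> (bracket L z a \<oplus> bracket L z b)"
    proof -
      have "y \<in> carrier L" "z \<in> carrier L" "a \<in> carrier L" "b \<in> carrier L"
        using y a part_carrier by blast+
      then show ?thesis by (simp add: y(5) a(3) bracket_add_left bracket_add_right a_ac)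
    qed
    then show ?thesis
      using hom[OF y(1,2) a(1)] hom[OF y(1,2) a(2)] hom[OF y(3,4) a(1)] hom[OF y(3,4) a(2)] N
      by (simp add: submodule_iff)
  qed
  show ?thesis
    using N left right stable_graded[OF N h] by (simp add: superideal_def)
qed

end

section \<open>The largest ideal meeting the Cartan subalgebra trivially\<close>

text \<open>A union, so that maximality is immediate; closure under sums then requires
  proof.\<close>

definition maximal_ideal :: "'a lie_superalgebra \<Rightarrow> 'a set \<Rightarrow> 'a set"
  where "maximal_ideal L C = \<Union>{J. superideal J L \<and> J \<inter> C = {\<zero>\<^bsub>L\<^esub>}}"

context generated_root_rep
begin

lemma cartan_zero: "\<iota> \<zero>\<^bsub>hspace v\<^esub> = \<zero>"
proof -
  interpret V: complex_vector_space "hspace v" using space by (simp add: complex_vector_space_iff)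
  show ?thesis using cartan_scale[OF V.zero_closed, of 0] by simp
qed

lemma superideal_zero: "superideal {\<zero>} L"
  using part_zero by (auto simp: superideal_def submodule_iff)

lemma zero_in_cartan: "\<zero> \<in> \<iota> ` carrier (hspace v)"
proof -
  interpret V: complex_vector_space "hspace v" using space by (simp add: complex_vector_space_iff)
  show ?thesis using cartan_zero V.zero_closed by (metis imageI)
qed

text \<open>If all simple roots are 1 at \<open>h\<close>, an ideal meeting the Cartan subalgebra
  trivially consists of sums of eigenvectors with nonzero eigenvalues. Such sums are closed under
  addition and contain no nonzero Cartan element, so the sum of two such ideals is again
  one.\<close>

lemma maximal_ideal:
  "superideal (maximal_ideal L (\<iota> ` carrier (hspace v))) L"
  "maximal_ideal L (\<iota> ` carrier (hspace v)) \<inter> \<iota> ` carrier (hspace v) = {\<zero>}"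
proof -
  let ?H = "\<iota> ` carrier (hspace v)" and ?I = "maximal_ideal L (\<iota> ` carrier (hspace v))"
  obtain h where h: "h \<in> carrier (hspace v)" "\<And>x. x \<in> X \<Longrightarrow> simple_root v x h = of_nat 1"
    using coweight_ex[of "\<lambda>x. 1"] by auto
  let ?P = "\<lambda>k. {u \<in> {u \<in> carrier L. k = 0 \<longrightarrow> u = \<zero>}. bracket L (\<iota> h) u = k \<odot> u}"
  have subP: "submodule (?P k) complex_field L" for k using submodule_nonzero_eigen[OF h] by simp
  have sums: "J \<subseteq> eigen_sums L ?P" if "superideal J L" "J \<inter> ?H = {\<zero>}" for J
    using trivial_eigen_sums[OF h, of J] that h(1) by (auto simp: superideal_def)
  have zero: "\<zero> \<in> ?I"
    unfolding maximal_ideal_def using superideal_zero zero_in_cartan by blast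
  have add: "x \<oplus> y \<in> ?I" if "x \<in> ?I" "y \<in> ?I" for x y
  proof -
    from that obtain J K where J: "superideal J L" "J \<inter> ?H = {\<zero>}" "x \<in> J"
      and K: "superideal K L" "K \<inter> ?H = {\<zero>}" "y \<in> K"
      unfolding maximal_ideal_def by blast
    note J' = superideal_submodule[OF J(1)] and K' = superideal_submodule[OF K(1)]
    let ?M = "{a \<oplus> b | a b. a \<in> J \<and> b \<in> K}"
    have M: "submodule ?M complex_field L"
      unfolding submodule_iff
    proof (intro conjI ballI allI)
      show "?M \<subseteq> carrier L" using J'(1) K'(1) by auto
      show "\<zero> \<in> ?M" using J'(2) K'(2) by force
      fix p assume "p \<in> ?M"
      then obtain a b where p: "p = a \<oplus> b" "a \<in> J" "b \<in> K" by blast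
      then have pc: "a \<in> carrier L" "b \<in> carrier L" using J'(1) K'(1) by auto
      show "c \<odot> p \<in> ?M" for c
      proof -
        have "c \<odot> p = c \<odot> a \<oplus> c \<odot> b" using p pc by (simp add: scale_add_right)
        then show ?thesis using p J'(4) K'(4) by blast
      qed
      fix q assume "q \<in> ?M"
      then obtain a' b' where q: "q = a' \<oplus> b'" "a' \<in> J" "b' \<in> K" by blast
      then have qc: "a' \<in> carrier L" "b' \<in> carrier L" using J'(1) K'(1) by auto
      have "p \<oplus> q = (a \<oplus> a') \<oplus> (b \<oplus> b')" using p q pc qc by (simp add: a_ac)
      then show "p \<oplus> q \<in> ?M" using J'(3) K'(3) p q by blast
    qed
    have Mst: "bracket L u p \<in> ?M" if "u \<in> carrier L" "p \<in> ?M" for u p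
    proof -
      obtain a b where p: "p = a \<oplus> b" "a \<in> J" "b \<in> K" using \<open>p \<in> ?M\<close> by blast
      then have "bracket L u p = bracket L u a \<oplus> bracket L u b"
        using subsetD[OF J'(1)] subsetD[OF K'(1)] that(1) by (simp add: bracket_add_right)
      moreover have "bracket L u a \<in> J" "bracket L u b \<in> K"
        using J(1) K(1) p that(1) by (auto simp: superideal_def)
      ultimately show ?thesis by blast
    qed
    have "superideal ?M L"
      by (rule superidealI[OF M]) (erule Mst[rotated], simp)+
    moreover have "?M \<inter> ?H = {\<zero>}"
    proof -
      have "u = \<zero>" if u: "u \<in> ?M" "u \<in> ?H" for u
      proof -
        have "u \<in> eigen_sums L ?P"
        proof -
          obtain a b where "u = a \<oplus> b" "a \<in> J" "b \<in> K" using u(1) by blast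
          then show ?thesis
            using eigen_sums_add[where P = ?P, OF subP] sums[OF J(1,2)] sums[OF K(1,2)] by blast
        qed
        then show ?thesis using u(2) cartan_nonzero_eigen[OF h] by auto
      qed
      moreover have "\<zero> \<in> ?M" using M by (simp add: submodule_iff)
      ultimately show ?thesis using zero_in_cartan by blast
    qed
    moreover have "x \<oplus> y \<in> ?M" using J(3) K(3) by blast
    ultimately show ?thesis unfolding maximal_ideal_def by blast
  qed
  have M: "submodule ?I complex_field L"
    unfolding submodule_iff
  proof (intro conjI ballI allI zero add)
    show "?I \<subseteq> carrier L" using superideal_submodule(1) by (auto simp: maximal_ideal_def)
    show "c \<odot> x \<in> ?I" if "x \<in> ?I" for c x
      using that superideal_submodule(4) unfolding maximal_ideal_def by blast
  qed
  have st: "bracket L u w \<in> ?I" if "u \<in> carrier L" "w \<in> ?I" for u w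
    using that unfolding maximal_ideal_def superideal_def by blast
  show "superideal ?I L" by (rule superidealI[OF M]) (erule st[rotated], simp)+
  show "?I \<inter> ?H = {\<zero>}" using zero zero_in_cartan by (auto simp: maximal_ideal_def)
qed

end

section \<open>Linear combinations and separating functionals\<close>

context complex_vector_space
begin

lemma lin_comb_closed [simp]: "u \<in> S \<rightarrow> carrier V \<Longrightarrow> lin_comb V S u c \<in> carrier V"
  unfolding lin_comb_def by (rule finsum_closed) auto

lemma lin_comb_add:
  "u \<in> S \<rightarrow> carrier V \<Longrightarrow> lin_comb V S u (\<lambda>i. c i + d i) = lin_comb V S u c \<oplus> lin_comb V S u d"
proof -
  assume u: "u \<in> S \<rightarrow> carrier V"
  have "(\<Oplus>i\<in>S. (c i + d i) \<odot> u i) = (\<Oplus>i\<in>S. c i \<odot> u i \<oplus> d i \<odot> u i)"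
    using u by (intro finsum_cong') (auto simp: scale_add_left Pi_iff)
  also have "\<dots> = (\<Oplus>i\<in>S. c i \<odot> u i) \<oplus> (\<Oplus>i\<in>S. d i \<odot> u i)"
    using u by (intro finsum_addf) auto
  finally show ?thesis by (simp add: lin_comb_def)
qed

lemma lin_comb_scale:
  "finite S \<Longrightarrow> u \<in> S \<rightarrow> carrier V \<Longrightarrow> lin_comb V S u (\<lambda>i. k * c i) = k \<odot> lin_comb V S u c"
  unfolding lin_comb_def
  by (subst finsum_smult_ldistr) (auto simp: Pi_iff intro!: finsum_cong')

lemma lin_comb_remove:
  assumes "finite S" "j \<in> S" "u \<in> S \<rightarrow> carrier V"
  shows "lin_comb V S u c = c j \<odot> u j \<oplus> lin_comb V (S - {j}) u c"
proof -
  have "(\<Oplus>i\<in>insert j (S - {j}). c i \<odot> u i) = c j \<odot> u j \<oplus> (\<Oplus>i\<in>S - {j}. c i \<odot> u i)"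
    using assms by (intro finsum_insert) auto
  then show ?thesis using assms(2) by (simp add: lin_comb_def insert_absorb)
qed

lemma lin_comb_cong:
  "u \<in> S \<rightarrow> carrier V \<Longrightarrow> (\<And>i. i \<in> S \<Longrightarrow> c i = d i) \<Longrightarrow> lin_comb V S u c = lin_comb V S u d"
  unfolding lin_comb_def by (rule finsum_cong') auto

text \<open>A smallest finite spanning set that contains \<open>h\<close> is a basis, and the
  functional is the coordinate at \<open>h\<close>. It will serve as a highest weight that is
  nonzero at \<open>h\<close>.\<close>

lemma separating_functional:
  assumes fin: "finite_dim V" and h: "h \<in> carrier V" "h \<noteq> \<zero>"
  obtains lam where "\<And>x y. x \<in> carrier V \<Longrightarrow> y \<in> carrier V \<Longrightarrow> lam (x \<oplus> y) = lam x + lam y"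
    and "\<And>c x. x \<in> carrier V \<Longrightarrow> lam (c \<odot> x) = c * lam x" and "lam h \<noteq> (0 :: complex)"
proof -
  define spans where "spans B \<longleftrightarrow> finite B \<and> B \<subseteq> carrier V \<and> h \<in> B \<and>
    (\<forall>w\<in>carrier V. \<exists>c. w = lin_comb V B (\<lambda>u. u) c)" for B
  obtain B0 where B0: "finite B0" "B0 \<subseteq> carrier V" "\<And>w. w \<in> carrier V \<Longrightarrow> \<exists>c. w = lin_comb V B0 (\<lambda>u. u) c"
    using fin by (auto simp: finite_dim_def)
  have "spans (insert h B0)"
  proof (cases "h \<in> B0")
    case True
    then show ?thesis using B0 by (simp add: spans_def insert_absorb)
  next
    case False
    have "\<exists>c. w = lin_comb V (insert h B0) (\<lambda>u. u) c" if w: "w \<in> carrier V" for w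
    proof -
      obtain c where c: "w = lin_comb V B0 (\<lambda>u. u) c" using B0(3)[OF w] by blast
      have pi: "(\<lambda>u. u) \<in> insert h B0 \<rightarrow> carrier V" and "(\<lambda>u. u) \<in> B0 \<rightarrow> carrier V"
        using B0(2) h(1) by auto
      then have "lin_comb V B0 (\<lambda>u. u) (c(h := 0)) = w"
        unfolding c using False by (intro lin_comb_cong) auto
      moreover have "insert h B0 - {h} = B0" using False by simp
      ultimately have "lin_comb V (insert h B0) (\<lambda>u. u) (c(h := 0)) = (c(h := 0)) h \<odot> h \<oplus> w"
        using lin_comb_remove[OF _ _ pi, of h "c(h := 0)"] B0(1) by (metis finite_insert insertI1)
      also have "\<dots> = w" using h(1) w by simp
      finally show ?thesis by metis
    qed
    then show ?thesis using B0 h(1) by (simp add: spans_def)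
  qed
  then obtain B where B: "spans B" and min: "\<And>B'. spans B' \<Longrightarrow> card B \<le> card B'"
    using ex_has_least_nat[of spans "insert h B0" card] by blast
  have fB: "finite B" and cB: "(\<lambda>u. u) \<in> B \<rightarrow> carrier V" and hB: "h \<in> B"
    and sp: "\<And>w. w \<in> carrier V \<Longrightarrow> \<exists>c. w = lin_comb V B (\<lambda>u. u) c"
    using B by (auto simp: spans_def)
  have indep: "c u = 0" if c: "lin_comb V B (\<lambda>u. u) c = \<zero>" and u: "u \<in> B" for c u
  proof -
    \<comment> \<open>A nonzero coefficient at such a \<open>u\<close> would make \<open>u\<close>
      redundant, against minimality. The vector \<open>h\<close> may not be removed from the set, so
      its coefficient is treated afterwards, using that \<open>h\<close> is nonzero.\<close>
    have other: "c u = 0" if "u \<in> B" "u \<noteq> h" for u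
    proof (rule ccontr)
      assume cu: "c u \<noteq> 0"
      have "spans (B - {u})"
      proof -
        have "\<exists>d. w = lin_comb V (B - {u}) (\<lambda>u. u) d" if w: "w \<in> carrier V" for w
        proof -
          obtain d where d: "w = lin_comb V B (\<lambda>u. u) d" using sp[OF w] by blast
          define d' where "d' i = d i + (- (d u / c u)) * c i" for i
          have "lin_comb V B (\<lambda>u. u) d' = w \<oplus> (- (d u / c u)) \<odot> lin_comb V B (\<lambda>u. u) c"
            unfolding d'_def d using cB fB by (simp only: lin_comb_add lin_comb_scale)
          then have "w = lin_comb V B (\<lambda>u. u) d'" using c w by simp
          also have "\<dots> = d' u \<odot> u \<oplus> lin_comb V (B - {u}) (\<lambda>u. u) d'"
            using fB \<open>u \<in> B\<close> cB by (rule lin_comb_remove)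
          also have "\<dots> = lin_comb V (B - {u}) (\<lambda>u. u) d'"
          proof -
            have "d' u = 0" using cu by (simp add: d'_def)
            moreover have "u \<in> carrier V" using cB \<open>u \<in> B\<close> by auto
            moreover have "lin_comb V (B - {u}) (\<lambda>u. u) d' \<in> carrier V" using cB by (intro lin_comb_closed) auto
            ultimately show ?thesis by simp
          qed
          finally show ?thesis by blast
        qed
        then show ?thesis using B \<open>u \<noteq> h\<close> by (auto simp: spans_def)
      qed
      then have "card B \<le> card (B - {u})" by (rule min)
      then show False using card_Diff1_less[OF fB \<open>u \<in> B\<close>] by simp
    qed
    have "lin_comb V B (\<lambda>u. u) c = c h \<odot> h \<oplus> lin_comb V (B - {h}) (\<lambda>u. u) c"
      using fB hB cB by (rule lin_comb_remove)
    also have "lin_comb V (B - {h}) (\<lambda>u. u) c = lin_comb V (B - {h}) (\<lambda>u. u) (\<lambda>i. 0 * c i)"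
      using other cB by (intro lin_comb_cong) auto
    also have "\<dots> = \<zero>"
    proof -
      have "(\<lambda>u. u) \<in> B - {h} \<rightarrow> carrier V" using cB by auto
      then show ?thesis using fB lin_comb_closed[of "\<lambda>u. u" "B - {h}" c] by (subst lin_comb_scale) auto
    qed
    finally have "c h \<odot> h = \<zero>" using c h(1) by (metis r_zero scale_closed)
    then have "c h = 0" using h(2) scale_eq_zero_iff[OF h(1)] by blast
    then show ?thesis using other u by blast
  qed
  \<comment> \<open>Coordinates are chosen; independence makes them unique, and uniqueness gives
    linearity.\<close>
  define crd where "crd w = (SOME c. w = lin_comb V B (\<lambda>u. u) c)" for w
  have crd: "w = lin_comb V B (\<lambda>u. u) (crd w)" if "w \<in> carrier V" for w
    unfolding crd_def using sp[OF that] by (rule someI_ex)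
  have uniq: "crd w u = c u" if "w = lin_comb V B (\<lambda>u. u) c" "u \<in> B" for w c u
  proof -
    have w: "w \<in> carrier V" using that(1) cB by simp
    have "lin_comb V B (\<lambda>u. u) (\<lambda>i. c i + (-1) * crd w i) = w \<oplus> (-1) \<odot> w"
      using that(1) crd[OF w] cB fB by (simp only: lin_comb_add lin_comb_scale)
    then have "c u + (-1) * crd w u = 0"
      using w by (intro indep[where c = "\<lambda>i. c i + (-1) * crd w i", OF _ that(2)]) (simp add: add_scale_minus)
    then show ?thesis by simp
  qed
  show thesis
  proof (rule that[of "\<lambda>w. crd w h"])
    show "crd (x \<oplus> y) h = crd x h + crd y h" if "x \<in> carrier V" "y \<in> carrier V" for x y
    proof (rule uniq[of _ "\<lambda>i. crd x i + crd y i", OF _ hB])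
      show "x \<oplus> y = lin_comb V B (\<lambda>u. u) (\<lambda>i. crd x i + crd y i)"
        unfolding lin_comb_add[OF cB] using crd that by metis
    qed
    show "crd (c \<odot> x) h = c * crd x h" if "x \<in> carrier V" for c x
    proof (rule uniq[of _ "\<lambda>i. c * crd x i", OF _ hB])
      show "c \<odot> x = lin_comb V B (\<lambda>u. u) (\<lambda>i. c * crd x i)"
        unfolding lin_comb_scale[OF fB cB] using crd that by metis
    qed
    have "h = lin_comb V B (\<lambda>u. u) (\<lambda>i. if i = h then 1 else 0)"
    proof -
      have "lin_comb V B (\<lambda>u. u) (\<lambda>i. if i = h then 1 else 0) =
        1 \<odot> h \<oplus> lin_comb V (B - {h}) (\<lambda>u. u) (\<lambda>i. if i = h then 1 else 0)"
        using lin_comb_remove[OF fB hB cB, of "\<lambda>i. if i = h then 1 else 0"] by simp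
      also have "lin_comb V (B - {h}) (\<lambda>u. u) (\<lambda>i. if i = h then 1 else 0) =
        lin_comb V (B - {h}) (\<lambda>u. u) (\<lambda>i. 0 * 0)"
        using cB by (intro lin_comb_cong) auto
      also have "\<dots> = 0 \<odot> lin_comb V (B - {h}) (\<lambda>u. u) (\<lambda>i. 0)"
        using fB cB by (intro lin_comb_scale) auto
      also have "\<dots> = \<zero>" using cB by (intro scale_zero_left lin_comb_closed) auto
      finally show ?thesis using h(1) by simp
    qed
    from uniq[OF this hB] show "crd h h \<noteq> 0" by simp
  qed
qed

end

text \<open>Operators act on all functions, without a condition of finite support. For the module
  below this is harmless, since each coefficient of an image depends on finitely many coefficients
  of the argument.\<close>

type_synonym 'b operator = "('b \<Rightarrow> complex) \<Rightarrow> 'b \<Rightarrow> complex"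

section \<open>The Verma module and the embedding of the Cartan subalgebra\<close>

definition linear_operator :: "'b operator \<Rightarrow> bool"
  where "linear_operator A \<longleftrightarrow>
    (\<forall>\<phi> \<psi>. A (\<lambda>w. \<phi> w + \<psi> w) = (\<lambda>w. A \<phi> w + A \<psi> w)) \<and>
    (\<forall>c \<phi>. A (\<lambda>w. c * \<phi> w) = (\<lambda>w. c * A \<phi> w))"

lemma linear_operator_simps:
  assumes "linear_operator A"
  shows "A (\<lambda>w. \<phi> w + \<psi> w) = (\<lambda>w. A \<phi> w + A \<psi> w)"
    and "A (\<lambda>w. c * \<phi> w) = (\<lambda>w. c * A \<phi> w)"
    and "A (\<lambda>w. \<phi> w - \<psi> w) = (\<lambda>w. A \<phi> w - A \<psi> w)"
    and "A (\<lambda>w. 0) = (\<lambda>w. 0)"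
proof -
  show add: "A (\<lambda>w. \<phi> w + \<psi> w) = (\<lambda>w. A \<phi> w + A \<psi> w)" for \<phi> \<psi>
    using assms unfolding linear_operator_def by blast
  show scale: "A (\<lambda>w. c * \<phi> w) = (\<lambda>w. c * A \<phi> w)" for c \<phi>
    using assms unfolding linear_operator_def by blast
  show "A (\<lambda>w. \<phi> w - \<psi> w) = (\<lambda>w. A \<phi> w - A \<psi> w)"
    using add[of \<phi> "\<lambda>w. (-1) * \<psi> w"] scale[of "-1" \<psi>] by simp
  show "A (\<lambda>w. 0) = (\<lambda>w. 0)" using scale[of 0 "\<lambda>w. 0"] by simp
qed

text \<open>An even and an odd operator are paired, so that no grading of the underlying space is needed.\<close>

definition operator_superalgebra :: "('b operator \<times> 'b operator) lie_superalgebra"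
  where "operator_superalgebra =
    \<lparr>carrier = {(A, B). linear_operator A \<and> linear_operator B},
     mult = undefined, one = undefined,
     zero = (\<lambda>\<phi> w. 0, \<lambda>\<phi> w. 0),
     add = (\<lambda>(A, B) (C, D). (\<lambda>\<phi> w. A \<phi> w + C \<phi> w, \<lambda>\<phi> w. B \<phi> w + D \<phi> w)),
     smult = (\<lambda>c (A, B). (\<lambda>\<phi> w. c * A \<phi> w, \<lambda>\<phi> w. c * B \<phi> w)),
     bracket = (\<lambda>(A, B) (C, D).
       (\<lambda>\<phi> w. A (C \<phi>) w - C (A \<phi>) w + (B (D \<phi>) w + D (B \<phi>) w),
        \<lambda>\<phi> w. A (D \<phi>) w - D (A \<phi>) w + (B (C \<phi>) w - C (B \<phi>) w))),
     part = (\<lambda>i. {(A, B). linear_operator A \<and> linear_operator B \<and>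
       (if i = 0 then B = (\<lambda>\<phi> w. 0) else A = (\<lambda>\<phi> w. 0))})\<rparr>"

lemma linear_operator_ops:
  "linear_operator (\<lambda>\<phi> w. 0)"
  "linear_operator A \<Longrightarrow> linear_operator B \<Longrightarrow> linear_operator (\<lambda>\<phi> w. A \<phi> w + B \<phi> w)"
  "linear_operator A \<Longrightarrow> linear_operator B \<Longrightarrow> linear_operator (\<lambda>\<phi> w. A \<phi> w - B \<phi> w)"
  "linear_operator A \<Longrightarrow> linear_operator (\<lambda>\<phi> w. c * A \<phi> w)"
  "linear_operator A \<Longrightarrow> linear_operator B \<Longrightarrow> linear_operator (\<lambda>\<phi>. A (B \<phi>))"
  by (simp_all add: linear_operator_def algebra_simps)

lemma lie_super_operator: "lie_super (operator_superalgebra :: ('b operator \<times> 'b operator) lie_superalgebra)"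
  (is "lie_super ?L")
proof -
  note defs = operator_superalgebra_def
  have "abelian_group ?L"
  proof (rule abelian_groupI)
    show "\<exists>y\<in>carrier ?L. y \<oplus>\<^bsub>?L\<^esub> x = \<zero>\<^bsub>?L\<^esub>" if "x \<in> carrier ?L" for x
    proof
      show "(-1) \<odot>\<^bsub>?L\<^esub> x \<oplus>\<^bsub>?L\<^esub> x = \<zero>\<^bsub>?L\<^esub>" by (cases x) (simp add: defs)
      show "(-1) \<odot>\<^bsub>?L\<^esub> x \<in> carrier ?L" using that linear_operator_ops(4)[of _ "-1"] by (cases x) (auto simp: defs)
    qed
  qed (auto simp: defs linear_operator_ops algebra_simps)
  then have "complex_space ?L"
    by (rule complex_spaceI) (auto simp: defs linear_operator_ops algebra_simps)
  moreover have "lie_super_axioms ?L"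
  proof
    fix x y z :: "'b operator \<times> 'b operator" and c :: complex and i j :: bit
    obtain A B where x: "x = (A, B)" by fastforce
    obtain C D where y: "y = (C, D)" by fastforce
    obtain F G where z: "z = (F, G)" by fastforce
    have bit: "i = 0 \<or> i = 1" for i :: bit by (cases i) simp_all
    have pc: "part ?L i \<subseteq> carrier ?L" for i by (auto simp: defs)
    then show "part ?L i \<subseteq> carrier ?L" .
    show "\<zero>\<^bsub>?L\<^esub> \<in> part ?L i" by (simp add: defs linear_operator_ops)
    have lin: "linear_operator A" "linear_operator B" if "x \<in> carrier ?L"
      using that by (simp_all add: x defs)
    have lin': "linear_operator C" "linear_operator D" if "y \<in> carrier ?L"
      using that by (simp_all add: y defs)
    have lin'': "linear_operator F" "linear_operator G" if "z \<in> carrier ?L"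
      using that by (simp_all add: z defs)
    show "c \<odot>\<^bsub>?L\<^esub> x \<in> part ?L i" if "x \<in> part ?L i"
      using that bit[of i] unfolding x by (elim disjE) (simp_all add: defs linear_operator_ops)
    show "\<exists>y\<in>part ?L 0. \<exists>z\<in>part ?L 1. x = y \<oplus>\<^bsub>?L\<^esub> z" if "x \<in> carrier ?L"
      using that unfolding x
      by (intro bexI[of _ "(A, \<lambda>\<phi> w. 0)"] bexI[of _ "(\<lambda>\<phi> w. 0, B)"]) (simp_all add: defs linear_operator_ops)
    show "bracket ?L (c \<odot>\<^bsub>?L\<^esub> x) y = c \<odot>\<^bsub>?L\<^esub> bracket ?L x y" if "x \<in> carrier ?L" "y \<in> carrier ?L"
    proof -
      have "linear_operator A" "linear_operator B" "linear_operator C" "linear_operator D"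
        using lin lin' that by blast+
      note * = this[THEN linear_operator_simps(2)]
      show ?thesis by (simp add: x y defs * algebra_simps)
    qed
    show "bracket ?L x (c \<odot>\<^bsub>?L\<^esub> y) = c \<odot>\<^bsub>?L\<^esub> bracket ?L x y" if "x \<in> carrier ?L" "y \<in> carrier ?L"
    proof -
      have "linear_operator A" "linear_operator B" "linear_operator C" "linear_operator D"
        using lin lin' that by blast+
      note * = this[THEN linear_operator_simps(2)]
      show ?thesis by (simp add: x y defs * algebra_simps)
    qed
    show "bracket ?L x y \<in> carrier ?L" if "x \<in> carrier ?L" "y \<in> carrier ?L"
      using lin[OF that(1)] lin'[OF that(2)] by (simp add: x y defs linear_operator_ops)
    show "x \<oplus>\<^bsub>?L\<^esub> y \<in> part ?L i" if "x \<in> part ?L i" "y \<in> part ?L i"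
      using that bit[of i] unfolding x y by (elim disjE) (simp_all add: defs linear_operator_ops)
    show "bracket ?L x y \<in> part ?L (i + j)" if "x \<in> part ?L i" "y \<in> part ?L j"
    proof -
      have "linear_operator A" "linear_operator B" "linear_operator C" "linear_operator D"
        using lin lin' pc that by blast+
      note * = this this[THEN linear_operator_simps(4)]
      show ?thesis using that bit[of i] bit[of j] unfolding x y
        by (elim disjE) (simp_all add: defs linear_operator_ops *)
    qed
    show "bracket ?L x y = (- koszul_sign i j) \<odot>\<^bsub>?L\<^esub> bracket ?L y x" if "x \<in> part ?L i" "y \<in> part ?L j"
    proof -
      have "linear_operator A" "linear_operator B" "linear_operator C" "linear_operator D"
        using lin lin' pc that by blast+
      note * = this[THEN linear_operator_simps(4)]
      show ?thesis using that bit[of i] bit[of j] unfolding x y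
        by (elim disjE) (simp_all add: defs * koszul_sign_def add.commute)
    qed
    show "bracket ?L (x \<oplus>\<^bsub>?L\<^esub> y) z = bracket ?L x z \<oplus>\<^bsub>?L\<^esub> bracket ?L y z"
      if "x \<in> carrier ?L" "y \<in> carrier ?L" "z \<in> carrier ?L"
    proof -
      have "linear_operator A" "linear_operator B" "linear_operator C" "linear_operator D"
        "linear_operator F" "linear_operator G"
        using lin lin' lin'' that by blast+
      note * = this[THEN linear_operator_simps(1)]
      show ?thesis by (simp add: x y z defs * algebra_simps)
    qed
    show "bracket ?L x (y \<oplus>\<^bsub>?L\<^esub> z) = bracket ?L x y \<oplus>\<^bsub>?L\<^esub> bracket ?L x z"
      if "x \<in> carrier ?L" "y \<in> carrier ?L" "z \<in> carrier ?L"
    proof -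
      have "linear_operator A" "linear_operator B" "linear_operator C" "linear_operator D"
        "linear_operator F" "linear_operator G"
        using lin lin' lin'' that by blast+
      note * = this[THEN linear_operator_simps(1)]
      show ?thesis by (simp add: x y z defs * algebra_simps)
    qed
    show "bracket ?L x (bracket ?L y z) =
          bracket ?L (bracket ?L x y) z \<oplus>\<^bsub>?L\<^esub> koszul_sign i j \<odot>\<^bsub>?L\<^esub> bracket ?L y (bracket ?L x z)"
      if "x \<in> part ?L i" "y \<in> part ?L j" "z \<in> carrier ?L"
    proof -
      have "linear_operator A" "linear_operator B" "linear_operator C" "linear_operator D"
        "linear_operator F" "linear_operator G"
        using lin lin' lin'' pc that by blast+
      note * = this[THEN linear_operator_simps(1)] this[THEN linear_operator_simps(2)]
        this[THEN linear_operator_simps(3)] this[THEN linear_operator_simps(4)]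
      have "(i = 0 \<and> B = (\<lambda>\<phi> w. 0)) \<or> (i = 1 \<and> A = (\<lambda>\<phi> w. 0))"
        "(j = 0 \<and> D = (\<lambda>\<phi> w. 0)) \<or> (j = 1 \<and> C = (\<lambda>\<phi> w. 0))"
        using that(1,2) bit[of i] bit[of j] unfolding x y by (auto simp: defs split: if_splits)
      then show ?thesis
        by (elim disjE conjE) (simp_all add: x y z defs * koszul_sign_def algebra_simps)
    qed
  qed
  ultimately show ?thesis by (simp add: lie_super_def complex_vector_space_def)
qed

definition homogeneous_operator :: "bit \<Rightarrow> 'b operator \<Rightarrow> 'b operator \<times> 'b operator"
  where "homogeneous_operator i A = (if i = 0 then (A, \<lambda>\<phi> w. 0) else (\<lambda>\<phi> w. 0, A))"

lemma bracket_homogeneous_operator: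
  assumes "linear_operator A" "linear_operator B"
  shows "bracket operator_superalgebra (homogeneous_operator i A) (homogeneous_operator j B) =
    homogeneous_operator (i + j) (\<lambda>\<phi> w. A (B \<phi>) w - koszul_sign i j * B (A \<phi>) w)"
proof -
  have bit: "i = 0 \<or> i = 1" for i :: bit by (cases i) simp_all
  show ?thesis using bit[of i] bit[of j] assms
    by (elim disjE) (simp_all add: operator_superalgebra_def homogeneous_operator_def koszul_sign_def
        linear_operator_simps)
qed

context
  fixes v :: "('h, 'x) root_datum" and X :: "'x set" and lam :: "'h \<Rightarrow> complex"
begin

text \<open>The Verma-type module with highest weight \<open>lam\<close>, on the words in the letters \<open>f\<close>; a function
  \<open>\<phi>\<close> stands for the family of coefficients of the words.\<close>

definition verma_weight :: "'x list \<Rightarrow> 'h \<Rightarrow> complex"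
  where "verma_weight u h = lam h - (\<Sum>z\<leftarrow>u. if z \<in> X then simple_root v z h else 0)"

text \<open>The coefficient of the word \<open>u\<close> in the image under \<open>e x\<close>,
  found by commuting \<open>e x\<close> past a first letter: the Cartan term picks up the word with
  \<open>x\<close> prepended to \<open>u\<close>, and the remaining term keeps the first letter of
  \<open>u\<close> at the cost of a Koszul sign.\<close>

primrec verma_e :: "'x \<Rightarrow> 'x list \<Rightarrow> ('x list \<Rightarrow> complex) \<Rightarrow> complex"
  where
  "verma_e x [] \<phi> = lam (coroot v x) * \<phi> [x]"
| "verma_e x (y # u) \<phi> = verma_weight (y # u) (coroot v x) * \<phi> (x # y # u) +
    koszul_sign (parity v x) (parity v y) * verma_e x u (\<lambda>w. \<phi> (y # w))"

definition verma_f :: "'x \<Rightarrow> 'x list operator"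
  where "verma_f x \<phi> u = (case u of [] \<Rightarrow> 0 | y # w \<Rightarrow> if y = x then \<phi> w else 0)"

definition verma_h :: "'h \<Rightarrow> 'x list operator"
  where "verma_h h \<phi> u = verma_weight u h * \<phi> u"

lemma verma_e_linear:
  "verma_e x u (\<lambda>w. \<phi> w + \<psi> w) = verma_e x u \<phi> + verma_e x u \<psi>"
  "verma_e x u (\<lambda>w. c * \<phi> w) = c * verma_e x u \<phi>"
  by (induction u arbitrary: \<phi> \<psi>) (simp_all add: algebra_simps)

lemma linear_verma:
  "linear_operator (\<lambda>\<phi> u. verma_e x u \<phi>)" "linear_operator (verma_f x)" "linear_operator (verma_h h)"
  by (auto simp: linear_operator_def verma_e_linear verma_f_def verma_h_def fun_eq_iff algebra_simps
      split: list.splits)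

text \<open>The induction needs an arbitrary constant \<open>c\<close> in place of the highest
  weight, because removing the first letter of a word changes the constant by the root of that
  letter. Letters outside \<open>X\<close> count with weight zero.\<close>

lemma verma_e_weight:
  assumes "x \<in> X"
  shows "verma_e x u (\<lambda>w. (c - (\<Sum>z\<leftarrow>w. if z \<in> X then simple_root v z h else 0)) * \<phi> w) =
    (c - (\<Sum>z\<leftarrow>u. if z \<in> X then simple_root v z h else 0) - simple_root v x h) * verma_e x u \<phi>"
proof (induction u arbitrary: c \<phi>)
  case Nil
  then show ?case using assms by (simp add: algebra_simps)
next
  case (Cons y u)
  let ?b = "if y \<in> X then simple_root v y h else 0"
  have eq: "c - (\<Sum>z\<leftarrow>y # w. if z \<in> X then simple_root v z h else 0) =
    (c - ?b) - (\<Sum>z\<leftarrow>w. if z \<in> X then simple_root v z h else 0)" for w by simp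
  have x: "(\<Sum>z\<leftarrow>x # y # u. if z \<in> X then simple_root v z h else 0) =
    simple_root v x h + (\<Sum>z\<leftarrow>y # u. if z \<in> X then simple_root v z h else 0)"
    using assms by simp
  show ?case
    unfolding verma_e.simps x eq Cons by (simp only: eq[symmetric]) (simp add: algebra_simps)
qed

text \<open>The recursion for \<open>verma_e\<close> is set up to make this relation hold, since
  \<open>verma_f y\<close> only prepends \<open>y\<close>.\<close>

lemma verma_e_f:
  "verma_e x u (verma_f y \<phi>) - koszul_sign (parity v x) (parity v y) * verma_f y (\<lambda>u. verma_e x u \<phi>) u =
    (if x = y then verma_h (coroot v x) \<phi> u else 0)"
proof (cases u)
  case Nil
  then show ?thesis by (simp add: verma_f_def verma_h_def verma_weight_def)
next
  case (Cons z w)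
  have zero: "verma_e x w (\<lambda>w. 0) = 0" using verma_e_linear(2)[of x w 0 "\<lambda>w. 0"] by simp
  have "(\<lambda>w. verma_f y \<phi> (z # w)) = (if z = y then \<phi> else (\<lambda>w. 0))"
    by (auto simp: verma_f_def fun_eq_iff)
  then show ?thesis using Cons zero by (auto simp: verma_f_def verma_h_def)
qed

end

section \<open>Dual spaces and prescribed values of the simple roots\<close>

definition linear_functional :: "(complex, 'a, 'm) module_scheme \<Rightarrow> ('a \<Rightarrow> complex) \<Rightarrow> bool"
  where "linear_functional V g \<longleftrightarrow>
    (\<forall>x\<in>carrier V. \<forall>y\<in>carrier V. g (x \<oplus>\<^bsub>V\<^esub> y) = g x + g y) \<and>
    (\<forall>c. \<forall>x\<in>carrier V. g (c \<odot>\<^bsub>V\<^esub> x) = c * g x)"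

lemma dual_space_iff:
  "g \<in> carrier (dual_space V) \<longleftrightarrow> g \<in> extensional (carrier V) \<and> linear_functional V g"
  by (auto simp: dual_space_def linear_functional_def PiE_def)

context complex_vector_space
begin

lemma linear_functional_zero: "linear_functional V g \<Longrightarrow> g \<zero> = 0"
  unfolding linear_functional_def by (metis mult_zero_left scale_zero_right zero_closed)

lemma linear_functional_lin_comb:
  assumes g: "linear_functional V g" and "finite S" "u \<in> S \<rightarrow> carrier V"
  shows "g (lin_comb V S u c) = (\<Sum>i\<in>S. c i * g (u i))"
  using assms(2,3)
proof (induction S rule: finite_induct)
  case empty
  then show ?case using linear_functional_zero[OF g] by (simp add: lin_comb_def)
next
  case (insert j S)
  have u: "u j \<in> carrier V" "u \<in> S \<rightarrow> carrier V" using insert.prems by auto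
  have "lin_comb V (insert j S) u c = c j \<odot> u j \<oplus> lin_comb V S u c"
    using lin_comb_remove[of "insert j S" j u c] insert by simp
  moreover have "g (c j \<odot> u j \<oplus> lin_comb V S u c) = c j * g (u j) + g (lin_comb V S u c)"
    using g u unfolding linear_functional_def by simp
  ultimately show ?case using insert.IH[OF u(2)] insert.hyps by simp
qed

text \<open>Induction on the number of functionals. If the new functional vanished on the common
  kernel of the earlier ones, it would be a combination of them, against independence; a vector of
  that kernel then corrects its value without disturbing the others.\<close>

lemma independent_functionals:
  assumes "finite S" and "\<And>i. i \<in> S \<Longrightarrow> linear_functional V (g i)"
    and "\<And>c i. \<forall>w\<in>carrier V. (\<Sum>i\<in>S. c i * g i w) = 0 \<Longrightarrow> i \<in> S \<Longrightarrow> c i = (0 :: complex)"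
  shows "\<exists>h\<in>carrier V. \<forall>i\<in>S. g i h = t i"
  using assms
proof (induction S arbitrary: t rule: finite_induct)
  case empty
  then show ?case by auto
next
  case (insert z S)
  have lin: "linear_functional V (g i)" if "i \<in> insert z S" for i using insert.prems(1) that by blast
  have add: "g i (x \<oplus> y) = g i x + g i y" and scale: "g i (c \<odot> x) = c * g i x"
    if "i \<in> insert z S" "x \<in> carrier V" "y \<in> carrier V" for i x y c
    using lin[OF that(1)] that unfolding linear_functional_def by auto
  have IH: "\<exists>h\<in>carrier V. \<forall>i\<in>S. g i h = t i" for t
  proof (rule insert.IH)
    show "linear_functional V (g i)" if "i \<in> S" for i using lin that by blast
    show "c i = 0" if c: "\<forall>w\<in>carrier V. (\<Sum>i\<in>S. c i * g i w) = 0" and i: "i \<in> S" for c i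
    proof -
      have "(\<Sum>i\<in>insert z S. (c(z := 0)) i * g i w) = (\<Sum>i\<in>S. c i * g i w)" for w
        using insert.hyps by (simp add: sum.insert) (intro sum.cong, auto)
      then have "(c(z := 0)) i = 0" using insert.prems(2)[of "c(z := 0)" i] c i by simp
      moreover have "i \<noteq> z" using i insert.hyps by blast
      ultimately show ?thesis by simp
    qed
  qed
  have "\<exists>h\<in>carrier V. \<forall>i\<in>S. g i h = (if i = j then 1 else 0)" for j by (rule IH)
  then obtain d where d: "\<And>j. d j \<in> carrier V" "\<And>i j. i \<in> S \<Longrightarrow> g i (d j) = (if i = j then 1 else 0)"
    by metis
  \<comment> \<open>The projection onto the common kernel of the \<open>g i\<close> with
    \<open>i\<close> in \<open>S\<close>, along the dual vectors \<open>d\<close>.\<close>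
  define k where "k w = w \<oplus> (-1) \<odot> lin_comb V S d (\<lambda>i. g i w)" for w
  have dS: "d \<in> S \<rightarrow> carrier V" using d by auto
  have kc: "k w \<in> carrier V" if "w \<in> carrier V" for w using that dS by (simp add: k_def)
  have gk: "g i (k w) = g i w - (\<Sum>j\<in>S. g j w * g i (d j))" if "w \<in> carrier V" "i \<in> insert z S" for i w
    using that dS linear_functional_lin_comb[OF lin[OF that(2)] insert.hyps(1) dS]
    by (simp add: k_def add scale)
  have "\<exists>w\<in>carrier V. g z (k w) \<noteq> 0"
  proof (rule ccontr)
    assume "\<not> (\<exists>w\<in>carrier V. g z (k w) \<noteq> 0)"
    then have eq: "g z w = (\<Sum>j\<in>S. g j w * g z (d j))" if "w \<in> carrier V" for w
      using gk[OF that, of z] that by simp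
    \<comment> \<open>The coefficients of the forbidden relation that expresses \<open>g z\<close>
      through the other functionals.\<close>
    define c where "c i = (if i = z then 1 else - g z (d i))" for i
    have "(\<Sum>i\<in>insert z S. c i * g i w) = 0" if "w \<in> carrier V" for w
    proof -
      have "(\<Sum>i\<in>S. c i * g i w) = (\<Sum>i\<in>S. - (g i w * g z (d i)))"
        using insert.hyps by (intro sum.cong) (auto simp: c_def)
      then show ?thesis using insert.hyps eq[OF that] by (simp add: c_def sum_negf)
    qed
    then have "c z = 0" using insert.prems(2)[of c z] by simp
    then show False by (simp add: c_def)
  qed
  then obtain w where w: "w \<in> carrier V" "g z (k w) \<noteq> 0" by blast
  have gk0: "g i (k w) = 0" if "i \<in> S" for i
  proof -
    have "(\<Sum>j\<in>S. g j w * g i (d j)) = (\<Sum>j\<in>S. if i = j then g j w else 0)"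
      using d(2)[OF that] by (intro sum.cong) auto
    also have "\<dots> = g i w" using insert.hyps(1) that by simp
    finally show ?thesis using gk[OF w(1), of i] that by simp
  qed
  obtain h where h: "h \<in> carrier V" "\<forall>i\<in>S. g i h = t i" using IH by blast
  let ?h = "h \<oplus> ((t z - g z h) / g z (k w)) \<odot> k w"
  have "g i ?h = t i" if "i \<in> insert z S" for i
  proof (cases "i = z")
    case True
    then show ?thesis using h kc[OF w(1)] w(2) by (simp add: add scale)
  next
    case False
    then show ?thesis using h kc[OF w(1)] gk0 that by (simp add: add scale)
  qed
  moreover have "?h \<in> carrier V" using h kc[OF w(1)] by simp
  ultimately show ?case by blast
qed

lemma dual_space_complex: "complex_space (dual_space V)"
proof (rule complex_spaceI)
  have lin: "linear_functional V (\<lambda>w\<in>carrier V. c * f w + d * g w)"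
    if "linear_functional V f" "linear_functional V g" for f g c d
    using that unfolding linear_functional_def by (simp add: algebra_simps)
  have closed: "(\<lambda>w\<in>carrier V. f w + g w) \<in> carrier (dual_space V)"
    if "f \<in> carrier (dual_space V)" "g \<in> carrier (dual_space V)" for f g
    using that lin[of f g 1 1] by (simp add: dual_space_iff)
  have closed': "(\<lambda>w\<in>carrier V. c * f w) \<in> carrier (dual_space V)"
    if "f \<in> carrier (dual_space V)" for f c
    using that lin[of f f c 0] by (simp add: dual_space_iff)
  have ops: "f \<oplus>\<^bsub>dual_space V\<^esub> g = (\<lambda>w\<in>carrier V. f w + g w)"
    "c \<odot>\<^bsub>dual_space V\<^esub> f = (\<lambda>w\<in>carrier V. c * f w)" "\<zero>\<^bsub>dual_space V\<^esub> = (\<lambda>w\<in>carrier V. 0)"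
    for f g c by (simp_all add: dual_space_def)
  have ext: "f = g \<longleftrightarrow> (\<forall>w\<in>carrier V. f w = g w)"
    if "f \<in> carrier (dual_space V)" "g \<in> carrier (dual_space V)" for f g
    using that unfolding dual_space_iff by (metis extensionalityI)
  have zero: "(\<lambda>w\<in>carrier V. 0) \<in> carrier (dual_space V)"
    by (simp add: dual_space_iff linear_functional_def)
  show "abelian_group (dual_space V)"
  proof (rule abelian_groupI)
    show "\<exists>y\<in>carrier (dual_space V). y \<oplus>\<^bsub>dual_space V\<^esub> x = \<zero>\<^bsub>dual_space V\<^esub>"
      if "x \<in> carrier (dual_space V)" for x
      using that closed'[of x "-1"] by (intro bexI[of _ "(\<lambda>w\<in>carrier V. (-1) * x w)"])
        (auto simp: ops fun_eq_iff)
    show "\<zero>\<^bsub>dual_space V\<^esub> \<oplus>\<^bsub>dual_space V\<^esub> x = x" if x: "x \<in> carrier (dual_space V)" for x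
    proof -
      have "x \<in> extensional (carrier V)" using x by (simp add: dual_space_iff)
      then show ?thesis by (intro extensionalityI[of _ "carrier V"]) (simp_all add: ops)
    qed
  qed (auto simp: ops closed zero fun_eq_iff algebra_simps)
  show "c \<odot>\<^bsub>dual_space V\<^esub> x \<in> carrier (dual_space V)" if "x \<in> carrier (dual_space V)" for c x
    using closed'[OF that] by (simp only: ops)
  show "1 \<odot>\<^bsub>dual_space V\<^esub> x = x" if x: "x \<in> carrier (dual_space V)" for x
  proof -
    have "x \<in> extensional (carrier V)" using x by (simp add: dual_space_iff)
    then show ?thesis by (intro extensionalityI[of _ "carrier V"]) (simp_all add: ops)
  qed
qed (simp_all add: dual_space_def fun_eq_iff algebra_simps)

lemma dual_lin_comb:
  assumes "finite S" "b \<in> S \<rightarrow> carrier (dual_space V)" "w \<in> carrier V"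
  shows "lin_comb (dual_space V) S b c w = (\<Sum>i\<in>S. c i * b i w)"
proof -
  interpret D: complex_vector_space "dual_space V"
    by (simp add: complex_vector_space_iff dual_space_complex)
  show ?thesis using assms(1,2)
  proof (induction S rule: finite_induct)
    case empty
    then show ?case using assms(3) by (simp add: lin_comb_def) (simp add: dual_space_def)
  next
    case (insert j S)
    have b: "b j \<in> carrier (dual_space V)" "b \<in> S \<rightarrow> carrier (dual_space V)" using insert.prems by auto
    have "lin_comb (dual_space V) (insert j S) b c = c j \<odot>\<^bsub>dual_space V\<^esub> b j \<oplus>\<^bsub>dual_space V\<^esub> lin_comb (dual_space V) S b c"
      using D.lin_comb_remove[of "insert j S" j b c] insert by simp
    then have "lin_comb (dual_space V) (insert j S) b c w = c j * b j w + lin_comb (dual_space V) S b c w"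
      using assms(3) by (simp add: dual_space_def)
    then show ?case using insert.IH[OF b(2)] insert.hyps by simp
  qed
qed

lemma dual_lin_indep_iff:
  assumes "finite S" "b \<in> S \<rightarrow> carrier (dual_space V)"
  shows "lin_indep_family (dual_space V) S b \<longleftrightarrow>
    (\<forall>c. (\<forall>w\<in>carrier V. (\<Sum>i\<in>S. c i * b i w) = 0) \<longrightarrow> (\<forall>i\<in>S. c i = 0))"
proof -
  interpret D: complex_vector_space "dual_space V"
    by (simp add: complex_vector_space_iff dual_space_complex)
  have "lin_comb (dual_space V) S b c = \<zero>\<^bsub>dual_space V\<^esub> \<longleftrightarrow> (\<forall>w\<in>carrier V. (\<Sum>i\<in>S. c i * b i w) = 0)" for c
  proof -
    have "lin_comb (dual_space V) S b c \<in> extensional (carrier V)"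
      using D.lin_comb_closed[OF assms(2), of c] by (simp add: dual_space_iff)
    moreover have "\<zero>\<^bsub>dual_space V\<^esub> = (\<lambda>w\<in>carrier V. 0)" by (simp add: dual_space_def)
    ultimately have "lin_comb (dual_space V) S b c = \<zero>\<^bsub>dual_space V\<^esub> \<longleftrightarrow>
      (\<forall>w\<in>carrier V. lin_comb (dual_space V) S b c w = 0)"
      by (auto intro: extensionalityI[of _ "carrier V"])
    then show ?thesis using dual_lin_comb[OF assms] by simp
  qed
  then show ?thesis by (simp add: lin_indep_family_def)
qed

end

lemma is_root_datumD:
  assumes "is_root_datum X v"
  shows "complex_space (hspace v)" "finite_dim (hspace v)"
    "x \<in> X \<Longrightarrow> coroot v x \<in> carrier (hspace v)"
    "x \<in> X \<Longrightarrow> linear_functional (hspace v) (simple_root v x)"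
  using assms by (auto simp: is_root_datum_def dual_space_iff PiE_def Pi_iff)

text \<open>Here the independence of the roots \<open>b(x)\<close> pays off: the Cartan elements
  that grade the algebras below all come from this statement.\<close>

lemma root_datum_coweight:
  assumes "finite X" "is_root_datum X v"
  shows "\<exists>h\<in>carrier (hspace v). \<forall>x\<in>X. simple_root v x h = t x"
proof -
  interpret V: complex_vector_space "hspace v"
    using is_root_datumD(1)[OF assms(2)] by (simp add: complex_vector_space_iff)
  have b: "simple_root v \<in> X \<rightarrow> carrier (dual_space (hspace v))"
    and ind: "lin_indep_family (dual_space (hspace v)) X (simple_root v)"
    using assms(2) by (auto simp: is_root_datum_def PiE_def)
  show ?thesis
  proof (rule V.independent_functionals[OF assms(1) is_root_datumD(4)[OF assms(2)]])
    show "c i = 0" if "\<forall>w\<in>carrier (hspace v). (\<Sum>i\<in>X. c i * simple_root v i w) = 0" "i \<in> X" for c i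
      using ind that unfolding V.dual_lin_indep_iff[OF assms(1) b] by blast
  qed
qed

text \<open>The highest weight is left arbitrary, so that \<open>separating_functional\<close> can
  supply a suitable one for each Cartan element.\<close>

lemma verma_rep:
  assumes X: "finite X" and v: "is_root_datum X v" and lam: "linear_functional (hspace v) lam"
  shows "root_rep operator_superalgebra X v (\<lambda>h. homogeneous_operator 0 (verma_h v X lam h))
    (\<lambda>x. homogeneous_operator (parity v x) (\<lambda>\<phi> u. verma_e v X lam x u \<phi>))
    (\<lambda>x. homogeneous_operator (parity v x) (verma_f x))"
proof -
  let ?h = "verma_h v X lam" and ?e = "\<lambda>x \<phi> u. verma_e v X lam x u \<phi>" and ?w = "verma_weight v X lam"
  note D = is_root_datumD[OF v]
  have hom_part: "homogeneous_operator i A \<in> part operator_superalgebra i" if "linear_operator A" for i A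
    using that by (simp add: homogeneous_operator_def operator_superalgebra_def linear_operator_ops)
  have hom_scale: "c \<odot>\<^bsub>operator_superalgebra\<^esub> homogeneous_operator i A = homogeneous_operator i (\<lambda>\<phi> u. c * A \<phi> u)"
    for c i A
    by (simp add: homogeneous_operator_def operator_superalgebra_def)
  have hom_add: "homogeneous_operator i A \<oplus>\<^bsub>operator_superalgebra\<^esub> homogeneous_operator i B =
      homogeneous_operator i (\<lambda>\<phi> u. A \<phi> u + B \<phi> u)" for i A B
    by (simp add: homogeneous_operator_def operator_superalgebra_def)
  have hom_zero: "homogeneous_operator i (\<lambda>\<phi> u. 0) = \<zero>\<^bsub>operator_superalgebra\<^esub>" for i
    by (simp add: homogeneous_operator_def operator_superalgebra_def)
  have lin: "lam (h \<oplus>\<^bsub>hspace v\<^esub> k) = lam h + lam k" "lam (c \<odot>\<^bsub>hspace v\<^esub> h) = c * lam h"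
    "x \<in> X \<Longrightarrow> simple_root v x (h \<oplus>\<^bsub>hspace v\<^esub> k) = simple_root v x h + simple_root v x k"
    "x \<in> X \<Longrightarrow> simple_root v x (c \<odot>\<^bsub>hspace v\<^esub> h) = c * simple_root v x h"
    if "h \<in> carrier (hspace v)" "k \<in> carrier (hspace v)" for h k c x
    using lam D(4) that unfolding linear_functional_def by blast+
  have w_add: "?w u (h \<oplus>\<^bsub>hspace v\<^esub> k) = ?w u h + ?w u k" if "h \<in> carrier (hspace v)" "k \<in> carrier (hspace v)" for u h k
  proof -
    have "(\<Sum>z\<leftarrow>u. if z \<in> X then simple_root v z (h \<oplus>\<^bsub>hspace v\<^esub> k) else 0) =
      (\<Sum>z\<leftarrow>u. if z \<in> X then simple_root v z h else 0) + (\<Sum>z\<leftarrow>u. if z \<in> X then simple_root v z k else 0)"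
      by (induction u) (auto simp: lin(3)[OF that])
    then show ?thesis by (simp add: verma_weight_def lin(1)[OF that])
  qed
  have w_scale: "?w u (c \<odot>\<^bsub>hspace v\<^esub> h) = c * ?w u h" if "h \<in> carrier (hspace v)" for u h c
  proof -
    have "(\<Sum>z\<leftarrow>u. if z \<in> X then simple_root v z (c \<odot>\<^bsub>hspace v\<^esub> h) else 0) =
      c * (\<Sum>z\<leftarrow>u. if z \<in> X then simple_root v z h else 0)"
      by (induction u) (auto simp: lin(4)[OF that that] algebra_simps)
    then show ?thesis by (simp add: verma_weight_def lin(2)[OF that that] algebra_simps)
  qed
  have "root_rep_axioms operator_superalgebra X v (\<lambda>h. homogeneous_operator 0 (?h h))
    (\<lambda>x. homogeneous_operator (parity v x) (?e x)) (\<lambda>x. homogeneous_operator (parity v x) (verma_f x))"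
  proof (rule root_rep_axioms.intro)
    show "complex_space (hspace v)" by (rule D(1))
    show "x \<in> X \<Longrightarrow> coroot v x \<in> carrier (hspace v)" for x by (rule D(3))
    show "\<exists>h\<in>carrier (hspace v). \<forall>x\<in>X. simple_root v x h = t x" for t
      by (rule root_datum_coweight[OF X v])
    show "homogeneous_operator 0 (?h h) \<in> part operator_superalgebra 0" for h
      by (rule hom_part[OF linear_verma(3)])
    show "homogeneous_operator (parity v x) (?e x) \<in> part operator_superalgebra (parity v x)" for x
      by (rule hom_part[OF linear_verma(1)])
    show "homogeneous_operator (parity v x) (verma_f x) \<in> part operator_superalgebra (parity v x)" for x
      by (rule hom_part[OF linear_verma(2)])
    show "homogeneous_operator 0 (?h (h \<oplus>\<^bsub>hspace v\<^esub> k)) =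
      homogeneous_operator 0 (?h h) \<oplus>\<^bsub>operator_superalgebra\<^esub> homogeneous_operator 0 (?h k)"
      if "h \<in> carrier (hspace v)" "k \<in> carrier (hspace v)" for h k
      unfolding hom_add verma_h_def w_add[OF that] by (simp add: algebra_simps)
    show "homogeneous_operator 0 (?h (c \<odot>\<^bsub>hspace v\<^esub> h)) = c \<odot>\<^bsub>operator_superalgebra\<^esub> homogeneous_operator 0 (?h h)"
      if "h \<in> carrier (hspace v)" for h c
      unfolding hom_scale verma_h_def w_scale[OF that] by (simp add: algebra_simps)
    show "bracket operator_superalgebra (homogeneous_operator 0 (?h h)) (homogeneous_operator 0 (?h k)) =
      \<zero>\<^bsub>operator_superalgebra\<^esub>" for h k
    proof -
      have "(\<lambda>\<phi> w. ?h h (?h k \<phi>) w - koszul_sign 0 0 * ?h k (?h h \<phi>) w) = (\<lambda>\<phi> w. 0)"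
        by (simp add: verma_h_def fun_eq_iff)
      then show ?thesis
        by (simp only: bracket_homogeneous_operator[OF linear_verma(3) linear_verma(3)] hom_zero)
    qed
    show "bracket operator_superalgebra (homogeneous_operator 0 (?h h)) (homogeneous_operator (parity v x) (?e x)) =
      simple_root v x h \<odot>\<^bsub>operator_superalgebra\<^esub> homogeneous_operator (parity v x) (?e x)"
      if "x \<in> X" for h x
    proof -
      have "?h h (?e x \<phi>) u - koszul_sign 0 (parity v x) * ?e x (?h h \<phi>) u = simple_root v x h * ?e x \<phi> u" for \<phi> u
      proof -
        have "?h h \<phi> = (\<lambda>w. (lam h - (\<Sum>z\<leftarrow>w. if z \<in> X then simple_root v z h else 0)) * \<phi> w)"
          by (simp add: verma_h_def verma_weight_def fun_eq_iff)
        then have "?e x (?h h \<phi>) u = (lam h - (\<Sum>z\<leftarrow>u. if z \<in> X then simple_root v z h else 0) -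
            simple_root v x h) * ?e x \<phi> u"
          by (simp only: verma_e_weight[OF that])
        then show ?thesis by (simp only: verma_h_def verma_weight_def) (simp add: algebra_simps)
      qed
      then show ?thesis
        by (simp only: bracket_homogeneous_operator[OF linear_verma(3) linear_verma(1)] hom_scale add_0)
    qed
    show "bracket operator_superalgebra (homogeneous_operator 0 (?h h)) (homogeneous_operator (parity v x) (verma_f x)) =
      (- simple_root v x h) \<odot>\<^bsub>operator_superalgebra\<^esub> homogeneous_operator (parity v x) (verma_f x)"
      if "x \<in> X" for h x
    proof -
      have "?h h (verma_f x \<phi>) u - koszul_sign 0 (parity v x) * verma_f x (?h h \<phi>) u =
        - simple_root v x h * verma_f x \<phi> u" for \<phi> u
        using that by (cases u) (auto simp: verma_h_def verma_weight_def verma_f_def algebra_simps)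
      then show ?thesis
        by (simp only: bracket_homogeneous_operator[OF linear_verma(3) linear_verma(2)] hom_scale add_0)
    qed
    show "bracket operator_superalgebra (homogeneous_operator (parity v x) (?e x)) (homogeneous_operator (parity v y) (verma_f y)) =
      \<zero>\<^bsub>operator_superalgebra\<^esub>" if "x \<noteq> y" for x y
    proof -
      have "(\<lambda>\<phi> w. ?e x (verma_f y \<phi>) w - koszul_sign (parity v x) (parity v y) * verma_f y (?e x \<phi>) w) = (\<lambda>\<phi> w. 0)"
        using that by (simp only: verma_e_f if_False)
      then show ?thesis
        by (simp only: bracket_homogeneous_operator[OF linear_verma(1) linear_verma(2)] hom_zero)
    qed
    show "bracket operator_superalgebra (homogeneous_operator (parity v x) (?e x)) (homogeneous_operator (parity v x) (verma_f x)) =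
      homogeneous_operator 0 (?h (coroot v x))" for x
    proof -
      have "(\<lambda>\<phi> w. ?e x (verma_f x \<phi>) w - koszul_sign (parity v x) (parity v x) * verma_f x (?e x \<phi>) w) =
        ?h (coroot v x)"
        by (simp add: verma_e_f fun_eq_iff)
      moreover have "parity v x + parity v x = 0" by (cases "parity v x") simp_all
      ultimately show ?thesis
        by (simp only: bracket_homogeneous_operator[OF linear_verma(1) linear_verma(2)])
    qed
  qed
  then show ?thesis using lie_super_operator by (simp add: root_rep_def)
qed

section \<open>The half-baked algebra as the universal realization\<close>

primrec generator_value :: "('h \<Rightarrow> 'a) \<Rightarrow> ('x \<Rightarrow> 'a) \<Rightarrow> ('x \<Rightarrow> 'a) \<Rightarrow> ('h, 'x) root_generator \<Rightarrow> 'a"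
  where
  "generator_value \<iota> e f (H h) = \<iota> h"
| "generator_value \<iota> e f (E x) = e x"
| "generator_value \<iota> e f (F x) = f x"

definition half_baked_class ::
    "'x set \<Rightarrow> ('h, 'x) root_datum \<Rightarrow> ('h, 'x) root_generator \<Rightarrow> ('h, 'x) root_generator lie_term set"
  where "half_baked_class X v g =
    lie_class (root_generators X v) (generator_parity v) (half_baked_relations X v) (Gen g)"

lemma cartan_embedding_eq: "cartan_embedding X v h = half_baked_class X v (H h)"
  by (simp add: cartan_embedding_def half_baked_class_def)

lemma root_generators_iff [simp]:
  "H h \<in> root_generators X v \<longleftrightarrow> h \<in> carrier (hspace v)"
  "E x \<in> root_generators X v \<longleftrightarrow> x \<in> X" "F x \<in> root_generators X v \<longleftrightarrow> x \<in> X"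
  by (auto simp: root_generators_def)

text \<open>A realization assigns to the generators elements that satisfy the defining relations, so
  the universal property of the presentation applies.\<close>

lemma (in root_rep) half_baked_hom:
  fixes \<Phi>
  defines "\<Phi> \<equiv> eval_class L (generator_value \<iota> e f)"
  shows "super_hom (half_baked X v) L \<Phi>"
    and "g \<in> root_generators X v \<Longrightarrow> \<Phi> (half_baked_class X v g) = generator_value \<iota> e f g"
proof -
  have gen: "generator_value \<iota> e f g \<in> part L (generator_parity v g)" if "g \<in> root_generators X v" for g
    using that cartan_part e_part f_part by (cases g) auto
  have rel: "eval_term L (generator_value \<iota> e f) s = eval_term L (generator_value \<iota> e f) t"
    if "(s, t) \<in> half_baked_relations X v" for s t
    using that
    by (induction rule: half_baked_relations.induct)
      (simp_all add: cartan_add cartan_scale bracket_cartan bracket_cartan_e bracket_cartan_f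
        bracket_e_f bracket_e_f_same)
  show "super_hom (half_baked X v) L \<Phi>"
    unfolding \<Phi>_def half_baked_def by (rule super_hom_eval_class[OF gen rel])
  show "\<Phi> (half_baked_class X v g) = generator_value \<iota> e f g" if "g \<in> root_generators X v"
    unfolding \<Phi>_def half_baked_class_def
    by (subst eval_class[OF gen rel]) (use that in simp_all)
qed

lemma half_baked_rep:
  assumes X: "finite X" and v: "is_root_datum X v"
  shows "generated_root_rep (half_baked X v) X v (cartan_embedding X v)
    (\<lambda>x. half_baked_class X v (E x)) (\<lambda>x. half_baked_class X v (F x))"
proof -
  let ?G = "root_generators X v" and ?p = "generator_parity v" and ?R = "half_baked_relations X v"
  let ?L = "half_baked X v"
  note defs = half_baked_def half_baked_class_def cartan_embedding_def
  interpret L: lie_super ?L unfolding half_baked_def by (rule lie_super_presented)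
  interpret V: complex_vector_space "hspace v"
    using is_root_datumD(1)[OF v] by (simp add: complex_vector_space_iff)
  note D = is_root_datumD[OF v]
  have part: "half_baked_class X v g \<in> part ?L (?p g)" if "g \<in> ?G" for g
    using that by (auto simp: defs presented_part intro!: imageI has_parity.intros(1))
  have rel: "lie_class ?G ?p ?R s = lie_class ?G ?p ?R t" if "(s, t) \<in> ?R" "s \<in> lie_terms ?G" "t \<in> lie_terms ?G" for s t
    using that by (intro lie_class_eqI lie_congruence.relation)
  have "root_rep_axioms ?L X v (cartan_embedding X v)
    (\<lambda>x. half_baked_class X v (E x)) (\<lambda>x. half_baked_class X v (F x))"
  proof (rule root_rep_axioms.intro)
    show "complex_space (hspace v)" by (rule D(1))
    show "x \<in> X \<Longrightarrow> coroot v x \<in> carrier (hspace v)" for x by (rule D(3))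
    show "\<exists>h\<in>carrier (hspace v). \<forall>x\<in>X. simple_root v x h = t x" for t
      by (rule root_datum_coweight[OF X v])
    show "cartan_embedding X v h \<in> part ?L 0" if "h \<in> carrier (hspace v)" for h
      using part[of "H h"] that by (simp add: cartan_embedding_eq)
    show "half_baked_class X v (E x) \<in> part ?L (parity v x)" if "x \<in> X" for x
      using part[of "E x"] that by simp
    show "half_baked_class X v (F x) \<in> part ?L (parity v x)" if "x \<in> X" for x
      using part[of "F x"] that by simp
    show "cartan_embedding X v (h \<oplus>\<^bsub>hspace v\<^esub> k) = cartan_embedding X v h \<oplus>\<^bsub>?L\<^esub> cartan_embedding X v k"
      if "h \<in> carrier (hspace v)" "k \<in> carrier (hspace v)" for h k
      using rel[OF half_baked_relations.intros(1)[OF that]] that by (simp add: defs presented_ops)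
    show "cartan_embedding X v (c \<odot>\<^bsub>hspace v\<^esub> h) = c \<odot>\<^bsub>?L\<^esub> cartan_embedding X v h"
      if "h \<in> carrier (hspace v)" for h c
      using rel[OF half_baked_relations.intros(2)[OF that, where c = c and X = X]] that by (simp add: defs presented_ops)
    show "bracket ?L (cartan_embedding X v h) (cartan_embedding X v k) = \<zero>\<^bsub>?L\<^esub>"
      if "h \<in> carrier (hspace v)" "k \<in> carrier (hspace v)" for h k
      using rel[OF half_baked_relations.intros(3)[OF that]] that by (simp add: defs presented_ops)
    show "bracket ?L (cartan_embedding X v h) (half_baked_class X v (E x)) =
      simple_root v x h \<odot>\<^bsub>?L\<^esub> half_baked_class X v (E x)" if "h \<in> carrier (hspace v)" "x \<in> X" for h x
      using rel[OF half_baked_relations.intros(4)[OF that]] that by (simp add: defs presented_ops)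
    show "bracket ?L (cartan_embedding X v h) (half_baked_class X v (F x)) =
      (- simple_root v x h) \<odot>\<^bsub>?L\<^esub> half_baked_class X v (F x)" if "h \<in> carrier (hspace v)" "x \<in> X" for h x
      using rel[OF half_baked_relations.intros(5)[OF that]] that by (simp add: defs presented_ops)
    show "bracket ?L (half_baked_class X v (E x)) (half_baked_class X v (F y)) = \<zero>\<^bsub>?L\<^esub>"
      if "x \<in> X" "y \<in> X" "x \<noteq> y" for x y
      using rel[OF half_baked_relations.intros(6)[OF that]] that by (simp add: defs presented_ops)
    show "bracket ?L (half_baked_class X v (E x)) (half_baked_class X v (F x)) = cartan_embedding X v (coroot v x)"
      if "x \<in> X" for x
      using rel[OF half_baked_relations.intros(7)[OF that]] that D(3) by (simp add: defs presented_ops)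
  qed
  moreover have "generated_root_rep_axioms ?L X v (cartan_embedding X v)
    (\<lambda>x. half_baked_class X v (E x)) (\<lambda>x. half_baked_class X v (F x))"
  proof (rule generated_root_rep_axioms.intro)
    fix x i assume "x \<in> part ?L i"
    then have "homogeneous_generated ?L (\<lambda>i. half_baked_class X v ` {g \<in> ?G. ?p g = i}) i x"
      unfolding half_baked_def half_baked_class_def[abs_def] by (rule presented_generated)
    then show "homogeneous_generated ?L (root_generating_set X v (cartan_embedding X v)
      (\<lambda>x. half_baked_class X v (E x)) (\<lambda>x. half_baked_class X v (F x))) i x"
    proof (rule homogeneous_generated_trans)
      fix i s assume "s \<in> half_baked_class X v ` {g \<in> ?G. ?p g = i}"
      then obtain g where "g \<in> ?G" "?p g = i" "s = half_baked_class X v g" by blast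
      then have "s \<in> root_generating_set X v (cartan_embedding X v)
        (\<lambda>x. half_baked_class X v (E x)) (\<lambda>x. half_baked_class X v (F x)) i"
        by (cases g) (auto simp: root_generating_set_def cartan_embedding_eq)
      then show "homogeneous_generated ?L (root_generating_set X v (cartan_embedding X v)
        (\<lambda>x. half_baked_class X v (E x)) (\<lambda>x. half_baked_class X v (F x))) i s"
        by (rule hgen_base)
    qed
  qed
  ultimately show ?thesis
    using L.lie_super_axioms by (simp add: generated_root_rep_def root_rep_def)
qed

text \<open>In the Verma module \<open>h\<close> acts on the empty word by the highest weight, which
  can be chosen nonzero at \<open>h\<close>.\<close>

lemma cartan_embedding_zero:
  assumes X: "finite X" and v: "is_root_datum X v" and h: "h \<in> carrier (hspace v)"
    and zero: "cartan_embedding X v h = \<zero>\<^bsub>half_baked X v\<^esub>"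
  shows "h = \<zero>\<^bsub>hspace v\<^esub>"
proof (rule ccontr)
  assume nz: "h \<noteq> \<zero>\<^bsub>hspace v\<^esub>"
  interpret V: complex_vector_space "hspace v"
    using is_root_datumD(1)[OF v] by (simp add: complex_vector_space_iff)
  obtain lam where lam: "linear_functional (hspace v) lam" "lam h \<noteq> 0"
    using V.separating_functional[OF is_root_datumD(2)[OF v] h nz] unfolding linear_functional_def by metis
  interpret R: root_rep operator_superalgebra X v "\<lambda>h. homogeneous_operator 0 (verma_h v X lam h)"
    "\<lambda>x. homogeneous_operator (parity v x) (\<lambda>\<phi> u. verma_e v X lam x u \<phi>)"
    "\<lambda>x. homogeneous_operator (parity v x) (verma_f x)"
    by (rule verma_rep[OF X v lam(1)])
  have "lie_super (half_baked X v)" unfolding half_baked_def by (rule lie_super_presented)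
  then have "homogeneous_operator 0 (verma_h v X lam h) = \<zero>\<^bsub>operator_superalgebra\<^esub>"
    using R.half_baked_hom(2)[of "H h"] h super_hom_zero[OF R.half_baked_hom(1) _ R.lie_super_axioms] zero
    by (simp add: cartan_embedding_eq)
  \<comment> \<open>The constant function serves as a vector with nonzero coefficient at the empty
    word.\<close>
  then have "verma_h v X lam h (\<lambda>_. 1) [] = 0"
    by (simp add: homogeneous_operator_def operator_superalgebra_def)
  then show False using lam(2) by (simp add: verma_h_def verma_weight_def)
qed

lemma homogeneous_generated_image:
  assumes "homogeneous_generated L S i x" and q: "super_hom L M q" and L: "lie_super L" and M: "lie_super M"
    and S: "\<And>i. S i \<subseteq> part L i" and S': "\<And>i s. s \<in> S i \<Longrightarrow> q s \<in> S' i"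
  shows "homogeneous_generated M S' i (q x)"
proof -
  interpret L: lie_super L by (rule L)
  note q' = super_homD[OF q]
  have c: "y \<in> carrier L" if "homogeneous_generated L S j y" for j y
    using L.hgen_part[OF that S] L.part_carrier by blast
  show ?thesis
    using assms(1)
  proof induction
    case (hgen_base s i)
    show ?case using S'[OF hgen_base] by (rule homogeneous_generated.hgen_base)
  next
    case (hgen_zero i)
    show ?case
      unfolding super_hom_zero[OF q L M] by (rule homogeneous_generated.hgen_zero)
  next
    case (hgen_add i x y)
    show ?case
      unfolding q'(2)[OF c[OF hgen_add.hyps(1)] c[OF hgen_add.hyps(2)]]
      by (rule homogeneous_generated.hgen_add[OF hgen_add.IH])
  next
    case (hgen_scale i x k)
    show ?case
      unfolding q'(3)[OF c[OF hgen_scale.hyps]]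
      by (rule homogeneous_generated.hgen_scale[OF hgen_scale.IH])
  next
    case (hgen_bracket i x j y)
    show ?case
      unfolding q'(4)[OF c[OF hgen_bracket.hyps(1)] c[OF hgen_bracket.hyps(2)]]
      by (rule homogeneous_generated.hgen_bracket[OF hgen_bracket.IH])
  qed
qed

lemma (in root_rep) hom_image_rep:
  assumes q: "super_hom L M q" and M: "lie_super M"
  shows "root_rep M X v (\<lambda>h. q (\<iota> h)) (\<lambda>x. q (e x)) (\<lambda>x. q (f x))"
proof -
  note q' = super_homD[OF q]
  have zero: "q \<zero> = \<zero>\<^bsub>M\<^esub>" by (rule super_hom_zero[OF q lie_super_axioms M])
  have "root_rep_axioms M X v (\<lambda>h. q (\<iota> h)) (\<lambda>x. q (e x)) (\<lambda>x. q (f x))"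
    by (rule root_rep_axioms.intro)
      (simp_all add: space coroot_closed coweight_ex q'(5) cartan_part e_part f_part cartan_add
        cartan_scale q'(2,3) q'(4)[symmetric] bracket_cartan bracket_cartan_e bracket_cartan_f
        bracket_e_f bracket_e_f_same zero)
  then show ?thesis using M by (simp add: root_rep_def)
qed

lemma (in generated_root_rep) hom_image_generated:
  assumes q: "super_hom L M q" and M: "lie_super M" and surj: "\<And>i. part M i \<subseteq> q ` part L i"
  shows "generated_root_rep M X v (\<lambda>h. q (\<iota> h)) (\<lambda>x. q (e x)) (\<lambda>x. q (f x))"
proof -
  have "generated_root_rep_axioms M X v (\<lambda>h. q (\<iota> h)) (\<lambda>x. q (e x)) (\<lambda>x. q (f x))"
  proof (rule generated_root_rep_axioms.intro)
    fix x i assume "x \<in> part M i"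
    then obtain u where u: "u \<in> part L i" "x = q u" using surj by blast
    show "homogeneous_generated M
      (root_generating_set X v (\<lambda>h. q (\<iota> h)) (\<lambda>x. q (e x)) (\<lambda>x. q (f x))) i x"
      unfolding u(2)
      by (rule homogeneous_generated_image[OF generated[OF u(1)] q lie_super_axioms M generating_set_part])
        (auto simp: root_generating_set_def)
  qed
  then show ?thesis using hom_image_rep[OF q M] by (simp add: generated_root_rep_def)
qed

lemma first_isomorphism:
  assumes G: "lie_super G" and L: "lie_super L" and q: "super_hom G L q"
    and surj: "\<And>i. part L i \<subseteq> q ` part G i" and K: "superideal K G"
    and ker: "\<And>u. u \<in> carrier G \<Longrightarrow> q u = \<zero>\<^bsub>L\<^esub> \<longleftrightarrow> u \<in> K"
  shows "\<exists>\<Psi>. super_iso (super_quotient G K) L \<Psi> \<and> (\<forall>u\<in>carrier G. \<Psi> (K +>\<^bsub>G\<^esub> u) = q u)"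
proof -
  interpret G: lie_super G by (rule G)
  interpret L: lie_super L by (rule L)
  note q' = super_homD[OF q]
  define \<Psi> where "\<Psi> A = q (SOME u. u \<in> A)" for A
  have eq_iff: "q u = q w \<longleftrightarrow> K +>\<^bsub>G\<^esub> u = K +>\<^bsub>G\<^esub> w" if "u \<in> carrier G" "w \<in> carrier G" for u w
  proof -
    have "q (u \<oplus>\<^bsub>G\<^esub> (-1) \<odot>\<^bsub>G\<^esub> w) = q u \<oplus>\<^bsub>L\<^esub> (-1) \<odot>\<^bsub>L\<^esub> q w" using that by (simp add: q')
    moreover have "q u \<oplus>\<^bsub>L\<^esub> (-1) \<odot>\<^bsub>L\<^esub> q w = \<zero>\<^bsub>L\<^esub> \<longleftrightarrow> q u = q w"
      using L.add_eq_zero_imp[of "q u" "(-1) \<odot>\<^bsub>L\<^esub> q w"] L.add_scale_minus[of "q w"] q'(1) that by auto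
    ultimately show ?thesis
      using ker[of "u \<oplus>\<^bsub>G\<^esub> (-1) \<odot>\<^bsub>G\<^esub> w"] G.quotient_eq_iff[OF K that] that by simp
  qed
  have \<Psi>: "\<Psi> (K +>\<^bsub>G\<^esub> u) = q u" if u: "u \<in> carrier G" for u
  proof -
    have "(SOME w. w \<in> K +>\<^bsub>G\<^esub> u) \<in> K +>\<^bsub>G\<^esub> u" using G.quotient_self[OF K u] by (rule someI)
    from G.quotient_memD[OF K this u] show ?thesis using eq_iff u by (simp add: \<Psi>_def)
  qed
  note ops = G.quotient_ops[OF K]
  have carr: "carrier L \<subseteq> q ` carrier G"
  proof
    fix x assume "x \<in> carrier L"
    then obtain y z where "y \<in> part L 0" "z \<in> part L 1" "x = y \<oplus>\<^bsub>L\<^esub> z" using L.part_decomp by blast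
    moreover then obtain a b where "a \<in> part G 0" "b \<in> part G 1" "y = q a" "z = q b" using surj by blast
    ultimately have "x = q (a \<oplus>\<^bsub>G\<^esub> b)" "a \<oplus>\<^bsub>G\<^esub> b \<in> carrier G" using G.part_carrier by (simp_all add: q')
    then show "x \<in> q ` carrier G" by blast
  qed
  have "super_hom (super_quotient G K) L \<Psi>"
    unfolding super_hom_def ops(5,6)
    by (auto simp: ops \<Psi> q' G.part_carrier)
  moreover have "bij_betw \<Psi> (carrier (super_quotient G K)) (carrier L)"
    unfolding bij_betw_def ops(5)
  proof
    show "inj_on \<Psi> ((\<lambda>x. K +>\<^bsub>G\<^esub> x) ` carrier G)"
      by (rule inj_onI) (auto simp: \<Psi> eq_iff)
    have "\<Psi> ` (\<lambda>x. K +>\<^bsub>G\<^esub> x) ` carrier G = q ` carrier G"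
      unfolding image_image by (rule image_cong) (auto simp: \<Psi>)
    also have "\<dots> = carrier L" using carr q'(1) by blast
    finally show "\<Psi> ` (\<lambda>x. K +>\<^bsub>G\<^esub> x) ` carrier G = carrier L" .
  qed
  moreover have "part L i \<subseteq> \<Psi> ` part (super_quotient G K) i" for i
  proof -
    have "\<Psi> ` (\<lambda>x. K +>\<^bsub>G\<^esub> x) ` part G i = q ` part G i"
      unfolding image_image by (rule image_cong) (auto simp: \<Psi> G.part_carrier)
    then show ?thesis using surj by (simp add: ops(6))
  qed
  ultimately show ?thesis using super_isoI \<Psi> by blast
qed

section \<open>The contragredient quotient\<close>

text \<open>Minimality mentions the datum only through the image of its Cartan space. It is
  therefore inherited when the same algebra is read as a generated realization of another datum with
  the same Cartan image.\<close>

locale minimal_root_rep = generated_root_rep L X v \<iota> e f for L (structure)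
    and X :: "'x set" and v :: "('h, 'x) root_datum" and \<iota> and e f :: "'x \<Rightarrow> 'a" +
  assumes cartan_inj: "h \<in> carrier (hspace v) \<Longrightarrow> \<iota> h = \<zero> \<Longrightarrow> h = \<zero>\<^bsub>hspace v\<^esub>"
    and minimal: "superideal J L \<Longrightarrow> J \<inter> \<iota> ` carrier (hspace v) = {\<zero>} \<Longrightarrow> J = {\<zero>}"

definition contragredient_ideal ::
    "'x set \<Rightarrow> ('h, 'x) root_datum \<Rightarrow> ('h, 'x) root_generator lie_term set set"
  where "contragredient_ideal X v =
    maximal_ideal (half_baked X v) (cartan_embedding X v ` carrier (hspace v))"

abbreviation contragredient ::
    "'x set \<Rightarrow> ('h, 'x) root_datum \<Rightarrow> ('h, 'x) root_generator lie_term set set lie_superalgebra"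
  where "contragredient X v \<equiv> super_quotient (half_baked X v) (contragredient_ideal X v)"

lemma maximal_idealI: "superideal J L \<Longrightarrow> J \<inter> C = {\<zero>\<^bsub>L\<^esub>} \<Longrightarrow> J \<subseteq> maximal_ideal L C"
  by (auto simp: maximal_ideal_def)

lemma contragredient_ideal:
  assumes "finite X" "is_root_datum X v"
  shows "superideal (contragredient_ideal X v) (half_baked X v)"
    and "contragredient_ideal X v \<inter> cartan_embedding X v ` carrier (hspace v) = {\<zero>\<^bsub>half_baked X v\<^esub>}"
  using generated_root_rep.maximal_ideal[OF half_baked_rep[OF assms]]
  by (simp_all add: contragredient_ideal_def)

text \<open>If an ideal of the quotient meets the Cartan subalgebra trivially, then so does its
  preimage in the half-baked algebra, which therefore lies in the maximal ideal.\<close>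

lemma contragredient_rep:
  assumes X: "finite X" and v: "is_root_datum X v"
  defines "q \<equiv> \<lambda>u. contragredient_ideal X v +>\<^bsub>half_baked X v\<^esub> u"
  shows "minimal_root_rep (contragredient X v) X v (\<lambda>h. q (cartan_embedding X v h))
    (\<lambda>x. q (half_baked_class X v (E x))) (\<lambda>x. q (half_baked_class X v (F x)))"
proof -
  let ?I = "contragredient_ideal X v" and ?G = "half_baked X v" and ?H = "cartan_embedding X v ` carrier (hspace v)"
  interpret G: generated_root_rep ?G X v "cartan_embedding X v"
    "\<lambda>x. half_baked_class X v (E x)" "\<lambda>x. half_baked_class X v (F x)"
    by (rule half_baked_rep[OF X v])
  note I = contragredient_ideal[OF X v]
  have Q: "lie_super (contragredient X v)" by (rule G.lie_super_quotient[OF I(1)])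
  have q: "super_hom ?G (contragredient X v) q"
    unfolding q_def by (rule G.super_hom_quotient[OF I(1)])
  note q' = super_homD[OF q] and ops = G.quotient_ops[OF I(1)]
  have zero_iff: "q u = \<zero>\<^bsub>contragredient X v\<^esub> \<longleftrightarrow> u \<in> ?I" if "u \<in> carrier ?G" for u
    using G.quotient_zero_iff[OF I(1) that] G.quotient_zero_iff[OF I(1) G.zero_closed]
      G.superideal_submodule(2)[OF I(1)]
    by (simp add: q_def ops(1))
  interpret Q: generated_root_rep "contragredient X v" X v "\<lambda>h. q (cartan_embedding X v h)"
    "\<lambda>x. q (half_baked_class X v (E x))" "\<lambda>x. q (half_baked_class X v (F x))"
    by (rule G.hom_image_generated[OF q Q]) (simp add: ops(6) q_def)
  have inj: "cartan_embedding X v h = \<zero>\<^bsub>?G\<^esub>"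
    if "h \<in> carrier (hspace v)" "q (cartan_embedding X v h) = \<zero>\<^bsub>contragredient X v\<^esub>" for h
    using that zero_iff I(2) by auto
  show ?thesis
  proof (rule minimal_root_rep.intro[OF Q.generated_root_rep_axioms], rule minimal_root_rep_axioms.intro)
    show "h = \<zero>\<^bsub>hspace v\<^esub>"
      if "h \<in> carrier (hspace v)" "q (cartan_embedding X v h) = \<zero>\<^bsub>contragredient X v\<^esub>" for h
      using cartan_embedding_zero[OF X v that(1) inj[OF that]] .
    fix J assume J: "superideal J (contragredient X v)"
      "J \<inter> (\<lambda>h. q (cartan_embedding X v h)) ` carrier (hspace v) = {\<zero>\<^bsub>contragredient X v\<^esub>}"
    note J' = Q.superideal_submodule[OF J(1)]
    let ?J = "{u \<in> carrier ?G. q u \<in> J}"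
    have qz: "q \<zero>\<^bsub>?G\<^esub> = \<zero>\<^bsub>contragredient X v\<^esub>"
      using zero_iff[OF G.zero_closed] G.superideal_submodule(2)[OF I(1)] by simp
    have sub: "submodule ?J complex_field ?G"
      unfolding G.submodule_iff using J' qz by (auto simp: q')
    have st: "bracket ?G u w \<in> ?J" if "u \<in> carrier ?G" "w \<in> ?J" for u w
      using that J(1) q' by (auto simp: superideal_def)
    have "superideal ?J ?G"
      by (rule G.superidealI[OF sub]) (erule st[rotated], simp)+
    moreover have "?J \<inter> ?H = {\<zero>\<^bsub>?G\<^esub>}"
    proof -
      have "u = \<zero>\<^bsub>?G\<^esub>" if u: "u \<in> ?J" "u \<in> ?H" for u
      proof -
        obtain h where h: "h \<in> carrier (hspace v)" "u = cartan_embedding X v h" using u(2) by blast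
        have "q (cartan_embedding X v h) \<in> J" using u(1) h(2) by simp
        then have "q (cartan_embedding X v h) = \<zero>\<^bsub>contragredient X v\<^esub>" using J(2) h(1) by blast
        then show ?thesis using inj[OF h(1)] h(2) by simp
      qed
      moreover have "\<zero>\<^bsub>?G\<^esub> \<in> ?J" using J'(2) qz by simp
      ultimately show ?thesis using G.zero_in_cartan by blast
    qed
    ultimately have "?J \<subseteq> ?I"
      unfolding contragredient_ideal_def by (rule maximal_idealI)
    then have "J \<subseteq> {\<zero>\<^bsub>contragredient X v\<^esub>}"
    proof (intro subsetI)
      fix A assume A: "A \<in> J"
      then obtain u where u: "u \<in> carrier ?G" "A = q u" using J'(1) ops(5) by (auto simp: q_def)
      then have "u \<in> ?I" using \<open>?J \<subseteq> ?I\<close> A by blast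
      then show "A \<in> {\<zero>\<^bsub>contragredient X v\<^esub>}" using zero_iff[OF u(1)] u(2) by simp
    qed
    then show "J = {\<zero>\<^bsub>contragredient X v\<^esub>}" using J'(2) by blast
  qed
qed

text \<open>Uniqueness of the contragredient algebra. The kernel of the evaluation meets the Cartan
  subalgebra trivially because the Cartan map of \<open>L\<close> is injective, so it lies in the
  maximal ideal. The image of the maximal ideal is an ideal of \<open>L\<close> that meets the
  Cartan image trivially, so it is zero. Hence kernel and maximal ideal agree.\<close>

lemma (in minimal_root_rep) contragredient_iso:
  assumes X: "finite X" and v: "is_root_datum X v"
  shows "\<exists>\<Psi>. super_iso (contragredient X v) L \<Psi> \<and> (\<forall>h\<in>carrier (hspace v).
    \<Psi> (contragredient_ideal X v +>\<^bsub>half_baked X v\<^esub> cartan_embedding X v h) = \<iota> h)"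
proof -
  let ?I = "contragredient_ideal X v" and ?G = "half_baked X v" and ?H = "cartan_embedding X v ` carrier (hspace v)"
  define ev where "ev = eval_class L (generator_value \<iota> e f)"
  interpret G: generated_root_rep ?G X v "cartan_embedding X v"
    "\<lambda>x. half_baked_class X v (E x)" "\<lambda>x. half_baked_class X v (F x)"
    by (rule half_baked_rep[OF X v])
  note I = contragredient_ideal[OF X v]
  have ev: "super_hom ?G L ev" unfolding ev_def by (rule half_baked_hom)
  note ev' = super_homD[OF ev]
  have ev_gen: "h \<in> carrier (hspace v) \<Longrightarrow> ev (cartan_embedding X v h) = \<iota> h"
    "x \<in> X \<Longrightarrow> ev (half_baked_class X v (E x)) = e x"
    "x \<in> X \<Longrightarrow> ev (half_baked_class X v (F x)) = f x" for h x
    using half_baked_hom(2)[of "H h"] half_baked_hom(2)[of "E x"] half_baked_hom(2)[of "F x"]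
    by (simp_all add: ev_def cartan_embedding_eq)
  have ev0: "ev \<zero>\<^bsub>?G\<^esub> = \<zero>" by (rule super_hom_zero[OF ev G.lie_super_axioms lie_super_axioms])
  have surj: "part L i \<subseteq> ev ` part ?G i" for i
  proof
    fix x assume "x \<in> part L i"
    then have "homogeneous_generated L (root_generating_set X v \<iota> e f) i x" by (rule generated)
    then show "x \<in> ev ` part ?G i"
    proof induction
      case (hgen_base s i)
      then consider h where "h \<in> carrier (hspace v)" "s = \<iota> h" "i = 0"
        | x where "x \<in> X" "s = e x" "i = parity v x" | x where "x \<in> X" "s = f x" "i = parity v x"
        unfolding root_generating_set_def by blast
      then show ?case
      proof cases
        case 1
        then show ?thesis using ev_gen(1) G.cartan_part by force
      next
        case 2
        then show ?thesis using ev_gen(2) G.e_part by force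
      next
        case 3
        then show ?thesis using ev_gen(3) G.f_part by force
      qed
    next
      case (hgen_zero i)
      then show ?case using ev0 G.part_zero by (metis imageI)
    next
      case (hgen_add i x y)
      then obtain a b where "a \<in> part ?G i" "b \<in> part ?G i" "x = ev a" "y = ev b" by blast
      then have "x \<oplus> y = ev (a \<oplus>\<^bsub>?G\<^esub> b)" "a \<oplus>\<^bsub>?G\<^esub> b \<in> part ?G i"
        using G.part_carrier G.part_add by (simp_all add: ev')
      then show ?case by blast
    next
      case (hgen_scale i x c)
      then obtain a where "a \<in> part ?G i" "x = ev a" by blast
      then have "c \<odot> x = ev (c \<odot>\<^bsub>?G\<^esub> a)" "c \<odot>\<^bsub>?G\<^esub> a \<in> part ?G i"
        using G.part_carrier G.part_scale by (simp_all add: ev')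
      then show ?case by blast
    next
      case (hgen_bracket i x j y)
      then obtain a b where a: "a \<in> part ?G i" "b \<in> part ?G j" "x = ev a" "y = ev b" by blast
      then have "bracket L x y = ev (bracket ?G a b)" using G.part_carrier by (simp add: ev')
      then show ?case using G.part_bracket[OF a(1,2)] by blast
    qed
  qed
  let ?K = "{u \<in> carrier ?G. ev u = \<zero>}"
  have subK: "submodule ?K complex_field ?G"
    unfolding G.submodule_iff using ev0 by (auto simp: ev')
  have stK: "bracket ?G u w \<in> ?K" if "u \<in> carrier ?G" "w \<in> ?K" for u w
    using that ev' by auto
  have K: "superideal ?K ?G"
    by (rule G.superidealI[OF subK]) (erule stK[rotated], simp)+
  have "?K \<inter> ?H = {\<zero>\<^bsub>?G\<^esub>}"
  proof -
    have "u = \<zero>\<^bsub>?G\<^esub>" if u: "u \<in> ?K" "u \<in> ?H" for u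
    proof -
      obtain h where h: "h \<in> carrier (hspace v)" "u = cartan_embedding X v h" using u(2) by blast
      then have "h = \<zero>\<^bsub>hspace v\<^esub>" using u(1) ev_gen(1) cartan_inj by auto
      then show ?thesis using h(2) G.cartan_zero by simp
    qed
    moreover have "\<zero>\<^bsub>?G\<^esub> \<in> ?K" using ev0 by simp
    ultimately show ?thesis using G.zero_in_cartan by blast
  qed
  then have KI: "?K \<subseteq> ?I"
    unfolding contragredient_ideal_def by (rule maximal_idealI[OF K])
  note I' = G.superideal_submodule[OF I(1)]
  have subJ: "submodule (ev ` ?I) complex_field L"
    unfolding submodule_iff
  proof (intro conjI ballI allI)
    show "ev ` ?I \<subseteq> carrier L" using I'(1) ev'(1) by blast
    show "\<zero> \<in> ev ` ?I" using I'(2) ev0 by (metis imageI)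
    fix x assume "x \<in> ev ` ?I"
    then obtain a where a: "a \<in> ?I" "x = ev a" by blast
    have ac: "a \<in> carrier ?G" using a(1) I'(1) by blast
    show "c \<odot> x \<in> ev ` ?I" for c
      using ev'(3)[OF ac, of c] I'(4)[OF a(1), of c] a(2) by (metis imageI)
    fix y assume "y \<in> ev ` ?I"
    then obtain b where b: "b \<in> ?I" "y = ev b" by blast
    have bc: "b \<in> carrier ?G" using b(1) I'(1) by blast
    show "x \<oplus> y \<in> ev ` ?I"
      using ev'(2)[OF ac bc] I'(3)[OF a(1) b(1)] a(2) b(2) by (metis imageI)
  qed
  have stJ: "bracket L (ev u) w \<in> ev ` ?I" if u: "u \<in> carrier ?G" and w: "w \<in> ev ` ?I" for u w
  proof -
    obtain a where a: "a \<in> ?I" "w = ev a" using w by blast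
    have "bracket L (ev u) w = ev (bracket ?G u a)" using a I'(1) u ev'(4) by auto
    moreover have "bracket ?G u a \<in> ?I" using I(1) a(1) u by (auto simp: superideal_def)
    ultimately show ?thesis by blast
  qed
  have "superideal (ev ` ?I) L"
  proof (rule superidealI[OF subJ])
    show "bracket L (\<iota> h) w \<in> ev ` ?I" if "h \<in> carrier (hspace v)" "w \<in> ev ` ?I" for h w
      using stJ[OF G.cartan_closed[OF that(1)] that(2)] ev_gen(1)[OF that(1)] by simp
    show "bracket L (e x) w \<in> ev ` ?I" if "x \<in> X" "w \<in> ev ` ?I" for x w
      using stJ[OF G.e_closed[OF that(1)] that(2)] ev_gen(2)[OF that(1)] by simp
    show "bracket L (f x) w \<in> ev ` ?I" if "x \<in> X" "w \<in> ev ` ?I" for x w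
      using stJ[OF G.f_closed[OF that(1)] that(2)] ev_gen(3)[OF that(1)] by simp
  qed
  moreover have "ev ` ?I \<inter> \<iota> ` carrier (hspace v) = {\<zero>}"
  proof -
    have "u = \<zero>" if u: "u \<in> ev ` ?I" "u \<in> \<iota> ` carrier (hspace v)" for u
    proof -
      obtain a where a: "a \<in> ?I" "u = ev a" using u(1) by blast
      obtain h where h: "h \<in> carrier (hspace v)" "u = \<iota> h" using u(2) by blast
      have ac: "a \<in> carrier ?G" and hc: "cartan_embedding X v h \<in> carrier ?G"
        using a(1) I'(1) G.cartan_closed[OF h(1)] by auto
      \<comment> \<open>If the image of \<open>a\<close> is a Cartan element, then \<open>a\<close>
        differs from the Cartan element \<open>h\<close> upstairs by an element of the kernel, which
        lies in the maximal ideal; so \<open>h\<close> lies in the maximal ideal as well.\<close>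
      have "ev (cartan_embedding X v h \<oplus>\<^bsub>?G\<^esub> (-1) \<odot>\<^bsub>?G\<^esub> a) = \<iota> h \<oplus> (-1) \<odot> \<iota> h"
        using ac hc a(2) h ev_gen(1)[OF h(1)] by (simp add: ev')
      then have "cartan_embedding X v h \<oplus>\<^bsub>?G\<^esub> (-1) \<odot>\<^bsub>?G\<^esub> a \<in> ?I"
        using KI ac hc h(1) by (auto simp: add_scale_minus)
      from I'(3)[OF this a(1)] have "cartan_embedding X v h \<in> ?I"
        using ac hc G.add_scale_minus[OF ac] G.a_comm[of "(-1) \<odot>\<^bsub>?G\<^esub> a" a]
        by (simp add: G.a_assoc)
      then have "cartan_embedding X v h = \<zero>\<^bsub>?G\<^esub>" using I(2) h(1) by blast
      then show ?thesis using ev_gen(1)[OF h(1)] ev0 h(2) by simp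
    qed
    moreover have "\<zero> \<in> ev ` ?I" using I'(2) ev0 by (metis imageI)
    ultimately show ?thesis using zero_in_cartan by blast
  qed
  ultimately have "ev ` ?I = {\<zero>}" by (rule minimal)
  then have ker: "ev u = \<zero> \<longleftrightarrow> u \<in> ?I" if "u \<in> carrier ?G" for u using KI that by blast
  obtain \<Psi> where \<Psi>: "super_iso (contragredient X v) L \<Psi>"
    "\<forall>u\<in>carrier ?G. \<Psi> (?I +>\<^bsub>?G\<^esub> u) = ev u"
    using first_isomorphism[OF G.lie_super_axioms lie_super_axioms ev surj I(1) ker] by blast
  then show ?thesis using ev_gen(1) G.cartan_closed by (intro exI[of _ \<Psi>]) simp
qed

section \<open>Root strings and Serre relations\<close>

primrec root_string :: "'a lie_superalgebra \<Rightarrow> 'a \<Rightarrow> 'a \<Rightarrow> nat \<Rightarrow> 'a"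
  where
  "root_string L a u 0 = u"
| "root_string L a u (Suc n) = bracket L a (root_string L a u n)"

primrec string_parity :: "('h, 'x) root_datum \<Rightarrow> 'x \<Rightarrow> 'x \<Rightarrow> nat \<Rightarrow> bit"
  where
  "string_parity v x y 0 = parity v y"
| "string_parity v x y (Suc n) = parity v x + string_parity v x y n"

text \<open>The scalars by which \<open>e\<^sub>x\<close> lowers the string \<open>(ad f\<^sub>x)\<^sup>n f\<^sub>y\<close>.\<close>

primrec string_coeff :: "('h, 'x) root_datum \<Rightarrow> 'x \<Rightarrow> 'x \<Rightarrow> nat \<Rightarrow> complex"
  where
  "string_coeff v x y 0 = 0"
| "string_coeff v x y (Suc n) = koszul_sign (parity v x) (parity v x) * string_coeff v x y n -
    (cartan v x y + of_nat n * cartan v x x)"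

text \<open>The factor in \<open>[E_n, F_n]\<close>: each step splits one \<open>e x\<close> off the
  first string and lets it lower the second, which contributes a Koszul sign and a string
  coefficient. Its inverse will normalize the new \<open>f\<close>.\<close>

primrec string_norm :: "('h, 'x) root_datum \<Rightarrow> 'x \<Rightarrow> 'x \<Rightarrow> nat \<Rightarrow> complex"
  where
  "string_norm v x y 0 = 1"
| "string_norm v x y (Suc n) =
    - (koszul_sign (parity v x) (string_parity v x y n) * string_coeff v x y (Suc n)) * string_norm v x y n"

text \<open>The numerical condition on \<open>m\<close> makes \<open>(ad e\<^sub>x)\<^sup>m\<^sup>+\<^sup>1 e\<^sub>y\<close> vanish.\<close>

definition serre_exponent :: "('h, 'x) root_datum \<Rightarrow> 'x \<Rightarrow> 'x \<Rightarrow> nat \<Rightarrow> bool"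
  where "serre_exponent v x y m \<longleftrightarrow> string_coeff v x y (Suc m) = 0 \<and>
    (m = 0 \<and> cartan v y x = 0 \<or> m \<ge> 1 \<and> (parity v x = 0 \<or> cartan v x x = 0) \<or> m \<ge> 2)"

lemma bit_add_self_cancel: "(p :: bit) + (p + q) = q"
  by (cases p; cases q) simp_all

lemma (in lie_super) root_string_closed [simp]:
  "a \<in> carrier L \<Longrightarrow> u \<in> carrier L \<Longrightarrow> root_string L a u n \<in> carrier L"
  by (induction n) auto

context root_rep
begin

abbreviation (input) "\<epsilon> x \<equiv> koszul_sign (parity v x) (parity v x)"

abbreviation (input) "eE x y n \<equiv> root_string L (e x) (e y) n"
abbreviation (input) "fF x y n \<equiv> root_string L (f x) (f y) n"

lemma e_string_part: "x \<in> X \<Longrightarrow> y \<in> X \<Longrightarrow> eE x y n \<in> part L (string_parity v x y n)"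
proof (induction n)
  case (Suc n)
  then show ?case unfolding root_string.simps string_parity.simps by (intro part_bracket e_part)
qed (simp add: e_part)

lemma f_string_part: "x \<in> X \<Longrightarrow> y \<in> X \<Longrightarrow> fF x y n \<in> part L (string_parity v x y n)"
proof (induction n)
  case (Suc n)
  then show ?case unfolding root_string.simps string_parity.simps by (intro part_bracket f_part)
qed (simp add: f_part)

lemma e_string_weight:
  assumes "x \<in> X" "y \<in> X" "h \<in> carrier (hspace v)"
  shows "bracket L (\<iota> h) (eE x y n) = (simple_root v y h + of_nat n * simple_root v x h) \<odot> eE x y n"
proof (induction n)
  case 0
  then show ?case using assms by (simp add: bracket_cartan_e)
next
  case (Suc n)
  have c: "eE x y n \<in> carrier L" using assms by simp
  show ?case
    using bracket_jacobi[OF cartan_part[OF assms(3)] e_part[OF assms(1)] c] Suc assms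
    by (simp add: bracket_cartan_e bracket_scale_left bracket_scale_right scale_add_left[symmetric] algebra_simps)
qed

lemma f_string_weight:
  assumes "x \<in> X" "y \<in> X" "h \<in> carrier (hspace v)"
  shows "bracket L (\<iota> h) (fF x y n) = (- (simple_root v y h + of_nat n * simple_root v x h)) \<odot> fF x y n"
proof (induction n)
  case 0
  then show ?case using assms by (simp add: bracket_cartan_f)
next
  case (Suc n)
  have c: "fF x y n \<in> carrier L" using assms by simp
  show ?case
    using bracket_jacobi[OF cartan_part[OF assms(3)] f_part[OF assms(1)] c] Suc assms
    by (simp add: bracket_cartan_f bracket_scale_left bracket_scale_right scale_add_left[symmetric] algebra_simps)
qed

context
  fixes x y
  assumes x: "x \<in> X" and y: "y \<in> X" and yx: "y \<noteq> x"
begin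

lemma e_f_string_0: "bracket L (e x) (fF x y 0) = \<zero>"
  using x y yx by (simp add: bracket_e_f)

text \<open>The Jacobi identity \<open>[e, [f, F]] = [a(x), F] + \<epsilon> [f, [e, F]]\<close> is
  the recursion of \<open>string_coeff\<close>. For odd \<open>x\<close> the sign \<epsilon> is -1,
  which makes the contributions alternate.\<close>

lemma e_f_string: "bracket L (e x) (fF x y (Suc n)) = string_coeff v x y (Suc n) \<odot> fF x y n"
proof (induction n)
  case 0
  have "bracket L (e x) (bracket L (f x) (f y)) = bracket L (\<iota> (coroot v x)) (f y)"
    using bracket_jacobi[OF e_part[OF x] f_part[OF x] f_closed[OF y]] x y yx
    by (simp add: bracket_e_f bracket_e_f_same coroot_closed)
  then show ?case using x y by (simp add: bracket_cartan_f coroot_closed cartan_def)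
next
  case (Suc n)
  let ?F = "fF x y (Suc n)"
  have c: "?F \<in> carrier L" "fF x y n \<in> carrier L" using x y by simp_all
  have "bracket L (e x) (fF x y (Suc (Suc n))) =
    bracket L (bracket L (e x) (f x)) ?F \<oplus> \<epsilon> x \<odot> bracket L (f x) (bracket L (e x) ?F)"
    unfolding root_string.simps(2)[of L "f x" "f y" "Suc n"] by (rule bracket_jacobi[OF e_part[OF x] f_part[OF x] c(1)])
  also have "bracket L (bracket L (e x) (f x)) ?F =
      (- (cartan v x y + of_nat (Suc n) * cartan v x x)) \<odot> ?F"
    using f_string_weight[OF x y coroot_closed[OF x], of "Suc n"] x by (simp only: bracket_e_f_same cartan_def)
  also have "\<epsilon> x \<odot> bracket L (f x) (bracket L (e x) ?F) = (\<epsilon> x * string_coeff v x y (Suc n)) \<odot> ?F"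
    unfolding Suc using c x y by (simp add: bracket_scale_right)
  finally show ?case
    using c(1) by (simp only: scale_add_left[symmetric] string_coeff.simps(2)[of v x y "Suc n"])
      (simp only: add.commute diff_conv_add_uminus)
qed

text \<open>The coefficients are those of the other string up to the sign \<epsilon>, so both
  strings break off at the same place.\<close>

lemma f_e_string: "bracket L (f x) (eE x y (Suc n)) = (\<epsilon> x * string_coeff v x y (Suc n)) \<odot> eE x y n"
proof (induction n)
  case 0
  have "bracket L (f x) (bracket L (e x) (e y)) = (- \<epsilon> x) \<odot> bracket L (\<iota> (coroot v x)) (e y)"
    using bracket_jacobi[OF f_part[OF x] e_part[OF x] e_closed[OF y]] x y yx
    by (simp add: bracket_f_e bracket_f_e_same coroot_closed bracket_scale_left)
  then show ?case using x y by (simp add: bracket_cartan_e coroot_closed cartan_def)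
next
  case (Suc n)
  have gen: "- a * b + a * (a * c) = a * (a * c - b)" for a b c :: complex
    by (simp add: algebra_simps)
  let ?E = "eE x y (Suc n)"
  have c: "?E \<in> carrier L" "eE x y n \<in> carrier L" using x y by simp_all
  have "bracket L (f x) (eE x y (Suc (Suc n))) =
    bracket L (bracket L (f x) (e x)) ?E \<oplus> \<epsilon> x \<odot> bracket L (e x) (bracket L (f x) ?E)"
    unfolding root_string.simps(2)[of L "e x" "e y" "Suc n"] by (rule bracket_jacobi[OF f_part[OF x] e_part[OF x] c(1)])
  also have "bracket L (bracket L (f x) (e x)) ?E =
      (- \<epsilon> x * (cartan v x y + of_nat (Suc n) * cartan v x x)) \<odot> ?E"
    using e_string_weight[OF x y coroot_closed[OF x], of "Suc n"] x c(1) coroot_closed[OF x]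
    by (simp only: bracket_f_e_same cartan_def bracket_scale_left cartan_closed scale_scale)
  also have "\<epsilon> x \<odot> bracket L (e x) (bracket L (f x) ?E) = (\<epsilon> x * (\<epsilon> x * string_coeff v x y (Suc n))) \<odot> ?E"
    unfolding Suc using c x y by (simp add: bracket_scale_right)
  finally show ?case
    using c(1) gen by (simp only: scale_add_left[symmetric] string_coeff.simps(2)[of v x y "Suc n"])
qed

text \<open>The formulas for \<open>[E\<^sub>n, F\<^sub>n]\<close> and \<open>[E\<^sub>n, F\<^sub>n\<^sub>+\<^sub>1]\<close> are proved by a simultaneous induction,
  each step expressing one bracket through the other.\<close>

lemma e_string_f_string:
  assumes nz: "cartan v x y \<noteq> 0"
  defines "\<rho> \<equiv> cartan v y x / cartan v x y"
  shows "bracket L (eE x y n) (fF x y n) =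
      string_norm v x y n \<odot> (\<iota> (coroot v y) \<oplus> (of_nat n * \<rho>) \<odot> \<iota> (coroot v x)) \<and>
    bracket L (eE x y n) (fF x y (Suc n)) = (string_norm v x y (Suc n) * \<rho>) \<odot> f x"
proof (induction n)
  case 0
  have "bracket L (e y) (bracket L (f x) (f y)) =
    koszul_sign (parity v y) (parity v x) \<odot> bracket L (f x) (\<iota> (coroot v y))"
    using bracket_jacobi[OF e_part[OF y] f_part[OF x] f_closed[OF y]] x y yx
    by (simp add: bracket_e_f bracket_e_f_same coroot_closed)
  also have "\<dots> = (koszul_sign (parity v x) (parity v y) * cartan v y x) \<odot> f x"
    using x y coroot_closed by (simp add: bracket_f_cartan cartan_def koszul_sign_commute)
  also have "koszul_sign (parity v x) (parity v y) * cartan v y x = string_norm v x y (Suc 0) * \<rho>"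
    using nz by (simp add: \<rho>_def)
  finally show ?case using x y coroot_closed by (simp add: bracket_e_f_same)
next
  case (Suc n)
  let ?k = "koszul_sign (parity v x) (string_parity v x y n)" and ?k' = "koszul_sign (parity v x) (string_parity v x y (Suc n))"
  let ?ax = "\<iota> (coroot v x)" and ?ay = "\<iota> (coroot v y)"
  have a: "?ax \<in> carrier L" "?ay \<in> carrier L" using x y coroot_closed by simp_all
  have c: "eE x y n \<in> carrier L" "eE x y (Suc n) \<in> carrier L" "fF x y n \<in> carrier L" "fF x y (Suc n) \<in> carrier L"
    "f x \<in> carrier L" "e x \<in> carrier L"
    using x y by simp_all
  \<comment> \<open>Split \<open>E_(n+1) = [e x, E_n]\<close>: one term uses the second formula at
    \<open>n\<close>, the other lowers \<open>F_(n+1)\<close> to \<open>F_n\<close> and uses the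
    first.\<close>
  have D: "bracket L (eE x y (Suc n)) (fF x y (Suc n)) =
    string_norm v x y (Suc n) \<odot> (?ay \<oplus> (of_nat (Suc n) * \<rho>) \<odot> ?ax)"
  proof -
    have "bracket L (eE x y (Suc n)) (fF x y (Suc n)) =
      bracket L (e x) (bracket L (eE x y n) (fF x y (Suc n))) \<oplus>
      (- ?k) \<odot> bracket L (eE x y n) (bracket L (e x) (fF x y (Suc n)))"
      unfolding root_string.simps(2)[of L "e x" "e y" n]
      by (rule bracket_jacobi_left[OF e_part[OF x] e_string_part[OF x y] c(4)])
    also have "bracket L (e x) (bracket L (eE x y n) (fF x y (Suc n))) = (string_norm v x y (Suc n) * \<rho>) \<odot> ?ax"
      using Suc c x by (simp only: bracket_scale_right bracket_e_f_same)
    also have "(- ?k) \<odot> bracket L (eE x y n) (bracket L (e x) (fF x y (Suc n))) =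
      string_norm v x y (Suc n) \<odot> (?ay \<oplus> (of_nat n * \<rho>) \<odot> ?ax)"
      unfolding e_f_string using Suc c a
      by (simp only: bracket_scale_right scale_scale a_closed scale_closed bracket_closed string_norm.simps)
        (simp add: mult.assoc)
    also have "(string_norm v x y (Suc n) * \<rho>) \<odot> ?ax \<oplus> string_norm v x y (Suc n) \<odot> (?ay \<oplus> (of_nat n * \<rho>) \<odot> ?ax) =
      string_norm v x y (Suc n) \<odot> (?ay \<oplus> (\<rho> \<odot> ?ax \<oplus> (of_nat n * \<rho>) \<odot> ?ax))"
      using a by (simp add: scale_add_right a_ac del: string_norm.simps)
    also have "\<rho> \<odot> ?ax \<oplus> (of_nat n * \<rho>) \<odot> ?ax = (of_nat (Suc n) * \<rho>) \<odot> ?ax"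
      using a by (simp add: scale_add_left[symmetric] algebra_simps)
    finally show ?thesis .
  qed
  \<comment> \<open>Split \<open>F_(n+2) = [f x, F_(n+1)]\<close>: one term lowers
    \<open>E_(n+1)\<close> and uses the second formula at \<open>n\<close>, the other uses
    \<open>D\<close>.\<close>
  have "bracket L (eE x y (Suc n)) (fF x y (Suc (Suc n))) =
    bracket L (bracket L (eE x y (Suc n)) (f x)) (fF x y (Suc n)) \<oplus>
    ?k' \<odot> bracket L (f x) (bracket L (eE x y (Suc n)) (fF x y (Suc n)))"
    unfolding root_string.simps(2)[of L "f x" "f y" "Suc n"]
      koszul_sign_commute[of "parity v x" "string_parity v x y (Suc n)"]
    by (rule bracket_jacobi[OF e_string_part[OF x y] f_part[OF x] c(4)])
  also have "bracket L (eE x y (Suc n)) (f x) = (- ?k' * (\<epsilon> x * string_coeff v x y (Suc n))) \<odot> eE x y n"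
    using bracket_skew[OF e_string_part[OF x y, of "Suc n"] f_part[OF x]] f_e_string c
    by (simp only: koszul_sign_commute[of "string_parity v x y (Suc n)"] scale_scale)
  also have "bracket L ((- ?k' * (\<epsilon> x * string_coeff v x y (Suc n))) \<odot> eE x y n) (fF x y (Suc n)) =
    (- ?k' * (\<epsilon> x * string_coeff v x y (Suc n)) * (string_norm v x y (Suc n) * \<rho>)) \<odot> f x"
    using Suc c by (simp only: bracket_scale_left scale_scale)
  also have "?k' \<odot> bracket L (f x) (bracket L (eE x y (Suc n)) (fF x y (Suc n))) =
    (?k' * (string_norm v x y (Suc n) * (cartan v y x + of_nat (Suc n) * \<rho> * cartan v x x))) \<odot> f x"
  proof -
    have "bracket L (f x) (?ay \<oplus> (of_nat (Suc n) * \<rho>) \<odot> ?ax) =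
      (cartan v y x + of_nat (Suc n) * \<rho> * cartan v x x) \<odot> f x"
      using x y a c coroot_closed
      by (simp only: bracket_add_right bracket_scale_right scale_closed bracket_f_cartan cartan_def
          scale_scale scale_add_left)
    then show ?thesis unfolding D using a c
      by (simp only: bracket_scale_right a_closed scale_closed scale_scale)
  qed
  also have "(- ?k' * (\<epsilon> x * string_coeff v x y (Suc n)) * (string_norm v x y (Suc n) * \<rho>)) \<odot> f x \<oplus>
    (?k' * (string_norm v x y (Suc n) * (cartan v y x + of_nat (Suc n) * \<rho> * cartan v x x))) \<odot> f x =
    (string_norm v x y (Suc (Suc n)) * \<rho>) \<odot> f x"
  proof -
    have gen: "- k * (a * c) * (N * r) + k * (N * (r * A + n * r * B)) = - (k * (a * c - (A + n * B))) * N * r"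
      for k a c N r A n B :: complex by (simp add: algebra_simps)
    \<comment> \<open>Writing \<open>a_yx\<close> as \<open>\<rho> a_xy\<close> makes both terms
      multiples of \<rho>; what remains is the recursion of \<open>string_coeff\<close>.\<close>
    have yx: "cartan v y x = \<rho> * cartan v x y" using nz by (simp add: \<rho>_def)
    have "- ?k' * (\<epsilon> x * string_coeff v x y (Suc n)) * (string_norm v x y (Suc n) * \<rho>) +
      ?k' * (string_norm v x y (Suc n) * (cartan v y x + of_nat (Suc n) * \<rho> * cartan v x x)) =
      string_norm v x y (Suc (Suc n)) * \<rho>"
      unfolding yx string_norm.simps(2)[of v x y "Suc n"] string_coeff.simps(2)[of v x y "Suc n"]
      by (rule gen)
    then show ?thesis using c(5) by (simp only: scale_add_left[symmetric])
  qed
  finally show ?case using D by blast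
qed

end

text \<open>Splitting \<open>e x\<close> off the first string either leaves a shorter one or moves
  along the second, so everything reduces to \<open>[e y, f z] = 0\<close> and
  \<open>[e y, f x] = 0\<close>. The length of the second string has to be arbitrary in the
  induction.\<close>

lemma e_string_f_string_distinct:
  assumes "x \<in> X" "y \<in> X" "z \<in> X" "y \<noteq> x" "z \<noteq> x" "y \<noteq> z"
  shows "bracket L (eE x y n) (fF x z k) = \<zero>"
proof (induction n arbitrary: k)
  case 0
  show ?case
  proof (induction k)
    case 0
    then show ?case using assms by (simp add: bracket_e_f)
  next
    case (Suc k)
    have "fF x z k \<in> carrier L" using assms by simp
    from bracket_jacobi[OF e_part[OF assms(2)] f_part[OF assms(1)] this] show ?case
      using Suc assms by (simp add: bracket_e_f)
  qed
next
  case (Suc n)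
  have c: "fF x z k \<in> carrier L" "eE x y n \<in> carrier L" using assms by simp_all
  have "bracket L (e x) (fF x z k) = \<zero> \<or> (\<exists>c k'. bracket L (e x) (fF x z k) = c \<odot> fF x z k')"
    using e_f_string_0[OF assms(1,3,5)] e_f_string[OF assms(1,3,5)] by (cases k) blast+
  then have "bracket L (eE x y n) (bracket L (e x) (fF x z k)) = \<zero>"
  proof
    assume "\<exists>c k'. bracket L (e x) (fF x z k) = c \<odot> fF x z k'"
    then obtain d k' where eq: "bracket L (e x) (fF x z k) = d \<odot> fF x z k'" by blast
    have "fF x z k' \<in> carrier L" using assms by simp
    then show ?thesis unfolding eq using Suc.IH c by (simp add: bracket_scale_right)
  qed (use c in simp)
  then show ?case
    using bracket_jacobi_left[OF e_part[OF assms(1)] e_string_part[OF assms(1,2), of n] c(1)] Suc.IH assms(1)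
    by simp
qed

text \<open>\<open>e x\<close> commutes with \<open>f y\<close>, so the bracket with
  \<open>f y\<close> passes through to the innermost \<open>e y\<close>.\<close>

lemma e_string_f:
  assumes "x \<in> X" "y \<in> X" "y \<noteq> x"
  shows "bracket L (eE x y n) (f y) = root_string L (e x) (\<iota> (coroot v y)) n"
proof (induction n)
  case 0
  then show ?case using assms by (simp add: bracket_e_f_same)
next
  case (Suc n)
  have c: "eE x y n \<in> carrier L" using assms by simp
  show ?case
    using bracket_jacobi_left[OF e_part[OF assms(1)] e_string_part[OF assms(1,2), of n] f_closed[OF assms(2)]]
      Suc assms c by (simp add: bracket_e_f coroot_closed)
qed

end

section \<open>Serre relations from minimality\<close>

context minimal_root_rep
begin

text \<open>The vectors obtained from \<open>u\<close> by applying elements \<open>e z\<close> alone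
  already span an ideal: an \<open>f\<close> moved to the right leaves only Cartan terms behind and
  finally kills \<open>u\<close>. At \<open>h1\<close> the eigenvalues of this ideal are at least
  \<open>Suc k\<close>, hence nonzero, so it meets the Cartan subalgebra trivially.\<close>

lemma highest_weight_zero:
  assumes u: "u \<in> carrier L" and wt: "\<And>h. h \<in> carrier (hspace v) \<Longrightarrow> bracket L (\<iota> h) u = \<mu> h \<odot> u"
    and h1: "h1 \<in> carrier (hspace v)" "\<And>x. x \<in> X \<Longrightarrow> simple_root v x h1 = 1"
    and k: "\<mu> h1 = of_nat (Suc k)" and f: "\<And>z. z \<in> X \<Longrightarrow> bracket L (f z) u = \<zero>"
  shows "u = \<zero>"
proof -
  define W where "W = {w. \<exists>zs. set zs \<subseteq> X \<and> w = foldr (\<lambda>z w. bracket L (e z) w) zs u}"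
  define J where "J = span L W"
  have Wc: "W \<subseteq> carrier L"
  proof
    fix w assume "w \<in> W"
    then obtain zs where "set zs \<subseteq> X" "w = foldr (\<lambda>z w. bracket L (e z) w) zs u" by (auto simp: W_def)
    then show "w \<in> carrier L" using u by (induction zs arbitrary: w) auto
  qed
  note sub = submodule_span[OF Wc, folded J_def]
  have uW: "u \<in> W" by (auto simp: W_def intro: exI[of _ "[]"])
  have eW: "bracket L (e z) w \<in> W" if "z \<in> X" "w \<in> W" for z w
  proof -
    obtain zs where "set zs \<subseteq> X" "w = foldr (\<lambda>z w. bracket L (e z) w) zs u" using \<open>w \<in> W\<close> by (auto simp: W_def)
    then have "set (z # zs) \<subseteq> X" "bracket L (e z) w = foldr (\<lambda>z w. bracket L (e z) w) (z # zs) u"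
      using \<open>z \<in> X\<close> by simp_all
    then show ?thesis unfolding W_def by blast
  qed
  have e_st: "bracket L (e z) w \<in> J" if "z \<in> X" "w \<in> J" for z w
    using bracket_span[OF that(2)[unfolded J_def] Wc e_closed[OF that(1)] sub] eW[OF that(1)]
    by (auto simp: J_def intro: span_base)
  \<comment> \<open>That \<open>h\<close> acts by a scalar is needed for all \<open>h\<close>, but a
    definite positive value only at \<open>h1\<close>.\<close>
  have weight: "\<exists>n. \<forall>h\<in>carrier (hspace v). \<exists>m. bracket L (\<iota> h) w = m \<odot> w \<and> (h = h1 \<longrightarrow> m = of_nat (Suc n))"
    if "w \<in> W" for w
  proof -
    obtain zs where zs: "set zs \<subseteq> X" "w = foldr (\<lambda>z w. bracket L (e z) w) zs u" using \<open>w \<in> W\<close> by (auto simp: W_def)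
    have "w \<in> W \<and> (\<forall>h\<in>carrier (hspace v). bracket L (\<iota> h) w =
        (\<mu> h + (\<Sum>z\<leftarrow>zs. simple_root v z h)) \<odot> w) \<and> (\<Sum>z\<leftarrow>zs. simple_root v z h1) = of_nat (length zs)"
      using zs
    proof (induction zs arbitrary: w)
      case Nil
      then show ?case using wt uW by simp
    next
      case (Cons z zs)
      let ?w = "foldr (\<lambda>z w. bracket L (e z) w) zs u"
      have IH: "?w \<in> W" "\<And>h. h \<in> carrier (hspace v) \<Longrightarrow> bracket L (\<iota> h) ?w = (\<mu> h + (\<Sum>z\<leftarrow>zs. simple_root v z h)) \<odot> ?w"
        "(\<Sum>z\<leftarrow>zs. simple_root v z h1) = of_nat (length zs)"
        using Cons.IH[of ?w] Cons.prems(1) by auto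
      have z: "z \<in> X" using Cons.prems by simp
      have wc: "?w \<in> carrier L" using IH(1) Wc by blast
      have "bracket L (\<iota> h) (bracket L (e z) ?w) =
        (\<mu> h + (simple_root v z h + (\<Sum>z\<leftarrow>zs. simple_root v z h))) \<odot> bracket L (e z) ?w"
        if h: "h \<in> carrier (hspace v)" for h
        using bracket_jacobi[OF cartan_part[OF h] e_part[OF z] wc] IH(2)[OF h] wc z h
        by (simp add: bracket_cartan_e bracket_scale_left bracket_scale_right scale_add_left[symmetric] algebra_simps)
      then show ?case using Cons.prems(2) IH(1,3) eW[OF z] h1(2)[OF z] by simp
    qed
    then show ?thesis using k by (intro exI[of _ "k + length zs"]) auto
  qed
  have cartan_st: "bracket L (\<iota> h) w \<in> J" if h: "h \<in> carrier (hspace v)" and w: "w \<in> J" for h w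
  proof (rule bracket_span[OF w[unfolded J_def] Wc cartan_closed[OF h] sub])
    fix w assume w: "w \<in> W"
    then obtain m where "bracket L (\<iota> h) w = m \<odot> w" using weight h by blast
    then show "bracket L (\<iota> h) w \<in> J" using w by (simp add: J_def span_scale_base)
  qed
  have fW: "bracket L (f z) w \<in> J" if z: "z \<in> X" and w: "w \<in> W" for z w
  proof -
    obtain zs where "set zs \<subseteq> X" "w = foldr (\<lambda>z w. bracket L (e z) w) zs u" using w by (auto simp: W_def)
    then show ?thesis
    proof (induction zs arbitrary: w)
      case Nil
      then show ?case using f[OF z] sub by (simp add: submodule_iff)
    next
      case (Cons y zs)
      let ?w = "foldr (\<lambda>z w. bracket L (e z) w) zs u"
      have y: "y \<in> X" and IH: "bracket L (f z) ?w \<in> J" using Cons by auto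
      have wW: "?w \<in> W" using Cons.prems(1) by (auto simp: W_def)
      have wc: "?w \<in> carrier L" using wW Wc by blast
      have wJ: "?w \<in> J" using wW by (simp add: J_def span_base)
      have "bracket L (bracket L (f z) (e y)) ?w \<in> J"
      proof (cases "z = y")
        case True
        have "bracket L (\<iota> (coroot v y)) ?w \<in> J" by (rule cartan_st[OF coroot_closed[OF y] wJ])
        then show ?thesis using True y wc coroot_closed[OF y] sub
          by (simp add: bracket_f_e_same bracket_scale_left submodule_iff)
      next
        case False
        then show ?thesis using y z wc sub by (simp add: bracket_f_e submodule_iff)
      qed
      moreover have "bracket L (e y) (bracket L (f z) ?w) \<in> J" by (rule e_st[OF y IH])
      ultimately show ?case
        using bracket_jacobi[OF f_part[OF z] e_part[OF y] wc] sub Cons.prems(2) by (simp add: submodule_iff)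
    qed
  qed
  have f_st: "bracket L (f z) w \<in> J" if z: "z \<in> X" and w: "w \<in> J" for z w
    by (rule bracket_span[OF w[unfolded J_def] Wc f_closed[OF z] sub fW[OF z]])
  have "superideal J L" by (rule superidealI[OF sub cartan_st e_st f_st])
  moreover have "J \<inter> \<iota> ` carrier (hspace v) = {\<zero>}"
  proof -
    let ?P = "\<lambda>k. {u \<in> {u \<in> carrier L. k = 0 \<longrightarrow> u = \<zero>}. bracket L (\<iota> h1) u = k \<odot> u}"
    have h1': "x \<in> X \<Longrightarrow> simple_root v x h1 = of_nat 1" for x using h1(2) by simp
    have P: "submodule (?P k) complex_field L" for k
      by (rule submodule_nonzero_eigen[OF h1(1) h1']) simp_all
    have WP: "W \<subseteq> eigen_sums L ?P"
    proof
      fix w assume w: "w \<in> W"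
      then obtain n where "bracket L (\<iota> h1) w = of_nat (Suc n) \<odot> w" using weight h1(1) by blast
      then have "w \<in> ?P (of_nat (Suc n))" using w Wc by (auto simp del: of_nat_Suc)
      then show "w \<in> eigen_sums L ?P" by (rule eigen_sums_base[where P = ?P, OF P])
    qed
    have JP: "J \<subseteq> eigen_sums L ?P"
      unfolding J_def by (rule subsetI, rule span_subset[OF _ submodule_eigen_sums[where P = ?P, OF P] WP])
    have "w = \<zero>" if w: "w \<in> J" "w \<in> \<iota> ` carrier (hspace v)" for w
    proof -
      obtain h where h: "h \<in> carrier (hspace v)" "w = \<iota> h" using w(2) by blast
      have "\<iota> h \<in> eigen_sums L ?P" using w(1) h(2) JP by blast
      from cartan_nonzero_eigen[OF h1(1) h1' _ h(1) this] show ?thesis using h(2) by simp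
    qed
    moreover have "\<zero> \<in> J" using sub by (simp add: submodule_iff)
    ultimately show ?thesis using zero_in_cartan by blast
  qed
  ultimately have "J = {\<zero>}" by (rule minimal)
  then show ?thesis using uW by (auto simp: J_def dest: span_base[of u W L])
qed

text \<open>Lowering \<open>[e x, e x]\<close> by \<open>f x\<close> produces multiples of
  \<open>a_xx e x\<close>, and the other \<open>f z\<close> commute with \<open>e x\<close>.\<close>

lemma e_bracket_isotropic:
  assumes x: "x \<in> X" and h1: "h1 \<in> carrier (hspace v)" "\<And>x. x \<in> X \<Longrightarrow> simple_root v x h1 = 1"
    and iso: "cartan v x x = 0"
  shows "bracket L (e x) (e x) = \<zero>"
proof (rule highest_weight_zero[where \<mu> = "\<lambda>h. 2 * simple_root v x h" and k = 1, OF _ _ h1])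
  have ex: "e x \<in> carrier L" using x by simp
  show "bracket L (e x) (e x) \<in> carrier L" using x by simp
  show "bracket L (\<iota> h) (bracket L (e x) (e x)) = (2 * simple_root v x h) \<odot> bracket L (e x) (e x)"
    if h: "h \<in> carrier (hspace v)" for h
    using bracket_jacobi[OF cartan_part[OF h] e_part[OF x] ex] x h
    by (simp add: bracket_cartan_e bracket_scale_left bracket_scale_right scale_add_left[symmetric])
  show "2 * simple_root v x h1 = of_nat (Suc 1)" using h1(2)[OF x] by simp
  show "bracket L (f z) (bracket L (e x) (e x)) = \<zero>" if z: "z \<in> X" for z
  proof (cases "z = x")
    case True
    have a: "bracket L (\<iota> (coroot v x)) (e x) = \<zero>" "bracket L (e x) (\<iota> (coroot v x)) = \<zero>"
      using x iso by (simp_all add: bracket_cartan_e bracket_e_cartan coroot_closed cartan_def)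
    show ?thesis
      using bracket_jacobi[OF f_part[OF z] e_part[OF x] ex] True x a coroot_closed[OF x]
      by (simp add: bracket_f_e_same bracket_scale_left bracket_scale_right)
  next
    case False
    then show ?thesis using bracket_jacobi[OF f_part[OF z] e_part[OF x] ex] x z by (simp add: bracket_f_e)
  qed
qed

text \<open>Each \<open>f z\<close> kills the end of the string: for \<open>z = x\<close> by the
  vanishing string coefficient, for \<open>z = y\<close> because the result is
  \<open>ad (e x)\<close> applied \<open>m + 1\<close> times to \<open>a(y)\<close>, and for other
  \<open>z\<close> because \<open>f z\<close> commutes with the string.\<close>

lemma e_serre:
  assumes x: "x \<in> X" and y: "y \<in> X" and yx: "y \<noteq> x" and m: "serre_exponent v x y m"
  shows "root_string L (e x) (e y) (Suc m) = \<zero>"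
proof -
  obtain h1 where h1: "h1 \<in> carrier (hspace v)" "\<And>x. x \<in> X \<Longrightarrow> simple_root v x h1 = 1"
    using coweight_ex[of "\<lambda>x. 1"] by blast
  have ex: "e x \<in> carrier L" and ay: "\<iota> (coroot v y) \<in> carrier L" using x y coroot_closed by simp_all
  let ?B = "root_string L (e x) (\<iota> (coroot v y))"
  have B1: "?B (Suc 0) = (- cartan v y x) \<odot> e x"
    using x y by (simp add: bracket_e_cartan coroot_closed cartan_def)
  have mono: "?B n = \<zero>" if "?B j = \<zero>" "j \<le> n" for j n
    using that(2) by (induction n rule: dec_induct) (use that(1) ex in auto)
  have B2: "?B (Suc (Suc 0)) = (- cartan v y x) \<odot> bracket L (e x) (e x)"
    using root_string.simps(2)[of L "e x" "\<iota> (coroot v y)" "Suc 0"] B1 ex by (simp add: bracket_scale_right)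
  have skew: "bracket L (e x) (e x) = (- koszul_sign (parity v x) (parity v x)) \<odot> bracket L (e x) (e x)"
    by (rule bracket_skew[OF e_part[OF x] e_part[OF x]])
  \<comment> \<open>Writing \<open>t\<close> for this bracket, the Jacobi identity reads
    \<open>t = - t + \<epsilon> t\<close>, and \<open>\<epsilon> - 2\<close> is nonzero for either
    parity.\<close>
  have eee: "bracket L (e x) (bracket L (e x) (e x)) = \<zero>"
  proof -
    let ?k = "koszul_sign (parity v x) (parity v x)" and ?t = "bracket L (e x) (bracket L (e x) (e x))"
    have t: "?t \<in> carrier L" using ex by simp
    have "bracket L (bracket L (e x) (e x)) (e x) = (- koszul_sign (parity v x + parity v x) (parity v x)) \<odot> ?t"
      by (rule bracket_skew[OF part_bracket[OF e_part[OF x] e_part[OF x]] e_part[OF x]])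
    moreover have "koszul_sign (parity v x + parity v x) (parity v x) = 1"
      by (cases "parity v x") simp_all
    ultimately have "?t = (-1) \<odot> ?t \<oplus> ?k \<odot> ?t"
      using bracket_jacobi[OF e_part[OF x] e_part[OF x] ex] by simp
    then have "\<zero> = (-1) \<odot> ?t \<oplus> ((-1) \<odot> ?t \<oplus> ?k \<odot> ?t)"
      using t add_scale_minus[OF t] by (metis a_comm scale_closed)
    also have "\<dots> = (?k - 2) \<odot> ?t"
      using t by (simp add: scale_add_left[symmetric])
    finally have "(?k - 2) \<odot> ?t = \<zero>" ..
    moreover have "?k - 2 \<noteq> 0" by (simp add: koszul_sign_def)
    ultimately show ?thesis using scale_eq_zero_iff[OF t] by blast
  qed
  \<comment> \<open>The second clause of \<open>serre_exponent\<close> is used here: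
    \<open>ad (e x)\<close> maps \<open>a(y)\<close> to \<open>- a_yx e x\<close>, then to a
    multiple of \<open>[e x, e x]\<close>, which vanishes for even or isotropic \<open>x\<close>,
    and then to zero.\<close>
  have B: "?B (Suc m) = \<zero>"
  proof -
    from m consider "m = 0" "cartan v y x = 0" | "m \<ge> 1" "parity v x = 0" | "m \<ge> 1" "cartan v x x = 0" | "m \<ge> 2"
      unfolding serre_exponent_def by blast
    then show ?thesis
    proof cases
      case 1
      then show ?thesis using B1 ex by simp
    next
      case 2
      have "bracket L (e x) (e x) = (-1) \<odot> bracket L (e x) (e x)" using skew 2(2) by simp
      then have "bracket L (e x) (e x) \<oplus> bracket L (e x) (e x) = \<zero>"
        using ex add_scale_minus[of "bracket L (e x) (e x)"] by simp
      then have "2 \<odot> bracket L (e x) (e x) = \<zero>" using ex scale_add_left[of "bracket L (e x) (e x)" 1 1] by simp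
      then have "bracket L (e x) (e x) = \<zero>" using ex scale_eq_zero_iff[of "bracket L (e x) (e x)" 2] by simp
      then have "?B (Suc (Suc 0)) = \<zero>" using B2 by simp
      then show ?thesis by (rule mono) (use 2 in simp)
    next
      case 3
      then have "?B (Suc (Suc 0)) = \<zero>" using B2 e_bracket_isotropic[OF x h1] by simp
      then show ?thesis by (rule mono) (use 3 in simp)
    next
      case 4
      have "?B (Suc (Suc (Suc 0))) = \<zero>"
        using root_string.simps(2)[of L "e x" "\<iota> (coroot v y)" "Suc (Suc 0)"] B2 ex eee
        by (simp add: bracket_scale_right)
      then show ?thesis by (rule mono) (use 4 in simp)
    qed
  qed
  show ?thesis
  proof (rule highest_weight_zero[where \<mu> = "\<lambda>h. simple_root v y h + of_nat (Suc m) * simple_root v x h"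
        and k = "Suc m", OF _ _ h1])
    show "root_string L (e x) (e y) (Suc m) \<in> carrier L" using ex y by (intro root_string_closed) simp_all
    show "bracket L (\<iota> h) (root_string L (e x) (e y) (Suc m)) =
      (simple_root v y h + of_nat (Suc m) * simple_root v x h) \<odot> root_string L (e x) (e y) (Suc m)"
      if "h \<in> carrier (hspace v)" for h
      by (rule e_string_weight[OF x y that])
    show "simple_root v y h1 + of_nat (Suc m) * simple_root v x h1 = of_nat (Suc (Suc m))"
      using h1(2)[OF x] h1(2)[OF y] by simp
    show "bracket L (f z) (root_string L (e x) (e y) (Suc m)) = \<zero>" if z: "z \<in> X" for z
    proof -
      consider "z = x" | "z = y" | "z \<noteq> x" "z \<noteq> y" by blast
      then show ?thesis
      proof cases
        case 1
        have "root_string L (e x) (e y) m \<in> carrier L" using ex y by simp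
        then show ?thesis
          using f_e_string[OF x y yx, of m] m 1 by (simp only: serre_exponent_def mult_zero_right scale_zero_left)
      next
        case 2
        have "bracket L (root_string L (e x) (e y) (Suc m)) (f y) = \<zero>"
          using e_string_f[OF x y yx, of "Suc m"] B by simp
        then show ?thesis
          unfolding 2 by (rule bracket_eq_zero_swap[OF e_string_part[OF x y] f_part[OF y]])
      next
        case 3
        have "bracket L (root_string L (e x) (e y) (Suc m)) (root_string L (f x) (f z) 0) = \<zero>"
          using 3 by (intro e_string_f_string_distinct[OF x y z yx]) auto
        then show ?thesis
          using bracket_eq_zero_swap[OF e_string_part[OF x y, of "Suc m"] f_part[OF z]] by simp
      qed
    qed
  qed
qed

text \<open>The Cartan image is a subspace, so negating the Cartan map does not change it, and
  minimality carries over.\<close>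

lemma flip_minimal:
  "minimal_root_rep L X v (\<lambda>h. (-1) \<odot> \<iota> h) f (\<lambda>x. koszul_sign (parity v x) (parity v x) \<odot> e x)"
proof (rule minimal_root_rep.intro[OF flip_generated], rule minimal_root_rep_axioms.intro)
  show "h = \<zero>\<^bsub>hspace v\<^esub>" if h: "h \<in> carrier (hspace v)" "(-1) \<odot> \<iota> h = \<zero>" for h
    using h scale_eq_zero_iff[OF cartan_closed[OF h(1)], of "-1"] cartan_inj by simp
  have "(\<lambda>h. (-1) \<odot> \<iota> h) ` carrier (hspace v) = \<iota> ` carrier (hspace v)"
  proof -
    have sub: "\<zero> \<in> \<iota> ` carrier (hspace v)" "\<And>c u. u \<in> \<iota> ` carrier (hspace v) \<Longrightarrow> c \<odot> u \<in> \<iota> ` carrier (hspace v)"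
      using submodule_cartan by (auto simp only: submodule_iff)
    have "\<iota> h \<in> (\<lambda>h. (-1) \<odot> \<iota> h) ` carrier (hspace v)" if h: "h \<in> carrier (hspace v)" for h
    proof -
      obtain k where k: "k \<in> carrier (hspace v)" "(-1) \<odot> \<iota> h = \<iota> k" using sub(2)[of "\<iota> h" "-1"] h by auto
      have "(-1) \<odot> ((-1) \<odot> \<iota> h) = (-1) \<odot> \<iota> k" using k(2) by simp
      then have "\<iota> h = (-1) \<odot> \<iota> k" using h by simp
      then show ?thesis using k(1) by blast
    qed
    then show ?thesis using sub(2) by blast
  qed
  then show "J = {\<zero>}" if "superideal J L" "J \<inter> (\<lambda>h. (-1) \<odot> \<iota> h) ` carrier (hspace v) = {\<zero>}" for J
    using that minimal by simp
qed

text \<open>The numerical condition involves only the datum, which the flip leaves alone.\<close>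

lemma f_serre:
  assumes "x \<in> X" "y \<in> X" "y \<noteq> x" "serre_exponent v x y m"
  shows "root_string L (f x) (f y) (Suc m) = \<zero>"
proof -
  interpret Fl: minimal_root_rep L X v "\<lambda>h. (-1) \<odot> \<iota> h" f "\<lambda>x. koszul_sign (parity v x) (parity v x) \<odot> e x"
    by (rule flip_minimal)
  show ?thesis
    by (rule Fl.e_serre[OF assms])
qed

text \<open>In each of the three types of reflexions the simple root \<open>b(y)\<close> is moved by a multiple \<open>m\<close> of
  \<open>b(x)\<close>, and the new generators are the ends of the two \<open>x\<close>-strings through \<open>e\<^sub>y\<close> and \<open>f\<^sub>y\<close>.\<close>

lemma reflected_rep:
  fixes v' :: "('h, 'x) root_datum" and M :: "'x \<Rightarrow> nat"
  assumes X: "finite X" and v': "is_root_datum X v'" and x: "x \<in> X"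
    and space': "hspace v' = hspace v"
    and coroot_x: "\<iota> (coroot v' x) = (-1) \<odot> \<iota> (coroot v x)"
    and root_x: "\<And>h. h \<in> carrier (hspace v) \<Longrightarrow> simple_root v' x h = - simple_root v x h"
    and parity_x: "parity v' x = parity v x"
    and M: "\<And>y. y \<in> X \<Longrightarrow> y \<noteq> x \<Longrightarrow> serre_exponent v x y (M y)"
    and M0: "\<And>y. y \<in> X \<Longrightarrow> y \<noteq> x \<Longrightarrow> cartan v x y = 0 \<Longrightarrow> M y = 0"
    and nz: "\<And>y n. y \<in> X \<Longrightarrow> y \<noteq> x \<Longrightarrow> n < M y \<Longrightarrow> string_coeff v x y (Suc n) \<noteq> 0"
    and coroot_y: "\<And>y. y \<in> X \<Longrightarrow> y \<noteq> x \<Longrightarrow> \<iota> (coroot v' y) =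
      \<iota> (coroot v y) \<oplus> (of_nat (M y) * (cartan v y x / cartan v x y)) \<odot> \<iota> (coroot v x)"
    and root_y: "\<And>y h. y \<in> X \<Longrightarrow> y \<noteq> x \<Longrightarrow> h \<in> carrier (hspace v) \<Longrightarrow>
      simple_root v' y h = simple_root v y h + of_nat (M y) * simple_root v x h"
    and parity_y: "\<And>y. y \<in> X \<Longrightarrow> y \<noteq> x \<Longrightarrow> parity v' y = string_parity v x y (M y)"
  shows "\<exists>e' f'. minimal_root_rep L X v' \<iota> e' f'"
proof -
  let ?k = "koszul_sign (parity v x) (parity v x)"
  define Es where "Es y n = root_string L (e x) (e y) n" for y n
  define Fs where "Fs y n = root_string L (f x) (f y) n" for y n
  define C where "C y = string_norm v x y (M y)" for y
  define e' where "e' y = (if y = x then f x else Es y (M y))" for y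
  \<comment> \<open>The sign at \<open>x\<close> gives
    \<open>[f x, \<epsilon> e x] = - a(x)\<close>. For the other indices \<open>C y\<close> is the
    factor by which the bracket of the two string ends differs from the new coroot.\<close>
  define f' where "f' y = (if y = x then ?k \<odot> e x else inverse (C y) \<odot> Fs y (M y))" for y
  have C: "C y \<noteq> 0" if y: "y \<in> X" "y \<noteq> x" for y
  proof -
    have "n \<le> M y \<Longrightarrow> string_norm v x y n \<noteq> 0" for n
      using nz[OF y] by (induction n) auto
    then show ?thesis by (simp add: C_def)
  qed
  have Ep: "Es y n \<in> part L (string_parity v x y n)" and Fp: "Fs y n \<in> part L (string_parity v x y n)"
    if "y \<in> X" for y n
    unfolding Es_def Fs_def by (rule e_string_part[OF x that], rule f_string_part[OF x that])
  have Ec: "Es y n \<in> carrier L" and Fc: "Fs y n \<in> carrier L" if "y \<in> X" for y n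
    using Ep[OF that] Fp[OF that] part_carrier by blast+
  have exc: "e x \<in> carrier L" "f x \<in> carrier L" using x by simp_all
  have fF: "bracket L (f x) (Fs y (M y)) = \<zero>" if "y \<in> X" "y \<noteq> x" for y
    using f_serre[OF x that M[OF that]] by (simp add: Fs_def)
  have Ee: "bracket L (Es y (M y)) (e x) = \<zero>" if "y \<in> X" "y \<noteq> x" for y
    using e_serre[OF x that M[OF that]]
    by (intro bracket_eq_zero_swap[OF e_part[OF x] Ep[OF that(1)]]) (simp add: Es_def)
  note D = is_root_datumD[OF v']
  have "root_rep_axioms L X v' \<iota> e' f'"
  proof (rule root_rep_axioms.intro)
    show "complex_space (hspace v')" by (rule D(1))
    show "y \<in> X \<Longrightarrow> coroot v' y \<in> carrier (hspace v')" for y by (rule D(3))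
    show "\<exists>h\<in>carrier (hspace v'). \<forall>y\<in>X. simple_root v' y h = t y" for t
      by (rule root_datum_coweight[OF X v'])
    show "e' y \<in> part L (parity v' y)" if "y \<in> X" for y
      using that Ep f_part[OF x] parity_x parity_y by (simp add: e'_def)
    show "f' y \<in> part L (parity v' y)" if "y \<in> X" for y
      using that Fp e_part[OF x] parity_x parity_y part_scale by (simp add: f'_def)
    show "bracket L (\<iota> h) (e' y) = simple_root v' y h \<odot> e' y" if "h \<in> carrier (hspace v')" "y \<in> X" for h y
      using that x root_x root_y e_string_weight[OF x that(2)] space'
      by (simp add: e'_def Es_def bracket_cartan_f)
    show "bracket L (\<iota> h) (f' y) = (- simple_root v' y h) \<odot> f' y" if "h \<in> carrier (hspace v')" "y \<in> X" for h y
    proof (cases "y = x")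
      case True
      then show ?thesis using that x root_x space' by (simp add: f'_def bracket_scale_right bracket_cartan_e mult.commute)
    next
      case False
      then show ?thesis
        using that Fc root_y f_string_weight[OF x that(2), of h "M y"] space'
        by (simp add: f'_def bracket_scale_right mult.commute) (simp add: Fs_def)
    qed
    \<comment> \<open>The Serre relations enter when one index is \<open>x\<close>: they say that
      the string ends commute with \<open>f x\<close> and with \<open>e x\<close>,
      respectively.\<close>
    show "bracket L (e' y) (f' z) = \<zero>" if yz: "y \<in> X" "z \<in> X" "y \<noteq> z" for y z
    proof -
      consider "y = x" "z \<noteq> x" | "y \<noteq> x" "z = x" | "y \<noteq> x" "z \<noteq> x" using yz(3) by blast
      then show ?thesis
      proof cases
        case 1
        then show ?thesis using fF[OF yz(2) 1(2)] Fc yz exc by (simp add: e'_def f'_def bracket_scale_right)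
      next
        case 2
        then show ?thesis using Ee[OF yz(1) 2(1)] Ec yz exc by (simp add: e'_def f'_def bracket_scale_right)
      next
        case 3
        then show ?thesis using e_string_f_string_distinct[OF x yz(1,2) 3 yz(3)] Ec Fc yz
          by (simp add: e'_def f'_def bracket_scale_right) (simp add: Es_def Fs_def)
      qed
    qed
    show "bracket L (e' y) (f' y) = \<iota> (coroot v' y)" if y: "y \<in> X" for y
    proof (cases "y = x")
      case True
      have "bracket L (f x) (?k \<odot> e x) = (?k * - ?k) \<odot> \<iota> (coroot v x)"
        using x exc coroot_closed[OF x] by (simp only: bracket_scale_right bracket_f_e_same scale_scale cartan_closed)
      then show ?thesis using True coroot_x by (simp add: e'_def f'_def)
    next
      case False
      have "bracket L (Es y (M y)) (Fs y (M y)) = C y \<odot> \<iota> (coroot v' y)"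
      proof (cases "cartan v x y = 0")
        case True
        then show ?thesis
          using M0[OF y False] coroot_y[OF y False] x y coroot_closed
          by (simp add: Es_def Fs_def C_def bracket_e_f_same)
      next
        case nz: False
        show ?thesis
          using e_string_f_string[OF x y False nz, of "M y"] coroot_y[OF y False]
          by (simp add: Es_def Fs_def C_def)
      qed
      then have "bracket L (Es y (M y)) (inverse (C y) \<odot> Fs y (M y)) = (inverse (C y) * C y) \<odot> \<iota> (coroot v' y)"
        using Ec[OF y] Fc[OF y] D(3)[OF y] space' by (simp only: bracket_scale_right scale_scale cartan_closed)
      then show ?thesis using C[OF y False] False D(3)[OF y] space' by (simp add: e'_def f'_def)
    qed
  qed (use space' cartan_part cartan_add cartan_scale bracket_cartan in simp_all)
  then interpret R: root_rep L X v' \<iota> e' f' using lie_super_axioms by (simp add: root_rep_def)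
  let ?S = "root_generating_set X v' \<iota> e' f'"
  have gen_e': "homogeneous_generated L ?S (parity v' y) (e' y)" and gen_f': "homogeneous_generated L ?S (parity v' y) (f' y)"
    if "y \<in> X" for y
    using that by (auto simp: root_generating_set_def intro!: hgen_base)
  have gen_fx: "homogeneous_generated L ?S (parity v x) (f x)"
    using gen_e'[OF x] parity_x by (simp add: e'_def)
  have gen_ex: "homogeneous_generated L ?S (parity v x) (e x)"
  proof -
    have "homogeneous_generated L ?S (parity v x) (?k \<odot> (?k \<odot> e x))"
      using hgen_scale[OF gen_f'[OF x], of ?k] parity_x by (simp add: f'_def)
    then show ?thesis using exc by simp
  qed
  \<comment> \<open>The original generators are recovered by descending each string from its end,
    since the string coefficients met on the way are nonzero. The induction counts the steps from
    the end; truncated subtraction makes it stationary after \<open>M y\<close> of them.\<close>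
  have gen_Es: "homogeneous_generated L ?S (string_parity v x y (M y - n)) (Es y (M y - n))"
    if y: "y \<in> X" "y \<noteq> x" for y n
  proof (induction n)
    case 0
    have "e' y = Es y (M y)" using y(2) by (simp add: e'_def)
    then show ?case using gen_e'[OF y(1)] parity_y[OF y] by simp
  next
    case (Suc n)
    show ?case
    proof (cases "n < M y")
      case True
      define j where "j = M y - Suc n"
      have j: "M y - n = Suc j" "j < M y" using True by (auto simp: j_def)
      have "homogeneous_generated L ?S (parity v x + string_parity v x y (Suc j)) (bracket L (f x) (Es y (Suc j)))"
        by (rule hgen_bracket[OF gen_fx Suc[unfolded j(1)]])
      then have *: "homogeneous_generated L ?S (string_parity v x y j) (bracket L (f x) (Es y (Suc j)))"
        by (simp only: string_parity.simps bit_add_self_cancel)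
      have "bracket L (f x) (Es y (Suc j)) = (?k * string_coeff v x y (Suc j)) \<odot> Es y j"
        using f_e_string[OF x y] by (simp only: Es_def)
      then have "inverse (?k * string_coeff v x y (Suc j)) \<odot> bracket L (f x) (Es y (Suc j)) = Es y j"
        using nz[OF y j(2)] Ec[OF y(1)] by (simp del: string_coeff.simps inverse_mult_distrib)
      then show ?thesis using hgen_scale[OF *, of "inverse (?k * string_coeff v x y (Suc j))"] by (simp add: j_def)
    next
      case False
      then have "M y - Suc n = M y - n" by simp
      then show ?thesis using Suc by simp
    qed
  qed
  have gen_Fs: "homogeneous_generated L ?S (string_parity v x y (M y - n)) (Fs y (M y - n))"
    if y: "y \<in> X" "y \<noteq> x" for y n
  proof (induction n)
    case 0
    have "homogeneous_generated L ?S (string_parity v x y (M y)) (C y \<odot> (inverse (C y) \<odot> Fs y (M y)))"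
      using hgen_scale[OF gen_f'[OF y(1)], of "C y"] parity_y[OF y] y(2) by (simp add: f'_def)
    then show ?case using C[OF y] Fc[OF y(1)] by simp
  next
    case (Suc n)
    show ?case
    proof (cases "n < M y")
      case True
      define j where "j = M y - Suc n"
      have j: "M y - n = Suc j" "j < M y" using True by (auto simp: j_def)
      have "homogeneous_generated L ?S (parity v x + string_parity v x y (Suc j)) (bracket L (e x) (Fs y (Suc j)))"
        by (rule hgen_bracket[OF gen_ex Suc[unfolded j(1)]])
      then have *: "homogeneous_generated L ?S (string_parity v x y j) (bracket L (e x) (Fs y (Suc j)))"
        by (simp only: string_parity.simps bit_add_self_cancel)
      have "bracket L (e x) (Fs y (Suc j)) = string_coeff v x y (Suc j) \<odot> Fs y j"
        using e_f_string[OF x y] by (simp only: Fs_def)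
      then have "inverse (string_coeff v x y (Suc j)) \<odot> bracket L (e x) (Fs y (Suc j)) = Fs y j"
        using nz[OF y j(2)] Fc[OF y(1)] by (simp del: string_coeff.simps)
      then show ?thesis using hgen_scale[OF *, of "inverse (string_coeff v x y (Suc j))"] by (simp add: j_def)
    next
      case False
      then have "M y - Suc n = M y - n" by simp
      then show ?thesis using Suc by simp
    qed
  qed
  have "homogeneous_generated L ?S i s" if s: "s \<in> root_generating_set X v \<iota> e f i" for i s
  proof -
    consider h where "h \<in> carrier (hspace v)" "s = \<iota> h" "i = 0"
      | y where "y \<in> X" "s = e y" "i = parity v y" | y where "y \<in> X" "s = f y" "i = parity v y"
      using s unfolding root_generating_set_def by blast
    then show ?thesis
    proof cases
      case 1
      then show ?thesis using space' by (auto simp: root_generating_set_def intro!: hgen_base)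
    next
      case 2
      then show ?thesis using gen_ex gen_Es[OF 2(1), of "M y"] by (cases "y = x") (simp_all add: Es_def)
    next
      case 3
      then show ?thesis using gen_fx gen_Fs[OF 3(1), of "M y"] by (cases "y = x") (simp_all add: Fs_def)
    qed
  qed
  then have "generated_root_rep L X v' \<iota> e' f'"
    using homogeneous_generated_trans[OF generated] R.root_rep_axioms
    by (simp add: generated_root_rep_def generated_root_rep_axioms_def)
  \<comment> \<open>Algebra and Cartan map are the old ones, so injectivity and minimality are those
    of the given realization.\<close>
  then have "minimal_root_rep L X v' \<iota> e' f'"
    using cartan_inj minimal space' by (simp add: minimal_root_rep_def minimal_root_rep_axioms_def)
  then show ?thesis by blast
qed

end

context complex_vector_space
begin

section \<open>Arrows of the groupoid\<close>

lemma lin_comb_family_cong: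
  "u \<in> S \<rightarrow> carrier V \<Longrightarrow> (\<And>i. i \<in> S \<Longrightarrow> u i = w i) \<Longrightarrow> lin_comb V S u c = lin_comb V S w c"
  unfolding lin_comb_def by (intro finsum_cong') (auto simp: Pi_iff)

lemma lin_comb_family_add:
  assumes "u \<in> S \<rightarrow> carrier V" "w \<in> S \<rightarrow> carrier V"
  shows "lin_comb V S (\<lambda>i. u i \<oplus> w i) c = lin_comb V S u c \<oplus> lin_comb V S w c"
proof -
  have "(\<Oplus>i\<in>S. c i \<odot> (u i \<oplus> w i)) = (\<Oplus>i\<in>S. c i \<odot> u i \<oplus> c i \<odot> w i)"
    using assms by (intro finsum_cong') (auto simp: scale_add_right Pi_iff)
  also have "\<dots> = (\<Oplus>i\<in>S. c i \<odot> u i) \<oplus> (\<Oplus>i\<in>S. c i \<odot> w i)"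
    using assms by (intro finsum_addf) auto
  finally show ?thesis by (simp add: lin_comb_def)
qed

lemma lin_comb_family_scale:
  assumes "u \<in> S \<rightarrow> carrier V"
  shows "lin_comb V S (\<lambda>i. k i \<odot> u i) c = lin_comb V S u (\<lambda>i. c i * k i)"
  unfolding lin_comb_def using assms by (intro finsum_cong') (auto simp: Pi_iff)

lemma lin_comb_const:
  "finite S \<Longrightarrow> w \<in> carrier V \<Longrightarrow> lin_comb V S (\<lambda>_. w) c = (\<Sum>i\<in>S. c i) \<odot> w"
proof (induction S rule: finite_induct)
  case empty
  then show ?case by (simp add: lin_comb_def)
next
  case (insert j S)
  have "lin_comb V (insert j S) (\<lambda>_. w) c = c j \<odot> w \<oplus> lin_comb V S (\<lambda>_. w) c"
    using lin_comb_remove[of "insert j S" j "\<lambda>_. w" c] insert by simp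
  then show ?case using insert by (simp add: scale_add_left)
qed

text \<open>The shear is invertible because \<open>k x = -2\<close> sends \<open>u x\<close> to its
  negative. A relation between the new vectors is one between the old ones in which only the
  coefficient at \<open>x\<close> has changed, by the sum of all \<open>c y * k y\<close>.\<close>

lemma lin_indep_shear:
  assumes X: "finite X" "x \<in> X" and u: "u \<in> X \<rightarrow> carrier V" and ind: "lin_indep_family V X u"
    and u': "\<And>y. y \<in> X \<Longrightarrow> u' y = u y \<oplus> k y \<odot> u x" and kx: "k x = -2"
  shows "lin_indep_family V X u'"
  unfolding lin_indep_family_def
proof (intro allI impI)
  fix c assume zero: "lin_comb V X u' c = \<zero>"
  have ux: "u x \<in> carrier V" using u X by auto
  have kc: "(\<lambda>y. k y \<odot> u x) \<in> X \<rightarrow> carrier V" using ux by auto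
  define s where "s = (\<Sum>y\<in>X. c y * k y)"
  define d where "d = c(x := c x + s)"
  have "lin_comb V X u' c = lin_comb V X (\<lambda>y. u y \<oplus> k y \<odot> u x) c"
    using u' funcset_mem[OF u] ux by (intro lin_comb_family_cong) simp_all
  also have "\<dots> = lin_comb V X u c \<oplus> lin_comb V X (\<lambda>y. k y \<odot> u x) c"
    by (rule lin_comb_family_add[OF u kc])
  also have "lin_comb V X (\<lambda>y. k y \<odot> u x) c = s \<odot> u x"
    using lin_comb_family_scale[of "\<lambda>_. u x" X k c] lin_comb_const[OF X(1) ux] ux by (simp add: s_def)
  also have "lin_comb V X u c \<oplus> s \<odot> u x = lin_comb V X u d"
  proof -
    have r: "lin_comb V (X - {x}) u d = lin_comb V (X - {x}) u c"
      using u by (intro lin_comb_cong) (auto simp: d_def)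
    have cl: "lin_comb V (X - {x}) u c \<in> carrier V" using u by (intro lin_comb_closed) auto
    show ?thesis
      unfolding lin_comb_remove[OF X u, of c] lin_comb_remove[OF X u, of d] r
      using cl ux by (simp add: d_def scale_add_left a_ac)
  qed
  finally have "\<forall>y\<in>X. d y = 0" using ind zero by (auto simp: lin_indep_family_def)
  then have c0: "c y = 0" if "y \<in> X" "y \<noteq> x" for y using that by (auto simp: d_def)
  have "s = c x * k x + (\<Sum>y\<in>X - {x}. c y * k y)" unfolding s_def using X by (intro sum.remove)
  also have "(\<Sum>y\<in>X - {x}. c y * k y) = 0" using c0 by (intro sum.neutral) auto
  finally have "s = c x * -2" using kx by simp
  moreover have "c x + s = 0" using \<open>\<forall>y\<in>X. d y = 0\<close> X by (auto simp: d_def)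
  ultimately have "c x = 0" by simp
  then show "\<forall>y\<in>X. c y = 0" using c0 by blast
qed

end

section \<open>Reflexions, homotheties and transports of root data\<close>

text \<open>Together with \<open>root_shift\<close>, a uniform shape for all cases of a reflexion:
  every vector is moved by a multiple of the one at \<open>x\<close>. The value -2 at
  \<open>y = x\<close> is the sign change, in the isotropic as in the anisotropic case.\<close>

definition coroot_shift :: "('h, 'x) root_datum \<Rightarrow> 'x \<Rightarrow> 'x \<Rightarrow> complex"
  where "coroot_shift v x y = (if y = x then -2 else if cartan v x x \<noteq> 0 then - 2 * (cartan v y x / cartan v x x)
    else if cartan v x y = 0 then 0 else cartan v y x / cartan v x y)"

definition root_shift :: "('h, 'x) root_datum \<Rightarrow> 'x \<Rightarrow> 'x \<Rightarrow> complex"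
  where "root_shift v x y = (if y = x then -2 else if cartan v x x \<noteq> 0 then - 2 * (cartan v x y / cartan v x x)
    else if cartan v x y = 0 then 0 else 1)"

lemma reflexion_formulas:
  assumes "complex_space (hspace v)" and x: "x \<in> X" and y: "y \<in> X"
    and a: "coroot v x \<in> carrier (hspace v)" "coroot v y \<in> carrier (hspace v)"
    and b: "simple_root v x \<in> carrier (dual_space (hspace v))" "simple_root v y \<in> carrier (dual_space (hspace v))"
  shows "coroot (reflexion X x v) y =
      coroot v y \<oplus>\<^bsub>hspace v\<^esub> coroot_shift v x y \<odot>\<^bsub>hspace v\<^esub> coroot v x"
    and "simple_root (reflexion X x v) y = simple_root v y \<oplus>\<^bsub>dual_space (hspace v)\<^esub>
      root_shift v x y \<odot>\<^bsub>dual_space (hspace v)\<^esub> simple_root v x"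
proof -
  interpret V: complex_vector_space "hspace v" using assms(1) by (simp add: complex_vector_space_iff)
  interpret D: complex_vector_space "dual_space (hspace v)"
    using V.dual_space_complex by (simp add: complex_vector_space_iff)
  have two: "u \<oplus>\<^bsub>hspace v\<^esub> (-2) \<odot>\<^bsub>hspace v\<^esub> u = (-1) \<odot>\<^bsub>hspace v\<^esub> u" if "u \<in> carrier (hspace v)" for u
    using V.scale_add_left[OF that, of 1 "-2"] that by simp
  have two': "u \<oplus>\<^bsub>dual_space (hspace v)\<^esub> (-2) \<odot>\<^bsub>dual_space (hspace v)\<^esub> u = (-1) \<odot>\<^bsub>dual_space (hspace v)\<^esub> u"
    if "u \<in> carrier (dual_space (hspace v))" for u
    using D.scale_add_left[OF that, of 1 "-2"] that by simp
  show "coroot (reflexion X x v) y =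
      coroot v y \<oplus>\<^bsub>hspace v\<^esub> coroot_shift v x y \<odot>\<^bsub>hspace v\<^esub> coroot v x"
    using x y a two
    by (auto simp: reflexion_def anisotropic_reflexion_def isotropic_reflexion_def Let_def coroot_shift_def
        V.diff_eq_scale V.minus_eq_scale)
  show "simple_root (reflexion X x v) y = simple_root v y \<oplus>\<^bsub>dual_space (hspace v)\<^esub>
      root_shift v x y \<odot>\<^bsub>dual_space (hspace v)\<^esub> simple_root v x"
    using x y b two'
    by (auto simp: reflexion_def anisotropic_reflexion_def isotropic_reflexion_def Let_def root_shift_def
        D.diff_eq_scale D.minus_eq_scale)
qed

lemma reflexion_hspace [simp]: "hspace (reflexion X x v) = hspace v"
  by (simp add: reflexion_def anisotropic_reflexion_def isotropic_reflexion_def Let_def)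

lemma is_root_datum_reflexion:
  assumes X: "finite X" "x \<in> X" and v: "is_root_datum X v"
  shows "is_root_datum X (reflexion X x v)"
proof -
  let ?V = "hspace v" and ?D = "dual_space (hspace v)" and ?r = "reflexion X x v"
  interpret V: complex_vector_space ?V using is_root_datumD(1)[OF v] by (simp add: complex_vector_space_iff)
  interpret D: complex_vector_space ?D using V.dual_space_complex by (simp add: complex_vector_space_iff)
  have a: "coroot v \<in> X \<rightarrow> carrier ?V" "lin_indep_family ?V X (coroot v)"
    and b: "simple_root v \<in> X \<rightarrow> carrier ?D" "lin_indep_family ?D X (simple_root v)"
    and p: "parity v \<in> X \<rightarrow>\<^sub>E UNIV"
    using v by (auto simp: is_root_datum_def PiE_def)
  have F: "coroot ?r y = coroot v y \<oplus>\<^bsub>?V\<^esub> coroot_shift v x y \<odot>\<^bsub>?V\<^esub> coroot v x"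
    "simple_root ?r y = simple_root v y \<oplus>\<^bsub>?D\<^esub> root_shift v x y \<odot>\<^bsub>?D\<^esub> simple_root v x" if "y \<in> X" for y
    using reflexion_formulas[OF is_root_datumD(1)[OF v] X(2) that] a(1) b(1) X(2) that by blast+
  have ext: "coroot ?r \<in> extensional X" "simple_root ?r \<in> extensional X" "parity ?r \<in> extensional X"
    using p by (auto simp: reflexion_def anisotropic_reflexion_def isotropic_reflexion_def Let_def PiE_def)
  have "lin_indep_family ?V X (coroot ?r)"
    by (rule V.lin_indep_shear[OF X a F(1)]) (simp_all add: coroot_shift_def)
  moreover have "lin_indep_family ?D X (simple_root ?r)"
    by (rule D.lin_indep_shear[OF X b F(2)]) (simp_all add: root_shift_def)
  moreover have "coroot ?r \<in> X \<rightarrow> carrier ?V"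
    using F(1) a(1) X(2) by (auto simp: Pi_iff)
  moreover have "simple_root ?r \<in> X \<rightarrow> carrier ?D"
    using F(2) b(1) X(2) by (auto simp: Pi_iff)
  ultimately show ?thesis
    using v ext by (simp add: is_root_datum_def PiE_def)
qed

lemma is_root_datum_rescaled:
  assumes X: "finite X" and v: "is_root_datum X v" and l: "\<forall>x\<in>X. l x \<noteq> 0"
  shows "is_root_datum X (rescaled X l v)"
proof -
  let ?V = "hspace v"
  interpret V: complex_vector_space ?V using is_root_datumD(1)[OF v] by (simp add: complex_vector_space_iff)
  have a: "coroot v \<in> X \<rightarrow> carrier ?V" "lin_indep_family ?V X (coroot v)"
    using v by (auto simp: is_root_datum_def PiE_def)
  have "lin_indep_family ?V X (\<lambda>x\<in>X. l x \<odot>\<^bsub>?V\<^esub> coroot v x)"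
    unfolding lin_indep_family_def
  proof (intro allI impI)
    fix c assume "lin_comb ?V X (\<lambda>x\<in>X. l x \<odot>\<^bsub>?V\<^esub> coroot v x) c = \<zero>\<^bsub>?V\<^esub>"
    moreover have "lin_comb ?V X (\<lambda>x\<in>X. l x \<odot>\<^bsub>?V\<^esub> coroot v x) c = lin_comb ?V X (\<lambda>x. l x \<odot>\<^bsub>?V\<^esub> coroot v x) c"
      using a(1) by (intro V.lin_comb_family_cong) auto
    ultimately have "lin_comb ?V X (coroot v) (\<lambda>x. c x * l x) = \<zero>\<^bsub>?V\<^esub>"
      by (simp add: V.lin_comb_family_scale[OF a(1)])
    then have "\<forall>x\<in>X. c x * l x = 0" using a(2) unfolding lin_indep_family_def by blast
    then show "\<forall>x\<in>X. c x = 0" using l by auto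
  qed
  then show ?thesis using v a(1) by (auto simp: is_root_datum_def rescaled_def)
qed

lemma linear_isoD:
  assumes "linear_iso V W \<theta>"
  shows "bij_betw \<theta> (carrier V) (carrier W)"
    and "u \<in> carrier V \<Longrightarrow> w \<in> carrier V \<Longrightarrow> \<theta> (u \<oplus>\<^bsub>V\<^esub> w) = \<theta> u \<oplus>\<^bsub>W\<^esub> \<theta> w"
    and "w \<in> carrier V \<Longrightarrow> \<theta> (c \<odot>\<^bsub>V\<^esub> w) = c \<odot>\<^bsub>W\<^esub> \<theta> w"
    and "w \<in> carrier V \<Longrightarrow> \<theta> w \<in> carrier W"
    and "inj_on \<theta> (carrier V)" and "\<theta> ` carrier V = carrier W"
  using assms by (auto simp: linear_iso_def bij_betw_def)

lemma linear_iso_zero: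
  assumes "complex_space V" "complex_space W" "linear_iso V W \<theta>"
  shows "\<theta> \<zero>\<^bsub>V\<^esub> = \<zero>\<^bsub>W\<^esub>"
proof -
  interpret V: complex_vector_space V using assms(1) by (simp add: complex_vector_space_iff)
  interpret W: complex_vector_space W using assms(2) by (simp add: complex_vector_space_iff)
  show ?thesis
    using linear_isoD(3)[OF assms(3) V.zero_closed, of 0] linear_isoD(4)[OF assms(3) V.zero_closed] by simp
qed

lemma linear_iso_lin_comb:
  assumes V: "complex_space V" and W: "complex_space W" and \<theta>: "linear_iso V W \<theta>"
    and "finite S" "u \<in> S \<rightarrow> carrier V"
  shows "\<theta> (lin_comb V S u c) = lin_comb W S (\<lambda>i. \<theta> (u i)) c"
  using assms(4,5)
proof (induction S rule: finite_induct)
  case empty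
  interpret V: complex_vector_space V using V by (simp add: complex_vector_space_iff)
  interpret W: complex_vector_space W using W by (simp add: complex_vector_space_iff)
  show ?case using linear_iso_zero[OF V W \<theta>] by (simp add: lin_comb_def)
next
  case (insert j S)
  interpret V: complex_vector_space V using V by (simp add: complex_vector_space_iff)
  interpret W: complex_vector_space W using W by (simp add: complex_vector_space_iff)
  note T = linear_isoD[OF \<theta>]
  have u: "u j \<in> carrier V" "u \<in> S \<rightarrow> carrier V" using insert.prems by auto
  have tu: "(\<lambda>i. \<theta> (u i)) \<in> insert j S \<rightarrow> carrier W" using insert.prems T(4) by auto
  have "lin_comb V (insert j S) u c = c j \<odot>\<^bsub>V\<^esub> u j \<oplus>\<^bsub>V\<^esub> lin_comb V S u c"
    using V.lin_comb_remove[of "insert j S" j u c] insert by simp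
  moreover have "lin_comb W (insert j S) (\<lambda>i. \<theta> (u i)) c = c j \<odot>\<^bsub>W\<^esub> \<theta> (u j) \<oplus>\<^bsub>W\<^esub> lin_comb W S (\<lambda>i. \<theta> (u i)) c"
    using W.lin_comb_remove[OF _ _ tu, of j c] insert by simp
  ultimately show ?case using insert.IH[OF u(2)] u by (simp add: T(2,3))
qed

text \<open>The inverse of the transpose is written with \<open>inv_into\<close>, so
  \<open>b\<close> must first be shown to lie in the range; the preimage is \<open>b\<close>
  composed with the inverse of \<theta>.\<close>

lemma transpose_inverse:
  assumes V: "complex_space V" and W: "complex_space W" and \<theta>: "linear_iso V W \<theta>"
    and b: "b \<in> carrier (dual_space V)"
  defines "g \<equiv> inv_into (carrier (dual_space W)) (transpose_map V \<theta>) b"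
  shows "g \<in> carrier (dual_space W)" and "h \<in> carrier V \<Longrightarrow> g (\<theta> h) = b h"
proof -
  interpret V: complex_vector_space V using V by (simp add: complex_vector_space_iff)
  note T = linear_isoD[OF \<theta>]
  let ?i = "inv_into (carrier V) \<theta>"
  have i: "?i (\<theta> h) = h" if "h \<in> carrier V" for h using T(5) that by simp
  have b': "linear_functional V b" "b \<in> extensional (carrier V)" using b by (simp_all add: dual_space_iff)
  have "linear_functional W (\<lambda>w\<in>carrier W. b (?i w))"
    unfolding linear_functional_def
  proof (intro conjI ballI allI)
    fix u assume u: "u \<in> carrier W"
    then obtain h where h: "h \<in> carrier V" "u = \<theta> h" using T(6) by auto
    show "(\<lambda>w\<in>carrier W. b (?i w)) (c \<odot>\<^bsub>W\<^esub> u) = c * (\<lambda>w\<in>carrier W. b (?i w)) u" for c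
      using T(4)[OF V.scale_closed[OF h(1)], of c] h i[OF V.scale_closed[OF h(1)], of c] i[OF h(1)] b'(1) u
      by (simp add: T(3) linear_functional_def)
    fix w assume w: "w \<in> carrier W"
    then obtain k where k: "k \<in> carrier V" "w = \<theta> k" using T(6) by auto
    show "(\<lambda>w\<in>carrier W. b (?i w)) (u \<oplus>\<^bsub>W\<^esub> w) = (\<lambda>w\<in>carrier W. b (?i w)) u + (\<lambda>w\<in>carrier W. b (?i w)) w"
      using T(4)[OF V.a_closed[OF h(1) k(1)]] h k i[OF V.a_closed[OF h(1) k(1)]] i[OF h(1)] i[OF k(1)] b'(1) u w
      by (simp add: T(2) linear_functional_def)
  qed
  then have "(\<lambda>w\<in>carrier W. b (?i w)) \<in> carrier (dual_space W)" by (simp add: dual_space_iff)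
  moreover have "transpose_map V \<theta> (\<lambda>w\<in>carrier W. b (?i w)) = b"
    unfolding transpose_map_def compose_def
    using b'(2) by (intro extensionalityI[of _ "carrier V"]) (simp_all add: T(4) i)
  ultimately have mem: "b \<in> transpose_map V \<theta> ` carrier (dual_space W)" by (metis imageI)
  show "g \<in> carrier (dual_space W)" unfolding g_def by (rule inv_into_into[OF mem])
  have eq: "transpose_map V \<theta> g = b" unfolding g_def by (rule f_inv_into_f[OF mem])
  show "g (\<theta> h) = b h" if "h \<in> carrier V"
    using fun_cong[OF eq, of h] that by (simp add: transpose_map_def compose_def)
qed

lemma transported_simple_root:
  assumes v: "is_root_datum X v" and W: "complex_space W" and \<theta>: "linear_iso (hspace v) W \<theta>" and x: "x \<in> X"
  shows "simple_root (transported X W \<theta> v) x \<in> carrier (dual_space W)"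
    and "h \<in> carrier (hspace v) \<Longrightarrow> simple_root (transported X W \<theta> v) x (\<theta> h) = simple_root v x h"
proof -
  have b: "simple_root v x \<in> carrier (dual_space (hspace v))"
    using v x by (auto simp: is_root_datum_def)
  show "simple_root (transported X W \<theta> v) x \<in> carrier (dual_space W)"
    using transpose_inverse(1)[OF is_root_datumD(1)[OF v] W \<theta> b] x
    by (simp add: transported_def compose_def)
  show "simple_root (transported X W \<theta> v) x (\<theta> h) = simple_root v x h" if "h \<in> carrier (hspace v)"
    using transpose_inverse(2)[OF is_root_datumD(1)[OF v] W \<theta> b that] x
    by (simp add: transported_def compose_def)
qed

lemma is_root_datum_transported:
  assumes X: "finite X" and v: "is_root_datum X v" and W: "complex_space W" and \<theta>: "linear_iso (hspace v) W \<theta>"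
  shows "is_root_datum X (transported X W \<theta> v)"
proof -
  let ?V = "hspace v" and ?r = "transported X W \<theta> v"
  note V = is_root_datumD(1)[OF v]
  interpret V: complex_vector_space ?V using V by (simp add: complex_vector_space_iff)
  interpret W: complex_vector_space W using W by (simp add: complex_vector_space_iff)
  note T = linear_isoD[OF \<theta>]
  note root = transported_simple_root[OF v W \<theta>]
  have a: "coroot v \<in> X \<rightarrow> carrier ?V" "lin_indep_family ?V X (coroot v)"
    and b: "simple_root v \<in> X \<rightarrow> carrier (dual_space ?V)" "lin_indep_family (dual_space ?V) X (simple_root v)"
    and p: "parity v \<in> X \<rightarrow>\<^sub>E UNIV"
    using v by (auto simp: is_root_datum_def PiE_def)
  have coroot: "coroot ?r y = \<theta> (coroot v y)" if "y \<in> X" for y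
    using that by (simp add: transported_def compose_def)
  have coroot_c: "coroot ?r \<in> X \<rightarrow> carrier W" using funcset_mem[OF a(1)] T(4) by (simp add: coroot Pi_iff)
  have "finite_dim W"
  proof -
    obtain B where B: "finite B" "B \<subseteq> carrier ?V" "\<And>h. h \<in> carrier ?V \<Longrightarrow> \<exists>c. h = lin_comb ?V B (\<lambda>u. u) c"
      using is_root_datumD(2)[OF v] by (auto simp: finite_dim_def)
    have inj: "inj_on \<theta> B" using T(5) B(2) by (rule inj_on_subset)
    have "\<exists>c. w = lin_comb W (\<theta> ` B) (\<lambda>u. u) c" if w: "w \<in> carrier W" for w
    proof -
      obtain h where h: "h \<in> carrier ?V" "w = \<theta> h" using w T(6) by auto
      obtain c where c: "h = lin_comb ?V B (\<lambda>u. u) c" using B(3)[OF h(1)] by blast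
      \<comment> \<open>The coefficients can be indexed by the image of \<open>B\<close> because
        \<theta> is injective there.\<close>
      let ?c = "\<lambda>w. c (inv_into B \<theta> w)"
      have "w = lin_comb W B (\<lambda>u. \<theta> u) c"
        unfolding h(2) c using B by (intro linear_iso_lin_comb[OF V W \<theta>]) auto
      also have "\<dots> = (\<Oplus>\<^bsub>W\<^esub>u\<in>B. ?c (\<theta> u) \<odot>\<^bsub>W\<^esub> \<theta> u)"
        unfolding lin_comb_def using B T(4) inj by (intro W.finsum_cong') auto
      also have "\<dots> = lin_comb W (\<theta> ` B) (\<lambda>u. u) ?c"
        unfolding lin_comb_def using B(2) T(4) inj
        by (intro W.finsum_reindex[symmetric]) auto
      finally show ?thesis by blast
    qed
    moreover have "\<theta> ` B \<subseteq> carrier W" using B(2) T(4) by auto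
    ultimately show ?thesis unfolding finite_dim_def using B(1) by (intro exI[of _ "\<theta> ` B"]) simp
  qed
  moreover have "lin_indep_family W X (coroot ?r)"
    unfolding lin_indep_family_def
  proof (intro allI impI)
    fix c assume zero: "lin_comb W X (coroot ?r) c = \<zero>\<^bsub>W\<^esub>"
    have "lin_comb W X (coroot ?r) c = lin_comb W X (\<lambda>y. \<theta> (coroot v y)) c"
      using coroot_c by (intro W.lin_comb_family_cong) (auto simp: coroot)
    also have "\<dots> = \<theta> (lin_comb ?V X (coroot v) c)"
      by (rule linear_iso_lin_comb[OF V W \<theta> X a(1), symmetric])
    finally have "\<theta> (lin_comb ?V X (coroot v) c) = \<theta> \<zero>\<^bsub>?V\<^esub>"
      using zero linear_iso_zero[OF V W \<theta>] by simp
    then have "lin_comb ?V X (coroot v) c = \<zero>\<^bsub>?V\<^esub>"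
      using T(5) V.lin_comb_closed[OF a(1), of c] by (simp add: inj_on_eq_iff)
    then show "\<forall>y\<in>X. c y = 0" using a(2) by (simp add: lin_indep_family_def)
  qed
  moreover have rc: "simple_root ?r \<in> X \<rightarrow> carrier (dual_space W)" using root(1) by auto
  moreover have "lin_indep_family (dual_space W) X (simple_root ?r)"
    unfolding W.dual_lin_indep_iff[OF X rc]
  proof (intro allI impI)
    fix c assume zero: "\<forall>w\<in>carrier W. (\<Sum>y\<in>X. c y * simple_root ?r y w) = 0"
    have "(\<Sum>y\<in>X. c y * simple_root v y h) = 0" if h: "h \<in> carrier ?V" for h
    proof -
      have "(\<Sum>y\<in>X. c y * simple_root v y h) = (\<Sum>y\<in>X. c y * simple_root ?r y (\<theta> h))"
        using root(2) h by (intro sum.cong) auto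
      then show ?thesis using zero T(4)[OF h] by simp
    qed
    then show "\<forall>y\<in>X. c y = 0" using b(2) V.dual_lin_indep_iff[OF X b(1)] by blast
  qed
  ultimately show ?thesis
    using W p coroot_c by (auto simp: is_root_datum_def transported_def PiE_def)
qed

lemma generating_arrow_root_datum:
  assumes "finite X" "generating_arrow X v v' \<phi>"
  shows "is_root_datum X v" and "is_root_datum X v'"
proof -
  have "is_root_datum X v \<and> is_root_datum X v'"
    using assms(2)
  proof cases
    case (reflexion_arrow x)
    then show ?thesis using is_root_datum_reflexion[OF assms(1)] by simp
  next
    case (tautological_arrow W)
    then show ?thesis using is_root_datum_transported[OF assms(1)] by simp
  next
    case (homothety_arrow l)
    then show ?thesis using is_root_datum_rescaled[OF assms(1)] by simp
  qed
  then show "is_root_datum X v" "is_root_datum X v'" by simp_all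
qed

lemma generating_arrow_closed:
  assumes "generating_arrow X v v' \<phi>" "h \<in> carrier (hspace v)"
  shows "\<phi> h \<in> carrier (hspace v')"
  using assms
proof (induction rule: generating_arrow.induct)
  case (tautological_arrow v W \<theta>)
  then show ?case using linear_isoD(4)[OF tautological_arrow(3)] by (simp add: transported_def)
qed (simp_all add: identity_on_def rescaled_def)

section \<open>The string length at a reflectable element\<close>

text \<open>The factor familiar from sl(2), doubled to avoid halves: it vanishes exactly when
  \<open>2 a_xy = - n a_xx\<close>.\<close>

lemma string_coeff_even:
  assumes "parity v x = 0"
  shows "2 * string_coeff v x y (Suc n) = - (of_nat (Suc n) * (2 * cartan v x y + of_nat n * cartan v x x))"
  using assms by (induction n) (simp_all add: algebra_simps)

text \<open>For odd \<open>x\<close> the sign in the recursion makes terms cancel in pairs, so the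
  closed form depends on the parity of the index, as for osp(1|2).\<close>

lemma string_coeff_odd:
  assumes "parity v x = 1"
  shows "string_coeff v x y (2 * k) = - (of_nat k * cartan v x x) \<and>
    string_coeff v x y (Suc (2 * k)) = - (cartan v x y + of_nat k * cartan v x x)"
  using assms by (induction k) (simp_all add: koszul_sign_def algebra_simps)

lemma string_parity_even: "parity v x = 0 \<Longrightarrow> string_parity v x y n = parity v y"
  by (induction n) simp_all

lemma string_parity_double: "string_parity v x y (2 * k) = parity v y"
proof (induction k)
  case (Suc k)
  have "string_parity v x y (2 * Suc k) = parity v x + (parity v x + string_parity v x y (2 * k))" by simp
  then show ?case using Suc by (simp only: bit_add_self_cancel)
qed simp

lemma nonpos_Ints_nat:
  assumes "(z :: complex) \<in> \<int>\<^sub>\<le>\<^sub>0"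
  obtains n where "z = - of_nat n"
proof -
  obtain i where i: "z = of_int i" "i \<le> 0" using assms by (rule nonpos_Ints_cases)
  then have "z = - of_nat (nat (- i))" by simp
  then show thesis by (rule that)
qed

text \<open>The string length is the multiple of \<open>b(x)\<close> by which the reflexion moves
  \<open>b(y)\<close>: it is \<open>- 2 a_xy / a_xx\<close> in the anisotropic case, an even number
  for odd \<open>x\<close>, and 0 or 1 in the isotropic case. If \<open>a_xy = 0\<close>, then
  \<open>a_yx = 0\<close> is what the Serre condition demands, and in the anisotropic case it also
  keeps \<open>a(y)\<close> fixed.\<close>

lemma reflexion_exponent:
  assumes x: "x \<in> X" and y: "y \<in> X" "y \<noteq> x" and refl: "reflectable X v x"
    and ws: "cartan v x y = 0 \<Longrightarrow> cartan v y x = 0"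
  shows "\<exists>m. serre_exponent v x y m \<and> (cartan v x y = 0 \<longrightarrow> m = 0) \<and>
    (\<forall>n<m. string_coeff v x y (Suc n) \<noteq> 0) \<and>
    coroot_shift v x y = of_nat m * (cartan v y x / cartan v x y) \<and> root_shift v x y = of_nat m \<and>
    parity (reflexion X x v) y = string_parity v x y m"
proof -
  consider (even) "cartan v x x \<noteq> 0" "parity v x = 0" | (odd) "cartan v x x \<noteq> 0" "parity v x = 1"
    | (iso) "cartan v x x = 0" by (cases "parity v x") auto
  then show ?thesis
  proof cases
    case even
    have "2 * cartan v x y / cartan v x x \<in> \<int>\<^sub>\<le>\<^sub>0" using refl even y by (simp add: reflectable_def)
    then obtain m where "2 * cartan v x y / cartan v x x = - of_nat m" by (rule nonpos_Ints_nat)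
    then have m: "2 * cartan v x y = - (of_nat m * cartan v x x)" using even(1) by (simp add: field_simps)
    have c: "string_coeff v x y (Suc n) = 0 \<longleftrightarrow> n = m" for n
    proof -
      have "2 * string_coeff v x y (Suc n) = - (of_nat (Suc n) * ((of_nat n - of_nat m) * cartan v x x))"
        unfolding string_coeff_even[of v x y n, OF even(2)] m by (simp add: algebra_simps)
      moreover have "string_coeff v x y (Suc n) = 0 \<longleftrightarrow> 2 * string_coeff v x y (Suc n) = 0"
        by (simp del: string_coeff.simps)
      ultimately have "string_coeff v x y (Suc n) = 0 \<longleftrightarrow>
        of_nat (Suc n) * ((of_nat n - of_nat m) * cartan v x x) = (0 :: complex)" by (simp only: neg_equal_0_iff_equal)
      then show ?thesis using even(1) by (simp del: of_nat_Suc)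
    qed
    have m0: "m = 0 \<longleftrightarrow> cartan v x y = 0" using m even(1) by auto
    have par: "parity (reflexion X x v) y = parity v y"
      using even(1) by (simp add: reflexion_def anisotropic_reflexion_def Let_def)
    show ?thesis
    proof (intro exI[of _ m] conjI)
      show "serre_exponent v x y m"
        using c m0 ws even(2) by (cases "m = 0") (simp_all add: serre_exponent_def del: string_coeff.simps)
      show "cartan v x y = 0 \<longrightarrow> m = 0" using m0 by blast
      show "\<forall>n<m. string_coeff v x y (Suc n) \<noteq> 0" by (simp add: c del: string_coeff.simps)
      show "root_shift v x y = of_nat m" using y even(1) m by (simp add: root_shift_def field_simps)
      show "coroot_shift v x y = of_nat m * (cartan v y x / cartan v x y)"
      proof (cases "cartan v x y = 0")
        case True
        then show ?thesis using y even(1) ws by (simp add: coroot_shift_def)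
      next
        case False
        have "of_nat m = - (2 * cartan v x y) / cartan v x x" using m even(1) by (simp add: field_simps)
        then show ?thesis using y even(1) False by (simp add: coroot_shift_def)
      qed
      show "parity (reflexion X x v) y = string_parity v x y m" using par string_parity_even[of v x y m, OF even(2)] by simp
    qed
  next
    case odd
    have "cartan v x y / cartan v x x \<in> \<int>\<^sub>\<le>\<^sub>0" using refl odd y by (simp add: reflectable_def)
    then obtain m where "cartan v x y / cartan v x x = - of_nat m" by (rule nonpos_Ints_nat)
    then have m: "cartan v x y = - (of_nat m * cartan v x x)" using odd(1) by (simp add: field_simps)
    have m0: "m = 0 \<longleftrightarrow> cartan v x y = 0" using m odd(1) by auto
    have par: "parity (reflexion X x v) y = parity v y"
      using odd(1) by (simp add: reflexion_def anisotropic_reflexion_def Let_def)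
    note coeff = string_coeff_odd[of v x y, OF odd(2)]
    \<comment> \<open>For odd anisotropic \<open>x\<close> the exponent is twice
      \<open>m = - a_xy / a_xx\<close>. If \<open>m\<close> is nonzero, the exponent is at least 2,
      and the Serre condition then holds without \<open>[e x, e x]\<close> being zero.\<close>
    show ?thesis
    proof (intro exI[of _ "2 * m"] conjI)
      have "string_coeff v x y (Suc (2 * m)) = 0" using coeff[of m] m by (simp del: string_coeff.simps)
      then show "serre_exponent v x y (2 * m)"
        using m0 ws by (cases "m = 0") (simp_all add: serre_exponent_def del: string_coeff.simps)
      show "cartan v x y = 0 \<longrightarrow> 2 * m = 0" using m0 by simp
      show "\<forall>n<2 * m. string_coeff v x y (Suc n) \<noteq> 0"
      proof (intro allI impI)
        fix n assume n: "n < 2 * m"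
        show "string_coeff v x y (Suc n) \<noteq> 0"
        proof (cases "even n")
          case True
          then obtain k where k: "n = 2 * k" by (elim evenE)
          have "string_coeff v x y (Suc n) = (of_nat m - of_nat k) * cartan v x x"
            unfolding k using coeff[of k] m by (simp add: algebra_simps del: string_coeff.simps)
          moreover have "of_nat m \<noteq> (of_nat k :: complex)" using n k by simp
          ultimately show ?thesis using odd(1) by (simp del: string_coeff.simps)
        next
          case False
          then obtain k where k: "n = 2 * k + 1" by (elim oddE)
          then have "Suc n = 2 * Suc k" by simp
          then have "string_coeff v x y (Suc n) = - (of_nat (Suc k) * cartan v x x)" using coeff[of "Suc k"] by (simp only:)
          then show ?thesis using odd(1) by (simp del: string_coeff.simps of_nat_Suc)
        qed
      qed
      show "root_shift v x y = of_nat (2 * m)" using y odd(1) m by (simp add: root_shift_def)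
      show "coroot_shift v x y = of_nat (2 * m) * (cartan v y x / cartan v x y)"
      proof (cases "cartan v x y = 0")
        case True
        then show ?thesis using y odd(1) ws by (simp add: coroot_shift_def)
      next
        case False
        have "of_nat (2 * m) = - (2 * cartan v x y) / cartan v x x" using m odd(1) by simp
        then show ?thesis using y odd(1) False by (simp add: coroot_shift_def)
      qed
      show "parity (reflexion X x v) y = string_parity v x y (2 * m)" using par string_parity_double[of v x y m] by simp
    qed
  next
    case iso
    have px: "parity v x = 1" using refl iso by (simp add: reflectable_def)
    show ?thesis
    proof (cases "cartan v x y = 0")
      case True
      then show ?thesis using y x iso ws
        by (intro exI[of _ 0]) (simp add: serre_exponent_def coroot_shift_def root_shift_def
          reflexion_def isotropic_reflexion_def Let_def)
    next
      case False
      \<comment> \<open>Exponent 1: the first string coefficient is \<open>- a_xy\<close>, which is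
        nonzero, and the second is \<open>a_xy - (a_xy + a_xx) = 0\<close>.\<close>
      then show ?thesis using y x iso px
        by (intro exI[of _ 1]) (simp add: serre_exponent_def coroot_shift_def root_shift_def
          reflexion_def isotropic_reflexion_def Let_def koszul_sign_def)
    qed
  qed
qed

text \<open>Collects the numbers from \<open>reflexion_exponent\<close> for all \<open>y\<close> at
  once. The Cartan map stays the same, in accordance with the identity that a reflexion induces on
  the Cartan space.\<close>

lemma (in minimal_root_rep) reflexion_rep:
  assumes X: "finite X" and v: "is_root_datum X v" and x: "x \<in> X" and refl: "reflectable X v x"
    and ws: "locally_weakly_symmetric X v"
  shows "\<exists>e' f'. minimal_root_rep L X (reflexion X x v) \<iota> e' f'"
proof -
  let ?r = "reflexion X x v"
  have ws': "cartan v y x = 0" if "y \<in> X" "cartan v x y = 0" for y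
    using ws x refl that by (auto simp: locally_weakly_symmetric_def)
  have "\<exists>m. serre_exponent v x y m \<and> (cartan v x y = 0 \<longrightarrow> m = 0) \<and>
    (\<forall>n<m. string_coeff v x y (Suc n) \<noteq> 0) \<and>
    coroot_shift v x y = of_nat m * (cartan v y x / cartan v x y) \<and> root_shift v x y = of_nat m \<and>
    parity ?r y = string_parity v x y m" if "y \<in> X" "y \<noteq> x" for y
    using that by (intro reflexion_exponent[OF x _ _ refl]) (auto intro: ws')
  then obtain M where M: "\<And>y. y \<in> X \<Longrightarrow> y \<noteq> x \<Longrightarrow> serre_exponent v x y (M y) \<and> (cartan v x y = 0 \<longrightarrow> M y = 0) \<and>
    (\<forall>n<M y. string_coeff v x y (Suc n) \<noteq> 0) \<and>
    coroot_shift v x y = of_nat (M y) * (cartan v y x / cartan v x y) \<and> root_shift v x y = of_nat (M y) \<and>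
    parity ?r y = string_parity v x y (M y)"
    by metis
  have a: "coroot v y \<in> carrier (hspace v)" and b: "simple_root v y \<in> carrier (dual_space (hspace v))" if "y \<in> X" for y
    using v that by (auto simp: is_root_datum_def)
  note F = reflexion_formulas[OF space x _ a[OF x] a b[OF x] b]
  have coroot: "\<iota> (coroot ?r y) = \<iota> (coroot v y) \<oplus> coroot_shift v x y \<odot> \<iota> (coroot v x)" if "y \<in> X" for y
  proof -
    interpret V: complex_vector_space "hspace v" using space by (simp add: complex_vector_space_iff)
    show ?thesis unfolding F(1)[OF that that that]
      using a[OF that] a[OF x] by (simp add: cartan_add cartan_scale)
  qed
  have root: "simple_root ?r y h = simple_root v y h + root_shift v x y * simple_root v x h"
    if "y \<in> X" "h \<in> carrier (hspace v)" for y h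
    unfolding F(2)[OF that(1) that(1) that(1)] using that(2) by (simp add: dual_space_def)
  show ?thesis
  proof (rule reflected_rep[OF X is_root_datum_reflexion[OF X x v] x, where M = M])
    show "hspace ?r = hspace v" by simp
    have "\<iota> (coroot v x) \<in> carrier L" using a[OF x] by simp
    then show "\<iota> (coroot ?r x) = (-1) \<odot> \<iota> (coroot v x)"
      using coroot[OF x] scale_add_left[of "\<iota> (coroot v x)" 1 "-2"] by (simp add: coroot_shift_def)
    show "simple_root ?r x h = - simple_root v x h" if "h \<in> carrier (hspace v)" for h
      using root[OF x that] by (simp add: root_shift_def)
    show "parity ?r x = parity v x"
      using x by (simp add: reflexion_def anisotropic_reflexion_def isotropic_reflexion_def Let_def)
  qed (use M coroot root in simp_all)
qed

text \<open>The factor on each coroot is absorbed by the same factor on \<open>e\<close>.\<close>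

lemma (in minimal_root_rep) rescaled_rep:
  assumes X: "finite X" and v: "is_root_datum X v" and l: "\<forall>x\<in>X. l x \<noteq> 0"
  shows "minimal_root_rep L X (rescaled X l v) \<iota> (\<lambda>x. l x \<odot> e x) f"
proof -
  let ?r = "rescaled X l v"
  note v' = is_root_datum_rescaled[OF X v l]
  have simps: "hspace ?r = hspace v" "simple_root ?r = simple_root v" "parity ?r = parity v"
    "x \<in> X \<Longrightarrow> coroot ?r x = l x \<odot>\<^bsub>hspace v\<^esub> coroot v x" for x
    by (simp_all add: rescaled_def)
  have "root_rep_axioms L X ?r \<iota> (\<lambda>x. l x \<odot> e x) f"
    by (rule root_rep_axioms.intro, use is_root_datumD(3)[OF v'] in
        \<open>simp_all add: simps space coweight_ex cartan_part cartan_add cartan_scale part_scale e_part f_part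
          bracket_cartan bracket_cartan_e bracket_cartan_f bracket_e_f bracket_e_f_same bracket_scale_left
          bracket_scale_right coroot_closed mult.commute\<close>)
  then have R: "root_rep L X ?r \<iota> (\<lambda>x. l x \<odot> e x) f" using lie_super_axioms by (simp add: root_rep_def)
  let ?S = "root_generating_set X ?r \<iota> (\<lambda>x. l x \<odot> e x) f"
  have "homogeneous_generated L ?S i s" if s: "s \<in> root_generating_set X v \<iota> e f i" for i s
  proof -
    consider h where "h \<in> carrier (hspace v)" "s = \<iota> h" "i = 0"
      | y where "y \<in> X" "s = e y" "i = parity v y" | y where "y \<in> X" "s = f y" "i = parity v y"
      using s unfolding root_generating_set_def by blast
    then show ?thesis
    proof cases
      case 2
      then have "l y \<odot> e y \<in> ?S i" unfolding root_generating_set_def simps by blast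
      then have "homogeneous_generated L ?S i (inverse (l y) \<odot> (l y \<odot> e y))"
        by (intro hgen_scale hgen_base)
      then show ?thesis using 2 l by simp
    qed (auto simp: root_generating_set_def simps intro!: hgen_base)
  qed
  then show ?thesis
    using homogeneous_generated_trans[OF generated] R cartan_inj minimal
    by (simp add: minimal_root_rep_def minimal_root_rep_axioms_def generated_root_rep_def
        generated_root_rep_axioms_def simps)
qed

text \<open>The elements \<open>e\<close> and \<open>f\<close> stay; only the labelling of the
  Cartan subalgebra is moved along \<theta>.\<close>

lemma (in minimal_root_rep) transported_rep:
  assumes X: "finite X" and v: "is_root_datum X v" and W: "complex_space W" and \<theta>: "linear_iso (hspace v) W \<theta>"
  defines "\<iota>' \<equiv> \<lambda>w. \<iota> (inv_into (carrier (hspace v)) \<theta> w)"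
  shows "minimal_root_rep L X (transported X W \<theta> v) \<iota>' e f"
    and "h \<in> carrier (hspace v) \<Longrightarrow> \<iota>' (\<theta> h) = \<iota> h"
proof -
  let ?r = "transported X W \<theta> v" and ?V = "hspace v"
  note v' = is_root_datum_transported[OF X v W \<theta>]
  note T = linear_isoD[OF \<theta>]
  interpret V: complex_vector_space ?V using space by (simp add: complex_vector_space_iff)
  have i: "\<iota>' (\<theta> h) = \<iota> h" if "h \<in> carrier ?V" for h using T(5) that by (simp add: \<iota>'_def)
  then show "h \<in> carrier (hspace v) \<Longrightarrow> \<iota>' (\<theta> h) = \<iota> h" .
  have simps: "hspace ?r = W" "parity ?r = parity v" "x \<in> X \<Longrightarrow> coroot ?r x = \<theta> (coroot v x)" for x
    by (simp_all add: transported_def compose_def)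
  note root = transported_simple_root(2)[OF v W \<theta>]
  have ex: "\<exists>h\<in>carrier ?V. w = \<theta> h" if "w \<in> carrier W" for w using that T(6) by auto
  have "root_rep_axioms L X ?r \<iota>' e f"
  proof (rule root_rep_axioms.intro)
    show "complex_space (hspace ?r)" using W simps by simp
    show "x \<in> X \<Longrightarrow> coroot ?r x \<in> carrier (hspace ?r)" for x using is_root_datumD(3)[OF v'] .
    show "\<exists>h\<in>carrier (hspace ?r). \<forall>x\<in>X. simple_root ?r x h = t x" for t
      by (rule root_datum_coweight[OF X v'])
    fix w assume "w \<in> carrier (hspace ?r)"
    then obtain h where h: "h \<in> carrier ?V" "w = \<theta> h" using ex simps by auto
    show "\<iota>' w \<in> part L 0" using h i cartan_part by simp
    show "\<iota>' (c \<odot>\<^bsub>hspace ?r\<^esub> w) = c \<odot> \<iota>' w" for c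
      unfolding simps h(2) T(3)[OF h(1), symmetric] i[OF h(1)] i[OF V.scale_closed[OF h(1)]]
      by (rule cartan_scale[OF h(1)])
    show "bracket L (\<iota>' w) (e x) = simple_root ?r x w \<odot> e x" if "x \<in> X" for x
      using h i root[OF that h(1)] bracket_cartan_e[OF h(1) that] by simp
    show "bracket L (\<iota>' w) (f x) = (- simple_root ?r x w) \<odot> f x" if "x \<in> X" for x
      using h i root[OF that h(1)] bracket_cartan_f[OF h(1) that] by simp
    fix u assume "u \<in> carrier (hspace ?r)"
    then obtain k where k: "k \<in> carrier ?V" "u = \<theta> k" using ex simps by auto
    show "\<iota>' (w \<oplus>\<^bsub>hspace ?r\<^esub> u) = \<iota>' w \<oplus> \<iota>' u"
      unfolding simps h(2) k(2) T(2)[OF h(1) k(1), symmetric] i[OF h(1)] i[OF k(1)] i[OF V.a_closed[OF h(1) k(1)]]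
      by (rule cartan_add[OF h(1) k(1)])
    show "bracket L (\<iota>' w) (\<iota>' u) = \<zero>" using h k i bracket_cartan by simp
  qed (use i coroot_closed in \<open>simp_all add: simps e_part f_part bracket_e_f bracket_e_f_same\<close>)
  then have R: "root_rep L X ?r \<iota>' e f" using lie_super_axioms by (simp add: root_rep_def)
  have image: "\<iota>' ` carrier (hspace ?r) = \<iota> ` carrier ?V"
  proof -
    have "\<iota>' ` carrier W = (\<lambda>h. \<iota>' (\<theta> h)) ` carrier ?V" using T(6) by (metis image_image)
    also have "\<dots> = \<iota> ` carrier ?V" using i by (intro image_cong) auto
    finally show ?thesis by (simp add: simps)
  qed
  have S: "root_generating_set X v \<iota> e f = root_generating_set X ?r \<iota>' e f"
  proof
    fix i
    have "(\<exists>h\<in>carrier ?V. u = \<iota> h) \<longleftrightarrow> (\<exists>h\<in>carrier (hspace ?r). u = \<iota>' h)" for u using image by blast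
    then show "root_generating_set X v \<iota> e f i = root_generating_set X ?r \<iota>' e f i"
      unfolding root_generating_set_def simps(2) by blast
  qed
  have "generated_root_rep L X ?r \<iota>' e f"
    using R generated unfolding S by (simp add: generated_root_rep_def generated_root_rep_axioms_def)
  moreover have "w = \<zero>\<^bsub>hspace ?r\<^esub>" if w: "w \<in> carrier (hspace ?r)" "\<iota>' w = \<zero>" for w
  proof -
    obtain h where h: "h \<in> carrier ?V" "w = \<theta> h" using ex w(1) simps by auto
    then have "h = \<zero>\<^bsub>?V\<^esub>" using w(2) i cartan_inj by simp
    then show ?thesis using h(2) linear_iso_zero[OF space W \<theta>] simps by simp
  qed
  ultimately show "minimal_root_rep L X ?r \<iota>' e f"
    using minimal image by (simp add: minimal_root_rep_def minimal_root_rep_axioms_def)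
qed

text \<open>The arrow changes the realization and not the algebra; the equation
  \<open>\<iota>' (\<phi> h) = \<iota> h\<close> records compatibility with the induced map of
  Cartan spaces.\<close>

lemma generating_arrow_rep:
  assumes X: "finite X" and arrow: "generating_arrow X v v' \<phi>"
    and ws: "locally_weakly_symmetric X v" and rep: "minimal_root_rep L X v \<iota> e f"
  shows "\<exists>\<iota>' e' f'. minimal_root_rep L X v' \<iota>' e' f' \<and> (\<forall>h\<in>carrier (hspace v). \<iota>' (\<phi> h) = \<iota> h)"
  using arrow ws rep
proof (induction rule: generating_arrow.induct)
  case (reflexion_arrow v x)
  then obtain e' f' where "minimal_root_rep L X (reflexion X x v) \<iota> e' f'"
    using minimal_root_rep.reflexion_rep[OF reflexion_arrow(5) X] by blast
  then show ?case by (intro exI conjI) (auto simp: identity_on_def)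
next
  case (tautological_arrow v W \<theta>)
  show ?case
    using minimal_root_rep.transported_rep[OF tautological_arrow(5) X tautological_arrow(1-3)] by blast
next
  case (homothety_arrow v l)
  then have "minimal_root_rep L X (rescaled X l v) \<iota> (\<lambda>x. l x \<odot>\<^bsub>L\<^esub> e x) f"
    by (intro minimal_root_rep.rescaled_rep X)
  then show ?case by (intro exI conjI) (auto simp: identity_on_def)
qed

section \<open>Admissibility and weak symmetricity\<close>

lemma groupoid_arrow_root_datum:
  assumes "groupoid_arrow X v v' \<phi>" "finite X"
  shows "is_root_datum X v" and "is_root_datum X v'"
    and "h \<in> carrier (hspace v) \<Longrightarrow> \<phi> h \<in> carrier (hspace v')"
proof -
  have "is_root_datum X v \<and> is_root_datum X v' \<and> (\<forall>h\<in>carrier (hspace v). \<phi> h \<in> carrier (hspace v'))"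
    using assms(1)
  proof induction
    case (composite_arrow v v' \<phi> v'' \<psi>)
    then show ?case
      using generating_arrow_root_datum(2)[OF assms(2) composite_arrow.hyps(2)]
        generating_arrow_closed[OF composite_arrow.hyps(2)]
      by (simp add: compose_def)
  qed (simp add: identity_on_def)
  then show "is_root_datum X v" "is_root_datum X v'"
    "h \<in> carrier (hspace v) \<Longrightarrow> \<phi> h \<in> carrier (hspace v')" by simp_all
qed

lemma groupoid_arrow_trans:
  assumes "groupoid_arrow X v w \<psi>" "groupoid_arrow X u v \<phi>"
  shows "\<exists>\<chi>. groupoid_arrow X u w \<chi>"
  using assms
proof (induction rule: groupoid_arrow.induct)
  case (composite_arrow v v' \<psi> v'' \<psi>')
  then obtain \<chi> where "groupoid_arrow X u v' \<chi>" by blast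
  from groupoid_arrow.composite_arrow[OF this composite_arrow.hyps(2)] show ?case by blast
qed blast

text \<open>Arrows compose easily because \<open>L\<close> is fixed along the whole path. Weak
  symmetricity is used at each datum on the path, hence the hypothesis on everything reachable from
  \<open>v\<close>.\<close>

lemma groupoid_arrow_rep:
  assumes arrow: "groupoid_arrow X v v' \<phi>" and X: "finite X"
    and ws: "\<forall>w \<chi>. groupoid_arrow X v w \<chi> \<longrightarrow> locally_weakly_symmetric X w"
    and rep: "minimal_root_rep L X v \<iota> e f"
  shows "\<exists>\<iota>' e' f'. minimal_root_rep L X v' \<iota>' e' f' \<and> (\<forall>h\<in>carrier (hspace v). \<iota>' (\<phi> h) = \<iota> h)"
  using arrow ws rep
proof induction
  case (identity_arrow v)
  then show ?case by (intro exI conjI) (auto simp: identity_on_def)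
next
  case (composite_arrow v v' \<phi> v'' \<psi>)
  obtain \<iota>' e' f' where rep': "minimal_root_rep L X v' \<iota>' e' f'" "\<forall>h\<in>carrier (hspace v). \<iota>' (\<phi> h) = \<iota> h"
    using composite_arrow.IH[OF composite_arrow.prems] by blast
  obtain \<iota>'' e'' f'' where rep'': "minimal_root_rep L X v'' \<iota>'' e'' f''"
    "\<forall>h\<in>carrier (hspace v'). \<iota>'' (\<psi> h) = \<iota>' h"
    using generating_arrow_rep[OF X composite_arrow.hyps(2) _ rep'(1)]
      composite_arrow.prems(1) composite_arrow.hyps(1) by blast
  have "\<forall>h\<in>carrier (hspace v). \<iota>'' (compose (carrier (hspace v)) \<psi> \<phi> h) = \<iota> h"
    using rep'(2) rep''(2) groupoid_arrow_root_datum(3)[OF composite_arrow.hyps(1) X]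
    by (simp add: compose_def)
  then show ?case using rep''(1) by blast
qed

text \<open>Along the arrow, the contragredient algebra of \<open>v\<close> becomes a minimal
  realization of \<open>v'\<close>, so by uniqueness it receives an isomorphism from the
  contragredient algebra of \<open>v'\<close>; the isomorphism sought is its inverse.\<close>

lemma weakly_symmetric_imp_admissible:
  assumes X: "finite X" and R: "root_component X R" and ws: "weakly_symmetric X R"
  shows "admissible X R"
proof -
  obtain v\<^sub>0 where v\<^sub>0: "is_root_datum X v\<^sub>0" and R_def: "R = {v. \<exists>\<phi>. groupoid_arrow X v\<^sub>0 v \<phi>}"
    using R by (auto simp: root_component_def)
  have "root_lie_superalgebra X R (contragredient_ideal X)"
    unfolding root_lie_superalgebra_def
  proof (intro conjI ballI allI impI)
    fix v assume v: "v \<in> R"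
    then have rd: "is_root_datum X v" using groupoid_arrow_root_datum(2)[OF _ X] by (auto simp: R_def)
    show "superideal (contragredient_ideal X v) (half_baked X v)"
      and "contragredient_ideal X v \<inter> cartan_embedding X v ` carrier (hspace v) = {\<zero>\<^bsub>half_baked X v\<^esub>}"
      using contragredient_ideal[OF X rd] .
    fix v' \<phi> assume v': "v' \<in> R" and arrow: "groupoid_arrow X v v' \<phi>"
    then have rd': "is_root_datum X v'" using groupoid_arrow_root_datum(2)[OF _ X] by (auto simp: R_def)
    have ws': "\<forall>w \<chi>. groupoid_arrow X v w \<chi> \<longrightarrow> locally_weakly_symmetric X w"
    proof (intro allI impI)
      fix w \<chi> assume "groupoid_arrow X v w \<chi>"
      then have "w \<in> R" using v groupoid_arrow_trans[of X v w \<chi> v\<^sub>0] by (auto simp: R_def)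
      then show "locally_weakly_symmetric X w" using ws by (simp add: weakly_symmetric_def)
    qed
    let ?L = "contragredient X v" and ?L' = "contragredient X v'"
    let ?\<iota> = "\<lambda>h. contragredient_ideal X v +>\<^bsub>half_baked X v\<^esub> cartan_embedding X v h"
    let ?\<iota>' = "\<lambda>h. contragredient_ideal X v' +>\<^bsub>half_baked X v'\<^esub> cartan_embedding X v' h"
    obtain \<iota>' e' f' where rep: "minimal_root_rep ?L X v' \<iota>' e' f'"
      "\<forall>h\<in>carrier (hspace v). \<iota>' (\<phi> h) = ?\<iota> h"
      using groupoid_arrow_rep[OF arrow X ws' contragredient_rep[OF X rd]] by blast
    obtain \<Psi> where \<Psi>: "super_iso ?L' ?L \<Psi>" "\<forall>h\<in>carrier (hspace v'). \<Psi> (?\<iota>' h) = \<iota>' h"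
      using minimal_root_rep.contragredient_iso[OF rep(1) X rd'] by blast
    interpret L': minimal_root_rep ?L' X v' ?\<iota>'
      "\<lambda>x. contragredient_ideal X v' +>\<^bsub>half_baked X v'\<^esub> half_baked_class X v' (E x)"
      "\<lambda>x. contragredient_ideal X v' +>\<^bsub>half_baked X v'\<^esub> half_baked_class X v' (F x)"
      by (rule contragredient_rep[OF X rd'])
    have inj: "inj_on \<Psi> (carrier ?L')" using \<Psi>(1) by (auto simp: super_iso_def bij_betw_def)
    have "inv_into (carrier ?L') \<Psi> (?\<iota> h) = ?\<iota>' (\<phi> h)" if h: "h \<in> carrier (hspace v)" for h
    proof -
      have \<phi>h: "\<phi> h \<in> carrier (hspace v')" by (rule groupoid_arrow_root_datum(3)[OF arrow X h])
      have "?\<iota> h = \<Psi> (?\<iota>' (\<phi> h))" using rep(2) \<Psi>(2) h \<phi>h by simp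
      then show ?thesis using inv_into_f_f[OF inj L'.cartan_closed[OF \<phi>h]] by simp
    qed
    then show "\<exists>\<Phi>. super_iso ?L ?L' \<Phi> \<and> (\<forall>h\<in>carrier (hspace v). \<Phi> (?\<iota> h) = ?\<iota>' (\<phi> h))"
      using super_iso_inverse[OF \<Psi>(1) L'.lie_super_axioms] by blast
  qed
  then show ?thesis by (auto simp: admissible_def)
qed

section \<open>Admissibility forces weak symmetricity\<close>

lemma coroot_nonzero:
  assumes X: "finite X" and v: "is_root_datum X v" and x: "x \<in> X"
  shows "coroot v x \<noteq> \<zero>\<^bsub>hspace v\<^esub>"
proof
  assume zero: "coroot v x = \<zero>\<^bsub>hspace v\<^esub>"
  interpret V: complex_vector_space "hspace v"
    using is_root_datumD(1)[OF v] by (simp add: complex_vector_space_iff)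
  have a: "coroot v \<in> X \<rightarrow> carrier (hspace v)" and ind: "lin_indep_family (hspace v) X (coroot v)"
    using v by (auto simp: is_root_datum_def PiE_def)
  have a': "coroot v \<in> X - {x} \<rightarrow> carrier (hspace v)" using a by auto
  let ?c = "\<lambda>y. if y = x then 1 else 0 :: complex"
  have "lin_comb (hspace v) (X - {x}) (coroot v) ?c = lin_comb (hspace v) (X - {x}) (coroot v) (\<lambda>y. 0 * 0)"
    using a' by (intro V.lin_comb_cong) auto
  also have "\<dots> = \<zero>\<^bsub>hspace v\<^esub>"
    using V.lin_comb_scale[OF _ a', of 0 "\<lambda>_. 0"] V.lin_comb_closed[OF a', of "\<lambda>_. 0"] X by simp
  finally have "lin_comb (hspace v) X (coroot v) ?c = \<zero>\<^bsub>hspace v\<^esub>"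
    using V.lin_comb_remove[OF X x a, of ?c] zero by simp
  then have "?c x = 0" using ind x unfolding lin_indep_family_def by blast
  then show False by simp
qed

text \<open>The given isomorphism is prescribed on the Cartan subalgebra only, so the images of
  \<open>f x\<close> and \<open>f y\<close> must be found from eigenvalues of suitable Cartan
  elements. Both data, the original and the reflected one, are realized on the quotient belonging to
  the reflected datum.\<close>

lemma admissible_imp_weakly_symmetric:
  assumes X: "finite X" and R: "root_component X R" and adm: "admissible X R"
  shows "weakly_symmetric X R"
  unfolding weakly_symmetric_def locally_weakly_symmetric_def
proof (intro ballI impI)
  fix v x y
  assume v: "v \<in> R" and x: "x \<in> X" and refl: "reflectable X v x" and y: "y \<in> X" and axy: "cartan v x y = 0"
  obtain v\<^sub>0 where R_def: "R = {v. \<exists>\<phi>. groupoid_arrow X v\<^sub>0 v \<phi>}"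
    using R by (auto simp: root_component_def)
  obtain I where I: "root_lie_superalgebra X R I" using adm by (auto simp: admissible_def)
  have rd: "is_root_datum X v" using v groupoid_arrow_root_datum(2)[OF _ X] by (auto simp: R_def)
  let ?v' = "reflexion X x v"
  have rd': "is_root_datum X ?v'" by (rule is_root_datum_reflexion[OF X x rd])
  define \<phi> where "\<phi> = compose (carrier (hspace v)) (identity_on v) (identity_on v)"
  have arrow: "groupoid_arrow X v ?v' \<phi>"
    unfolding \<phi>_def
    by (rule groupoid_arrow.composite_arrow[OF groupoid_arrow.identity_arrow[OF rd]
          generating_arrow.reflexion_arrow[OF rd x refl]])
  have v': "?v' \<in> R" using v groupoid_arrow_trans[OF arrow] by (auto simp: R_def)
  have \<phi>: "\<phi> h = h" if "h \<in> carrier (hspace v)" for h using that by (simp add: \<phi>_def compose_def identity_on_def)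
  let ?G = "half_baked X v" and ?G' = "half_baked X ?v'"
  let ?L = "super_quotient ?G (I v)" and ?L' = "super_quotient ?G' (I ?v')"
  let ?q = "\<lambda>u. I v +>\<^bsub>?G\<^esub> u" and ?q' = "\<lambda>u. I ?v' +>\<^bsub>?G'\<^esub> u"
  have Iv: "superideal (I v) ?G" and Iv': "superideal (I ?v') ?G'"
    and triv: "I ?v' \<inter> cartan_embedding X ?v' ` carrier (hspace ?v') = {\<zero>\<^bsub>?G'\<^esub>}"
    using I v v' unfolding root_lie_superalgebra_def by blast+
  have "\<exists>\<Phi>. super_iso ?L ?L' \<Phi> \<and>
    (\<forall>h\<in>carrier (hspace v). \<Phi> (?q (cartan_embedding X v h)) = ?q' (cartan_embedding X ?v' (\<phi> h)))"
    by (rule mp[OF spec[OF bspec[OF bspec[OF conjunct2[OF I[unfolded root_lie_superalgebra_def]] v] v']] arrow])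
  then obtain \<Phi> where \<Phi>: "super_iso ?L ?L' \<Phi>"
    "\<forall>h\<in>carrier (hspace v). \<Phi> (?q (cartan_embedding X v h)) = ?q' (cartan_embedding X ?v' (\<phi> h))"
    by (elim exE conjE)
  interpret G: generated_root_rep ?G X v "cartan_embedding X v" "\<lambda>x. half_baked_class X v (E x)"
    "\<lambda>x. half_baked_class X v (F x)" by (rule half_baked_rep[OF X rd])
  interpret G': generated_root_rep ?G' X ?v' "cartan_embedding X ?v'" "\<lambda>x. half_baked_class X ?v' (E x)"
    "\<lambda>x. half_baked_class X ?v' (F x)" by (rule half_baked_rep[OF X rd'])
  have L': "lie_super ?L'" by (rule G'.lie_super_quotient[OF Iv'])
  have L: "lie_super ?L" by (rule G.lie_super_quotient[OF Iv])
  define \<iota>' e' f' where "\<iota>' h = ?q' (cartan_embedding X ?v' h)" and "e' z = ?q' (half_baked_class X ?v' (E z))"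
    and "f' z = ?q' (half_baked_class X ?v' (F z))" for h z
  define \<iota> e f where "\<iota> h = \<Phi> (?q (cartan_embedding X v h))" and "e z = \<Phi> (?q (half_baked_class X v (E z)))"
    and "f z = \<Phi> (?q (half_baked_class X v (F z)))" for h z
  interpret R': generated_root_rep ?L' X ?v' \<iota>' e' f'
    unfolding \<iota>'_def[abs_def] e'_def[abs_def] f'_def[abs_def]
    by (rule G'.hom_image_generated[OF G'.super_hom_quotient[OF Iv'] L']) (simp add: G'.quotient_ops[OF Iv'])
  interpret Fl: generated_root_rep ?L' X ?v' "\<lambda>h. (-1) \<odot>\<^bsub>?L'\<^esub> \<iota>' h" f'
    "\<lambda>z. koszul_sign (parity ?v' z) (parity ?v' z) \<odot>\<^bsub>?L'\<^esub> e' z"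
    by (rule R'.flip_generated)
  interpret R: root_rep ?L' X v \<iota> e f
    unfolding \<iota>_def[abs_def] e_def[abs_def] f_def[abs_def]
    by (rule root_rep.hom_image_rep[OF G.hom_image_rep[OF G.super_hom_quotient[OF Iv] L] super_iso_imp_hom[OF \<Phi>(1)] L'])
  have \<iota>_eq: "\<iota> h = \<iota>' h" if "h \<in> carrier (hspace v)" for h using \<Phi>(2) \<phi> that by (simp add: \<iota>_def \<iota>'_def)
  have b: "simple_root v z \<in> carrier (dual_space (hspace v))" and a: "coroot v z \<in> carrier (hspace v)" if "z \<in> X" for z
    using rd that by (auto simp: is_root_datum_def)
  have root: "simple_root ?v' z h = simple_root v z h + root_shift v x z * simple_root v x h"
    if "z \<in> X" "h \<in> carrier (hspace v)" for z h
    unfolding reflexion_formulas(2)[OF is_root_datumD(1)[OF rd] x that(1) a[OF x] a[OF that(1)] b[OF x] b[OF that(1)]]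
    using that(2) by (simp add: dual_space_def)
  show "cartan v y x = 0"
  proof (cases "y = x")
    case True
    then show ?thesis using axy by simp
  next
    case False
    \<comment> \<open>At this \<open>h\<close> the element \<open>f x\<close> has eigenvalue
      \<open>- b(x) = b'(x) = 1\<close>, and \<open>simple_eigenspace\<close> makes it a multiple of
      \<open>e' x\<close>.\<close>
    have "\<exists>h\<in>carrier (hspace ?v'). \<forall>z\<in>X. simple_root ?v' z h = (if z = x then 1 else 2)"
      by (rule root_datum_coweight[OF X rd'])
    then obtain h where h: "h \<in> carrier (hspace ?v')" "\<And>z. z \<in> X \<Longrightarrow> simple_root ?v' z h = (if z = x then 1 else 2)"
      by blast
    have hv: "h \<in> carrier (hspace v)" using h(1) by simp
    have "simple_root v x h + (-2) * simple_root v x h = 1"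
      using root[OF x hv] h(2)[OF x] unfolding root_shift_def by simp
    then have "- simple_root v x h = 1" by simp
    then have "simple_root v x h = -1" by (metis minus_minus)
    then have "bracket ?L' (\<iota>' h) (f x) = f x"
      using R.bracket_cartan_f[OF hv x] \<iota>_eq[OF hv] R.f_closed[OF x] by simp
    then obtain d where d: "f x = d \<odot>\<^bsub>?L'\<^esub> e' x"
      using R'.simple_eigenspace[OF x h R.f_closed[OF x]] by blast
    \<comment> \<open>As \<open>a_xy = 0\<close>, the root of \<open>y\<close> is unchanged, so
      \<open>f y\<close> has eigenvalue -1 at \<open>k\<close>; the flipped realization turns this
      into eigenvalue 1.\<close>
    have "\<exists>h\<in>carrier (hspace ?v'). \<forall>z\<in>X. simple_root ?v' z h = (if z = y then 1 else 2)"
      by (rule root_datum_coweight[OF X rd'])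
    then obtain k where k: "k \<in> carrier (hspace ?v')" "\<And>z. z \<in> X \<Longrightarrow> simple_root ?v' z k = (if z = y then 1 else 2)"
      by blast
    have kv: "k \<in> carrier (hspace v)" using k(1) by simp
    have "root_shift v x y = 0" using False axy by (simp add: root_shift_def)
    then have "simple_root v y k = 1"
      using root[OF y kv] k(2)[OF y] by simp
    then have "bracket ?L' ((-1) \<odot>\<^bsub>?L'\<^esub> \<iota>' k) (f y) = f y"
      using R.bracket_cartan_f[OF kv y] \<iota>_eq[OF kv] R.f_closed[OF y] R.cartan_closed[OF kv]
      by (simp add: R'.bracket_scale_left)
    then obtain c where c: "f y = c \<odot>\<^bsub>?L'\<^esub> f' y"
      using Fl.simple_eigenspace[OF y k R.f_closed[OF y]] by blast
    \<comment> \<open>For distinct indices this is the half-baked relation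
      \<open>[e' x, f' y] = 0\<close> of the reflected datum.\<close>
    have "bracket ?L' (f x) (f y) = \<zero>\<^bsub>?L'\<^esub>"
      unfolding c d using x y False R'.bracket_e_f[OF x y]
      by (simp add: R'.bracket_scale_left R'.bracket_scale_right)
    then have "\<zero>\<^bsub>?L'\<^esub> = koszul_sign (parity v y) (parity v x) \<odot>\<^bsub>?L'\<^esub> (cartan v y x \<odot>\<^bsub>?L'\<^esub> f x)"
      using R'.bracket_jacobi[OF R.e_part[OF y] R.f_part[OF x] R.f_closed[OF y]] x y False a
      by (simp add: R.bracket_e_f R.bracket_e_f_same R.bracket_f_cartan cartan_def)
    then have "(koszul_sign (parity v y) (parity v x) * cartan v y x) \<odot>\<^bsub>?L'\<^esub> f x = \<zero>\<^bsub>?L'\<^esub>"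
      using R.f_closed[OF x] by simp
    then have "cartan v y x = 0 \<or> f x = \<zero>\<^bsub>?L'\<^esub>"
      using R'.scale_eq_zero_iff[OF R.f_closed[OF x]] by simp
    moreover have "f x \<noteq> \<zero>\<^bsub>?L'\<^esub>"
    proof
      assume "f x = \<zero>\<^bsub>?L'\<^esub>"
      then have "\<iota> (coroot v x) = \<zero>\<^bsub>?L'\<^esub>"
        using R.bracket_e_f_same[OF x] R.e_closed[OF x] by simp
      then have "?q' (cartan_embedding X ?v' (coroot v x)) = \<zero>\<^bsub>?L'\<^esub>"
        using \<iota>_eq[OF a[OF x]] by (simp add: \<iota>'_def)
      moreover have "\<zero>\<^bsub>?L'\<^esub> = I ?v'" by (simp add: super_quotient_def)
      moreover have a': "coroot v x \<in> carrier (hspace ?v')" using a[OF x] by simp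
      ultimately have "cartan_embedding X ?v' (coroot v x) \<in> I ?v'"
        using G'.quotient_zero_iff[OF Iv' G'.cartan_closed[OF a']] by simp
      then have "cartan_embedding X ?v' (coroot v x) = \<zero>\<^bsub>?G'\<^esub>" using triv a' by blast
      then have "coroot v x = \<zero>\<^bsub>hspace v\<^esub>" using cartan_embedding_zero[OF X rd' a'] by simp
      then show False using coroot_nonzero[OF X rd x] by blast
    qed
    ultimately show ?thesis by blast
  qed
qed

theorem theorem3p3p1:
  fixes X :: "'x set" and R :: "('h, 'x) root_datum set"
  assumes "finite X" and "root_component X R"
  shows "admissible X R \<longleftrightarrow> weakly_symmetric X R"
  using weakly_symmetric_imp_admissible[OF assms] admissible_imp_weakly_symmetric[OF assms] by blast

end
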